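(* Let $\langle X\mid R\rangle$ be a finite group presentation, with Dehn function $\Delta$, and let $\Delta_0(n)=\max\{\mathrm{Area}(c): c \text{ is a proper corolla and } |c|\leqslant n\}$. Then $\langle X\mid R\rangle$ has a solvable Word Problem if and only if the function $\Delta_0$ is bounded above by a computable function, if and only if the function $\Delta_0$ is computable. Moreover $\Delta$ is computable or bounded above by a computable function if and only if the same is true for $\Delta_0$.
   Context: $R$ is a set of non-empty cyclically reduced words with $R^{-1}\subset R$. A relator is a reduced word in the normal closure of $R$ in the free group $\mathcal F(X)$ (identified with the set of reduced words). $\mathrm{Area}(w)$ is the least $k$ such that the relator $w$ is the reduced form of a product of $k$ conjugates of elements of $R$. $\Delta(n)=\max\{\mathrm{Area}(w): w\text{ a relator},\ |w|\leqslant n\}$. The maximum of the empty set is $0$. The Word Problem is solvable if the set of relators is a decidable subset of $\mathcal F(X)$. For a word $u$ there are unique reduced $t$ and cyclically reduced $w$ such that the reduced form of $u$ is the word $twt^{-1}$; $w$ is the cyclically reduced form of $u$; $\pi(u,v)$ is the cyclically reduced form of $uv$. $w_2w_1$ is a cyclic conjugate of $w_1w_2$; $w_1uw_2$ is an insertion of $u$ into $w_1w_2$. $C_1$ is the set of cyclic conjugates of elements of $R$; for $k>1$, $C_k$ is the set of cyclic conjugates of the words $\pi(u,v)$ where (1) $u\in C_{k-1},v\in C_1$ or $u\in C_1,v\in C_{k-1}$; (2) $u\ne v^{-1}$; (3) either $u^{-1}$ is a prefix of $v$, or $v^{-1}$ is a suffix of $u$, or the last letter of $u$ is the inverse of the first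 of $v$ but the first letter of $u$ is not the inverse of the last of $v$. $D_1$ is the set of reduced words of the form $uwu^{-1}$, $w\in C_1$ ($u$ possibly empty); for $k>1$, $D_k$ is the set of reduced words which are of the form $uwu^{-1}$ with $w\in C_k$ ($u$ possibly empty) or are insertions of a word of $D_i$ into a word of $D_j$ with $i,j\geqslant1$, $i+j=k$. A proper corolla is a word $c$ such that, for some $k$, $c\in C_k$ and $c\notin D_h$ for all $h<k$. *)

theory Defs
  imports "HOL-Algebra.Coset" "HOL-Library.Sublist" "HOL-Library.Nat_Bijection"
begin

text \<open>
  Partial recursive functions in the usual sense (zero, successor, projections, composition,
  primitive recursion, unbounded minimisation). The relation \<open>rec_eval p xs y\<close> says that the
  program \<open>p\<close> halts on the argument tuple \<open>xs\<close> with result \<open>y\<close>. In a run each occurrence of a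
  subprogram only sees argument tuples of one length, so no arities are recorded in the syntax.
  Primitive recursion and minimisation act on the first argument.
\<close>

datatype recf = Zero | Succ | Proj nat | Comp recf "recf list" | Prim recf recf | Mu recf

inductive rec_eval :: "recf \<Rightarrow> nat list \<Rightarrow> nat \<Rightarrow> bool" where
  zero: "rec_eval Zero xs 0"
| succ: "rec_eval Succ [x] (Suc x)"
| proj: "i < length xs \<Longrightarrow> rec_eval (Proj i) xs (xs ! i)"
| comp: "list_all2 (\<lambda>g y. rec_eval g xs y) gs ys \<Longrightarrow> rec_eval f ys z \<Longrightarrow> rec_eval (Comp f gs) xs z"
| prim_0: "rec_eval f xs y \<Longrightarrow> rec_eval (Prim f g) (0 # xs) y"
| prim_Suc: "rec_eval (Prim f g) (n # xs) y \<Longrightarrow> rec_eval g (n # y # xs) z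
    \<Longrightarrow> rec_eval (Prim f g) (Suc n # xs) z"
| mu: "rec_eval f (n # xs) 0 \<Longrightarrow> (\<forall>m<n. \<exists>y. rec_eval f (m # xs) y \<and> y > 0)
    \<Longrightarrow> rec_eval (Mu f) xs n"

definition computable :: "(nat \<Rightarrow> nat) \<Rightarrow> bool" where
  "computable f \<longleftrightarrow> (\<exists>p. \<forall>n. rec_eval p [n] (f n))"

definition computably_bounded :: "(nat \<Rightarrow> nat) \<Rightarrow> bool" where
  "computably_bounded f \<longleftrightarrow> (\<exists>g. computable g \<and> (\<forall>n. f n \<le> g n))"

text \<open>Meaningful only when \<open>code\<close> is injective on \<open>A\<close>; values of \<open>f\<close> off the image of \<open>A\<close> are irrelevant.\<close>

definition decidable_subset :: "('b \<Rightarrow> nat) \<Rightarrow> 'b set \<Rightarrow> 'b set \<Rightarrow> bool" where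
  "decidable_subset code A S \<longleftrightarrow>
    S \<subseteq> A \<and> (\<exists>f. computable f \<and> (\<forall>a\<in>A. f (code a) = (if a \<in> S then 1 else 0)))"

text \<open>The letter \<open>(x, True)\<close> stands for the generator \<open>x\<close> and \<open>(x, False)\<close> for its inverse.\<close>

type_synonym 'a letter = "'a \<times> bool"
type_synonym 'a word = "'a letter list"

definition linv :: "'a letter \<Rightarrow> 'a letter" where
  "linv l = (fst l, \<not> snd l)"

definition winv :: "'a word \<Rightarrow> 'a word" where
  "winv w = rev (map linv w)"

definition words :: "'a set \<Rightarrow> 'a word set" where
  "words X = lists (X \<times> UNIV)"

fun reduced :: "'a word \<Rightarrow> bool" where
  "reduced (l # m # w) \<longleftrightarrow> m \<noteq> linv l \<and> reduced (m # w)"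
| "reduced _ \<longleftrightarrow> True"

fun cancel_cons :: "'a letter \<Rightarrow> 'a word \<Rightarrow> 'a word" where
  "cancel_cons l [] = [l]"
| "cancel_cons l (m # w) = (if m = linv l then w else l # m # w)"

definition reduced_form :: "'a word \<Rightarrow> 'a word" where
  "reduced_form w = foldr cancel_cons w []"

definition cyclically_reduced :: "'a word \<Rightarrow> bool" where
  "cyclically_reduced w \<longleftrightarrow> reduced w \<and> (w \<noteq> [] \<longrightarrow> last w \<noteq> linv (hd w))"

definition cyc_reduced_form :: "'a word \<Rightarrow> 'a word" where
  "cyc_reduced_form u =
    (THE w. cyclically_reduced w \<and> (\<exists>t. reduced t \<and> reduced_form u = t @ w @ winv t))"

definition cyclic_conjugates :: "'a word \<Rightarrow> 'a word set" where
  "cyclic_conjugates w = {w2 @ w1 | w1 w2. w = w1 @ w2}"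

definition free_group :: "'a set \<Rightarrow> 'a word monoid" where
  "free_group X =
    \<lparr>carrier = {w \<in> words X. reduced w}, mult = (\<lambda>u v. reduced_form (u @ v)), one = []\<rparr>"

definition normal_closure :: "('g, 'm) monoid_scheme \<Rightarrow> 'g set \<Rightarrow> 'g set" where
  "normal_closure G S = \<Inter>{N. N \<lhd> G \<and> S \<subseteq> N}"

definition group_presentation :: "'a set \<Rightarrow> 'a word set \<Rightarrow> bool" where
  "group_presentation X R \<longleftrightarrow>
    R \<subseteq> words X \<and> (\<forall>r\<in>R. r \<noteq> [] \<and> cyclically_reduced r) \<and> winv ` R \<subseteq> R"

definition relators :: "'a set \<Rightarrow> 'a word set \<Rightarrow> 'a word set" where
  "relators X R = normal_closure (free_group X) R"

definition area :: "'a set \<Rightarrow> 'a word set \<Rightarrow> 'a word \<Rightarrow> nat" where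
  "area X R w = (LEAST k. \<exists>ps. length ps = k \<and> set ps \<subseteq> words X \<times> R \<and>
    w = reduced_form (concat (map (\<lambda>(u, r). u @ r @ winv u) ps)))"

definition max0 :: "nat set \<Rightarrow> nat" where
  "max0 A = (if A = {} then 0 else Max A)"

definition dehn :: "'a set \<Rightarrow> 'a word set \<Rightarrow> nat \<Rightarrow> nat" where
  "dehn X R n = max0 {area X R w | w. w \<in> relators X R \<and> length w \<le> n}"

definition word_code :: "('a \<Rightarrow> nat) \<Rightarrow> 'a word \<Rightarrow> nat" where
  "word_code e w = list_encode (map (\<lambda>(x, b). 2 * e x + of_bool b) w)"

text \<open>
  For finite \<open>X\<close> the choice of the numbering \<open>e\<close> of the generators is immaterial, since any two
  numberings differ by a function with finite domain. The notion is only meant for finite \<open>X\<close>.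
\<close>

definition solvable_word_problem :: "'a set \<Rightarrow> 'a word set \<Rightarrow> bool" where
  "solvable_word_problem X R \<longleftrightarrow>
    (\<exists>e. inj_on e X \<and> decidable_subset (word_code e) (carrier (free_group X)) (relators X R))"

definition corolla_product :: "'a word \<Rightarrow> 'a word \<Rightarrow> 'a word" where
  "corolla_product u v = cyc_reduced_form (u @ v)"

definition composable :: "'a word \<Rightarrow> 'a word \<Rightarrow> bool" where
  "composable u v \<longleftrightarrow> u \<noteq> winv v \<and>
    (prefix (winv u) v \<or> suffix (winv v) u \<or>
     (u \<noteq> [] \<and> v \<noteq> [] \<and> last u = linv (hd v) \<and> hd u \<noteq> linv (last v)))"

fun C_words :: "'a word set \<Rightarrow> nat \<Rightarrow> 'a word set" where
  "C_words R 0 = {}"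
| "C_words R (Suc 0) = (\<Union>r\<in>R. cyclic_conjugates r)"
| "C_words R (Suc (Suc k)) =
    (\<Union>{cyclic_conjugates (corolla_product u v) | u v.
      (u \<in> C_words R (Suc k) \<and> v \<in> C_words R (Suc 0) \<or>
       u \<in> C_words R (Suc 0) \<and> v \<in> C_words R (Suc k)) \<and> composable u v})"

inductive in_D :: "'a set \<Rightarrow> 'a word set \<Rightarrow> nat \<Rightarrow> 'a word \<Rightarrow> bool"
  for X :: "'a set" and R :: "'a word set" where
  conjugate: "k \<ge> 1 \<Longrightarrow> w \<in> C_words R k \<Longrightarrow> u \<in> words X \<Longrightarrow> reduced (u @ w @ winv u)
    \<Longrightarrow> in_D X R k (u @ w @ winv u)"
| insertion: "i \<ge> 1 \<Longrightarrow> j \<ge> 1 \<Longrightarrow> in_D X R i u \<Longrightarrow> in_D X R j (w1 @ w2) \<Longrightarrow> reduced (w1 @ u @ w2)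
    \<Longrightarrow> in_D X R (i + j) (w1 @ u @ w2)"

definition D_words :: "'a set \<Rightarrow> 'a word set \<Rightarrow> nat \<Rightarrow> 'a word set" where
  "D_words X R k = {w. in_D X R k w}"

definition proper_corolla :: "'a set \<Rightarrow> 'a word set \<Rightarrow> 'a word \<Rightarrow> bool" where
  "proper_corolla X R c \<longleftrightarrow>
    (\<exists>k\<ge>1. c \<in> C_words R k \<and> (\<forall>h. 1 \<le> h \<and> h < k \<longrightarrow> c \<notin> D_words X R h))"

definition dehn0 :: "'a set \<Rightarrow> 'a word set \<Rightarrow> nat \<Rightarrow> nat" where
  "dehn0 X R n = max0 {area X R c | c. proper_corolla X R c \<and> length c \<le> n}"

lemma linv_linv [simp]: "linv (linv l) = l"
  by (simp add: linv_def)

lemma linv_neq [simp]: "linv l \<noteq> l" "l \<noteq> linv l"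
  by (auto simp: linv_def prod_eq_iff)

lemma winv_simps [simp]:
  "winv [] = []" "winv (l # w) = winv w @ [linv l]" "winv (u @ v) = winv v @ winv u"
  by (simp_all add: winv_def)

lemma winv_winv [simp]: "winv (winv w) = w"
  by (induction w) auto

lemma length_winv [simp]: "length (winv w) = length w"
  by (simp add: winv_def)

lemma winv_words: "w \<in> words X \<Longrightarrow> winv w \<in> words X"
  by (auto simp: words_def winv_def linv_def in_lists_conv_set)

lemma reduced_Cons: "reduced (l # w) \<longleftrightarrow> reduced w \<and> (w \<noteq> [] \<longrightarrow> hd w \<noteq> linv l)"
  by (cases w) auto

lemma reduced_cancel_cons: "reduced w \<Longrightarrow> reduced (cancel_cons l w)"
  by (cases w) (auto simp: reduced_Cons)

lemma reduced_form_simps [simp]: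
  "reduced_form [] = []" "reduced_form (l # w) = cancel_cons l (reduced_form w)"
  by (simp_all add: reduced_form_def)

lemma reduced_reduced_form: "reduced (reduced_form w)"
  by (induction w) (auto intro: reduced_cancel_cons)

lemma reduced_form_reduced: "reduced w \<Longrightarrow> reduced_form w = w"
proof (induction w)
  case (Cons l w)
  then show ?case by (cases w) auto
qed auto

lemma reduced_form_words: "w \<in> words X \<Longrightarrow> reduced_form w \<in> words X"
proof (induction w)
  case (Cons l w)
  then show ?case by (cases "reduced_form w") (auto simp: words_def)
qed (simp add: words_def)

lemma cancel_cons_linv: "reduced w \<Longrightarrow> cancel_cons l (cancel_cons (linv l) w) = w"
proof (cases w)
  case (Cons m v)
  assume "reduced w"
  with Cons show ?thesis by (cases v) auto
qed auto

lemma reduced_form_append_left: "reduced_form (reduced_form u @ v) = reduced_form (u @ v)"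
proof (induction u)
  case (Cons l u)
  have *: "reduced_form (cancel_cons l w @ v) = cancel_cons l (reduced_form (w @ v))" for w
    by (cases w) (auto simp: cancel_cons_linv reduced_reduced_form)
  show ?case using Cons by (simp add: *)
qed auto

lemma reduced_form_append_right: "reduced_form (u @ reduced_form v) = reduced_form (u @ v)"
  by (induction u) (auto simp: reduced_form_reduced reduced_reduced_form)

lemma reduced_form_winv_left: "reduced_form (winv w @ w) = []"
proof (induction w)
  case (Cons l w)
  have "reduced_form (winv w @ linv l # l # w) = reduced_form (winv w @ reduced_form (linv l # l # w))"
    by (rule reduced_form_append_right [symmetric])
  also have "reduced_form (linv l # l # w) = reduced_form w"
    using cancel_cons_linv [of "reduced_form w" "linv l"] by (simp add: reduced_reduced_form)
  finally show ?case using Cons by (simp add: reduced_form_append_right)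
qed auto

lemma group_free_group: "group (free_group X)"
proof (rule groupI)
  fix x y z
  assume "x \<in> carrier (free_group X)" "y \<in> carrier (free_group X)" "z \<in> carrier (free_group X)"
  show "x \<otimes>\<^bsub>free_group X\<^esub> y \<otimes>\<^bsub>free_group X\<^esub> z = x \<otimes>\<^bsub>free_group X\<^esub> (y \<otimes>\<^bsub>free_group X\<^esub> z)"
    by (simp add: free_group_def reduced_form_append_left reduced_form_append_right)
next
  fix x y
  assume "x \<in> carrier (free_group X)" "y \<in> carrier (free_group X)"
  then show "x \<otimes>\<^bsub>free_group X\<^esub> y \<in> carrier (free_group X)"
    using reduced_form_words [of "x @ y" X]
    by (auto simp: free_group_def reduced_reduced_form words_def)
next
  show "\<one>\<^bsub>free_group X\<^esub> \<in> carrier (free_group X)"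
    by (simp add: free_group_def words_def)
next
  fix x
  assume "x \<in> carrier (free_group X)"
  then show "\<one>\<^bsub>free_group X\<^esub> \<otimes>\<^bsub>free_group X\<^esub> x = x"
    by (simp add: free_group_def reduced_form_reduced)
next
  fix x
  assume x: "x \<in> carrier (free_group X)"
  show "\<exists>y\<in>carrier (free_group X). y \<otimes>\<^bsub>free_group X\<^esub> x = \<one>\<^bsub>free_group X\<^esub>"
  proof
    show "reduced_form (winv x) \<in> carrier (free_group X)"
      using x by (simp add: free_group_def reduced_reduced_form reduced_form_words winv_words)
    show "reduced_form (winv x) \<otimes>\<^bsub>free_group X\<^esub> x = \<one>\<^bsub>free_group X\<^esub>"
      by (simp add: free_group_def reduced_form_append_left reduced_form_winv_left)
  qed
qed

lemma reduced_append: "reduced (u @ v) \<Longrightarrow> reduced u \<and> reduced v"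
  by (induction u) (auto simp: reduced_Cons split: if_splits)

lemma ex_cyclic_decomposition:
  assumes "reduced u"
  shows "\<exists>t w. reduced t \<and> cyclically_reduced w \<and> u = t @ w @ winv t"
  using assms
proof (induction u rule: length_induct)
  case (1 u)
  show ?case
  proof (cases "cyclically_reduced u")
    case True
    then show ?thesis by (intro exI [of _ "[]"] exI [of _ u]) auto
  next
    case False
    then have ne: "u \<noteq> []" and last: "last u = linv (hd u)"
      using 1 by (auto simp: cyclically_reduced_def)
    then have "tl u \<noteq> []" by (cases u) auto
    with ne last obtain l v where u: "u = l # v @ [linv l]"
      by (metis append_butlast_last_id last_tl list.collapse)
    then have "reduced v"
      using 1 reduced_append [of v "[linv l]"] by (auto simp: reduced_Cons)
    then obtain t w where tw: "cyclically_reduced w" "v = t @ w @ winv t"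
      using 1 u by (metis length_Cons length_append_singleton less_Suc_eq less_SucI)
    then have "u = (l # t) @ w @ winv (l # t)" using u by simp
    moreover from this have "reduced (l # t)"
      using 1 reduced_append by metis
    ultimately show ?thesis using tw by blast
  qed
qed

lemma cyclic_decomposition_unique_aux:
  assumes "t @ w @ winv t = t' @ w' @ winv t'" "cyclically_reduced w" "length t \<le> length t'"
  shows "t = t' \<and> w = w'"
proof -
  obtain s where s: "t' = t @ s"
    using assms by (metis append_eq_append_conv_if append_take_drop_id)
  then have w: "w = s @ w' @ winv s" using assms by simp
  have "s = []"
  proof (cases s)
    case (Cons l v)
    then show ?thesis using w assms by (simp add: cyclically_reduced_def)
  qed auto
  then show ?thesis using s w by simp
qed

lemma cyclic_decomposition_unique:
  assumes "t @ w @ winv t = t' @ w' @ winv t'" "cyclically_reduced w" "cyclically_reduced w'"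
  shows "t = t' \<and> w = w'"
  using cyclic_decomposition_unique_aux assms by (metis nat_le_linear)

lemma cyc_reduced_form:
  "cyclically_reduced (cyc_reduced_form u) \<and>
    (\<exists>t. reduced t \<and> reduced_form u = t @ cyc_reduced_form u @ winv t)"
  unfolding cyc_reduced_form_def
proof (rule theI')
  show "\<exists>!w. cyclically_reduced w \<and> (\<exists>t. reduced t \<and> reduced_form u = t @ w @ winv t)"
    using ex_cyclic_decomposition [OF reduced_reduced_form [of u]] cyclic_decomposition_unique
    by metis
qed

end

theory Submission
  imports Defs
begin

text \<open>
  A word of area \<open>k\<close> bounds a planar diagram with \<open>k\<close> faces. Growing a disc inside a minimal diagram
  face by face shows that a nonempty relator of area \<open>k\<close> lies in \<open>D\<^sub>k\<close>: a disc that cannot be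
  enlarged is, up to a tail, the whole diagram, or else the boundary word splits into two shorter
  relators. So the area of \<open>w\<close> is the least \<open>k\<close> with \<open>w \<in> D\<^sub>k\<close>, the proper corollas are the
  \<open>c \<in> C\<^sub>k\<close> of area exactly \<open>k\<close>, and cutting a relator into proper corollas gives
  \<open>\<Delta>\<^sub>0 n \<le> \<Delta> n \<le> n \<Delta>\<^sub>0 n\<close>. Moreover \<open>w\<close> has area at most \<open>k + 1\<close> iff its area is at most \<open>k\<close> or
  inserting a cyclic conjugate of some \<open>r \<in> R\<close> somewhere into \<open>w\<close> yields a word of area at most \<open>k\<close>.
  Hence, for a finite presentation, the area is at most \<open>k\<close> and \<open>c \<in> C\<^sub>k\<close> are decidable conditions. A
  computable bound for \<open>\<Delta>\<close> therefore solves the word problem, and a solution of the word problem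
  allows both maxima to be found by search.
\<close>

subsection \<open>Free groups and conjugation\<close>

text \<open>No diagram is ever constructed. \<open>filling R n x\<close> stands for a diagram with
  at most \<open>n\<close> faces, and a disc inside it is a factor from some
  \<open>C_words R i\<close> of a conjugate of the boundary. What planarity would supply, namely
  what lies behind a given boundary edge, is extracted from membership in D by induction on its
  rules. Growing a disc therefore needs the attached words to lie in D already; strong induction on
  the number of faces provides this, because the disc itself takes at least one face. The second
  obstacle is that the definitions demand reduced words and special overlaps at every stage, whereas
  the argument produces arbitrary products. Maximal cancellations, maximal common arcs and
  decorations of minimal size bring these products into the required form. The factor
  \<open>n\<close> between the two Dehn functions counts corollas: an insertion divides the letters
  of a word among two nonempty words, so there is at most one corolla per letter. Computability
  concerns numbers and correctness concerns words, so each algorithm is written for an arbitrary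
  type of letters, verified on words, and transported to numbers by an injective renaming.\<close>

typedef 'a fgrp = "{w :: 'a word. reduced w}" morphisms word_of Abs_fgrp
  by (rule exI [of _ "[]"]) simp

definition fg :: "'a word \<Rightarrow> 'a fgrp" where
  "fg w = Abs_fgrp (reduced_form w)"

lemma word_of_fg: "word_of (fg w) = reduced_form w"
  by (simp add: fg_def Abs_fgrp_inverse reduced_reduced_form)

lemma fg_eq_iff: "fg u = fg v \<longleftrightarrow> reduced_form u = reduced_form v"
  by (metis word_of_fg fg_def)

lemma fg_word_of: "fg (word_of x) = x"
  using word_of [of x] by (simp add: fg_def reduced_form_reduced word_of_inverse)

lemma fg_surj: obtains w where "reduced w" "x = fg w"
  using word_of [of x] fg_word_of [of x] by force

lemma reduced_form_winv_right: "reduced_form (w @ winv w) = []"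
  using reduced_form_winv_left [of "winv w"] by simp

lemma reduced_form_winv_cong:
  assumes "reduced_form u = reduced_form v"
  shows "reduced_form (winv u) = reduced_form (winv v)"
proof -
  have "reduced_form (winv u) = reduced_form (winv u @ v @ winv v)"
    by (metis append_Nil2 reduced_form_append_right reduced_form_simps(1) reduced_form_winv_right)
  also have "\<dots> = reduced_form ((winv u @ u) @ winv v)"
    by (metis append.assoc assms reduced_form_append_left reduced_form_append_right)
  also have "\<dots> = reduced_form (winv v)"
    by (metis append_Nil reduced_form_append_left reduced_form_winv_left)
  finally show ?thesis .
qed

declare add_uminus_conv_diff [simp del] \<comment> \<open>it would loop with \<open>group_norm\<close>\<close>

lemmas group_norm = diff_conv_add_uminus add.assoc minus_add

text \<open>The class \<open>group_add\<close> is non-commutative, so the free group can be written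
  additively. With \<open>group_norm\<close>, which associates to the right and pushes signs onto
  single terms, \<open>simp\<close> settles most identities between conjugates.\<close>

instantiation fgrp :: (type) group_add
begin

definition zero_fgrp :: "'a fgrp" where "0 = fg []"
definition plus_fgrp :: "'a fgrp \<Rightarrow> 'a fgrp \<Rightarrow> 'a fgrp" where "x + y = fg (word_of x @ word_of y)"
definition uminus_fgrp :: "'a fgrp \<Rightarrow> 'a fgrp" where "- x = fg (winv (word_of x))"
definition minus_fgrp :: "'a fgrp \<Rightarrow> 'a fgrp \<Rightarrow> 'a fgrp" where "x - y = x + - y" for x y :: "'a fgrp"

instance
proof
  fix a b c :: "'a fgrp"
  show "a + b + c = a + (b + c)"
    by (simp add: plus_fgrp_def fg_eq_iff word_of_fg reduced_form_append_left reduced_form_append_right)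
  show "0 + a = a" "a + 0 = a"
    by (simp_all add: plus_fgrp_def zero_fgrp_def word_of_fg fg_word_of)
  show "- a + a = 0"
    by (simp add: plus_fgrp_def uminus_fgrp_def zero_fgrp_def fg_eq_iff word_of_fg
        reduced_form_append_left reduced_form_winv_left)
  show "a + - b = a - b"
    by (simp add: minus_fgrp_def)
qed

end

lemma fg_Nil [simp]: "fg [] = 0"
  by (simp add: zero_fgrp_def)

lemma fg_append [simp]: "fg (u @ v) = fg u + fg v"
  by (simp add: plus_fgrp_def fg_eq_iff word_of_fg reduced_form_append_left reduced_form_append_right)

lemma fg_winv [simp]: "fg (winv w) = - fg w"
  unfolding uminus_fgrp_def fg_eq_iff word_of_fg
  by (rule reduced_form_winv_cong) (simp add: reduced_form_reduced reduced_reduced_form)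

lemma fg_Cons: "NO_MATCH [] w \<Longrightarrow> fg (l # w) = fg [l] + fg w"
  using fg_append [of "[l]" w] by simp

lemma fg_linv [simp]: "fg [linv l] = - fg [l]"
  using fg_winv [of "[l]"] by simp

lemma fg_reduced_eq: "fg u = fg v \<Longrightarrow> reduced u \<Longrightarrow> reduced v \<Longrightarrow> u = v"
  by (simp add: fg_eq_iff reduced_form_reduced)

lemma fg_reduced_form [simp]: "fg (reduced_form w) = fg w"
  by (simp add: fg_eq_iff reduced_form_reduced reduced_reduced_form)

lemma fg_eq_0_iff: "fg w = 0 \<longleftrightarrow> reduced_form w = []"
  using fg_eq_iff [of w "[]"] by simp

lemma fg_reduced_eq_0: "reduced w \<Longrightarrow> fg w = 0 \<longleftrightarrow> w = []"
  by (simp add: fg_eq_0_iff reduced_form_reduced)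

lemma eq_linv_iff: "l = linv m \<longleftrightarrow> m = linv l"
  by (metis linv_linv)

section \<open>Reduced words and cancellation at a junction\<close>

lemma reduced_append_iff:
  "reduced (u @ v) \<longleftrightarrow> reduced u \<and> reduced v \<and> (u \<noteq> [] \<and> v \<noteq> [] \<longrightarrow> last u \<noteq> linv (hd v))"
proof (induction u)
  case (Cons l u)
  then show ?case
    by (cases "u = []"; cases "v = []") (auto simp: reduced_Cons eq_linv_iff)
qed auto

lemma hd_winv: "w \<noteq> [] \<Longrightarrow> hd (winv w) = linv (last w)"
  by (simp add: winv_def hd_rev last_map)

lemma last_winv: "w \<noteq> [] \<Longrightarrow> last (winv w) = linv (hd w)"
  by (simp add: winv_def last_rev hd_map)

lemma winv_eq_Nil [simp]: "winv w = [] \<longleftrightarrow> w = []"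
  by (simp add: winv_def)

lemma reduced_winv [simp]: "reduced (winv w) \<longleftrightarrow> reduced w"
proof -
  have "reduced w \<Longrightarrow> reduced (winv w)" for w :: "'a word"
    by (induction w) (auto simp: reduced_append_iff reduced_Cons last_winv, metis linv_linv)
  from this [of w] this [of "winv w"] show ?thesis by auto
qed

text \<open>Reduced words cancel only at their junction, and \<open>s\<close> collects everything
  that cancels; peeling off the last letter of \<open>u\<close> finds it.\<close>

lemma max_cancellation:
  assumes "reduced u" "reduced v"
  obtains u' s v' where "u = u' @ s" "v = winv s @ v'" "reduced (u' @ v')"
proof -
  have "\<exists>u' s v'. u = u' @ s \<and> v = winv s @ v' \<and> reduced (u' @ v')"
    using assms
  proof (induction u arbitrary: v rule: rev_induct)
    case Nil
    then show ?case by (intro exI [of _ "[]"] exI [of _ "[]"] exI [of _ v]) simp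
  next
    case (snoc l u)
    show ?case
    proof (cases "v \<noteq> [] \<and> hd v = linv l")
      case True
      then obtain v1 where v: "v = linv l # v1" by (cases v) auto
      with snoc.prems have "reduced u" "reduced v1"
        by (auto simp: reduced_Cons reduced_append_iff)
      with snoc.IH [of v1] obtain u' s v' where "u = u' @ s" "v1 = winv s @ v'" "reduced (u' @ v')"
        by blast
      with v show ?thesis
        by (intro exI [of _ u'] exI [of _ "s @ [l]"] exI [of _ v']) simp
    next
      case False
      then have "reduced ((u @ [l]) @ v)"
        using snoc.prems by (subst reduced_append_iff) (auto simp: eq_linv_iff [of l])
      then show ?thesis
        by (intro exI [of _ "u @ [l]"] exI [of _ "[]"] exI [of _ v]) simp
    qed
  qed
  with that show thesis by blast
qed

lemma cyclically_reduced_append: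
  "cyclically_reduced (u @ v) \<Longrightarrow> cyclically_reduced (v @ u)"
  by (cases "u = []"; cases "v = []")
    (auto simp: cyclically_reduced_def reduced_append_iff)

section \<open>Rotations and conjugacy in the free group\<close>

definition rot :: "'b list \<Rightarrow> 'b list \<Rightarrow> bool" where
  "rot u v \<longleftrightarrow> (\<exists>n. v = rotate n u)"

lemma rot_append: "rot (u @ v) (v @ u)"
  unfolding rot_def by (rule exI [of _ "length u"]) (simp add: rotate_append)

lemma rotE:
  assumes "rot u v" obtains x y where "u = x @ y" "v = y @ x"
  using assms that unfolding rot_def by (metis append_take_drop_id rotate_drop_take)

lemma rot_trans: "rot u v \<Longrightarrow> rot v w \<Longrightarrow> rot u w"
  unfolding rot_def by (metis rotate_rotate)

lemma rot_sym: "rot u v \<Longrightarrow> rot v u"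
  by (metis rotE rot_append)

lemma rot_refl [simp]: "rot u u"
  unfolding rot_def by (rule exI [of _ 0]) simp

lemma cyclic_conjugates_iff: "v \<in> cyclic_conjugates u \<longleftrightarrow> rot u v"
  unfolding cyclic_conjugates_def by (blast intro: rot_append elim: rotE)

lemma rot_cyclically_reduced: "rot u v \<Longrightarrow> cyclically_reduced u \<Longrightarrow> cyclically_reduced v"
  by (metis rotE cyclically_reduced_append)

lemma rot_length: "rot u v \<Longrightarrow> length v = length u"
  by (auto simp: rot_def)

lemma rot_Nil: "rot u v \<Longrightarrow> u = [] \<longleftrightarrow> v = []"
  using rot_length by fastforce

definition fconj :: "'a fgrp \<Rightarrow> 'a fgrp \<Rightarrow> bool" where
  "fconj x y \<longleftrightarrow> (\<exists>g. x = g + y - g)"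

lemma fconjI: "x = g + y - g \<Longrightarrow> fconj x y"
  by (auto simp: fconj_def)

lemma fconj_refl [simp]: "fconj x x"
  by (rule fconjI [of _ 0]) simp

lemma fconj_sym: "fconj x y \<Longrightarrow> fconj y x"
  unfolding fconj_def
proof (elim exE)
  fix g assume "x = g + y - g"
  then show "\<exists>g. y = g + x - g" by (intro exI [of _ "- g"]) (simp add: group_norm)
qed

lemma fconj_trans: "fconj x y \<Longrightarrow> fconj y z \<Longrightarrow> fconj x z"
  unfolding fconj_def
proof (elim exE)
  fix g h assume "x = g + y - g" "y = h + z - h"
  then show "\<exists>g. x = g + z - g"
    by (intro exI [of _ "g + h"]) (simp add: group_norm)
qed

lemma fconj_rot: "rot u v \<Longrightarrow> fconj (fg u) (fg v)"
proof (elim rotE)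
  fix x y assume "u = x @ y" "v = y @ x"
  then show ?thesis by (intro fconjI [of _ "fg x"]) (simp add: group_norm)
qed

text \<open>The classical conjugacy criterion. Among all conjugators carrying a rotation
  \<open>v'\<close> of \<open>v\<close> to \<open>u\<close>, a shortest \<open>g\<close> makes the
  word \<open>g @ v' @ winv g\<close> reduced as it stands, hence equal to \<open>u\<close>, and
  \<open>u\<close> is cyclically reduced only if \<open>g\<close> is empty.\<close>

lemma fconj_cyclically_reduced_imp_rot:
  assumes u: "cyclically_reduced u" and v: "cyclically_reduced v" and "fconj (fg u) (fg v)"
  shows "rot u v"
proof (cases "v = []")
  case True
  with assms show ?thesis
    by (auto simp: fconj_def cyclically_reduced_def fg_reduced_eq_0)
next
  case False
  define P where "P g \<longleftrightarrow> reduced g \<and> (\<exists>v'. rot v v' \<and> fg u = fg g + fg v' - fg g)" for g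
  have "\<exists>g. P g"
    using assms(3) unfolding fconj_def P_def by (metis fg_surj rot_refl)
  then obtain g where g: "P g" and min: "\<And>h. P h \<Longrightarrow> length g \<le> length h"
    using ex_has_least_nat [of P _ length] by metis
  then obtain v' where v': "rot v v'" and eq: "fg u = fg g + fg v' - fg g" and rg: "reduced g"
    unfolding P_def by blast
  have cv': "cyclically_reduced v'" and ne: "v' \<noteq> []"
    using v v' rot_cyclically_reduced rot_Nil False by blast+
  show ?thesis
  proof (cases g rule: rev_cases)
    case Nil
    with eq have "u = v'"
      using u cv' by (auto simp: cyclically_reduced_def intro: fg_reduced_eq)
    with v' show ?thesis using rot_sym by blast
  next
    case (snoc h l)
    have rh: "reduced h" using rg snoc by (simp add: reduced_append_iff)
    have noP: "\<not> P h" using min [of h] snoc by auto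
    \<comment> \<open>If the last letter \<open>l\<close> of \<open>g\<close> cancelled at either
      end of \<open>v'\<close>, it could be absorbed by rotating \<open>v'\<close>, which leaves the
      shorter conjugator \<open>h\<close>.\<close>
    have 1: "hd v' \<noteq> linv l"
    proof
      assume "hd v' = linv l"
      with ne obtain v1 where v1: "v' = linv l # v1" by (cases v') auto
      then have "rot v (v1 @ [linv l])"
        using v' rot_trans rot_append [of "[linv l]" v1] by fastforce
      moreover have "fg u = fg h + fg (v1 @ [linv l]) - fg h"
        using eq snoc v1 fg_append [of "[linv l]" v1] by (simp add: group_norm)
      ultimately show False using noP rh P_def by blast
    qed
    have 2: "last v' \<noteq> l"
    proof
      assume "last v' = l"
      with ne obtain v1 where v1: "v' = v1 @ [l]" by (cases v' rule: rev_cases) auto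
      then have "rot v (l # v1)"
        using v' rot_trans rot_append [of v1 "[l]"] by fastforce
      moreover have "fg u = fg h + fg (l # v1) - fg h"
        using eq snoc v1 fg_append [of "[l]" v1] by (simp add: group_norm)
      ultimately show False using noP rh P_def by blast
    qed
    have "g \<noteq> []" "last g = l" using snoc by auto
    then have "reduced (g @ v' @ winv g)"
      using rg cv' ne 1 2
      by (auto simp: reduced_append_iff cyclically_reduced_def hd_winv eq_linv_iff [of l])
    then have "u = g @ v' @ winv g"
      using u eq by (intro fg_reduced_eq) (auto simp: cyclically_reduced_def group_norm)
    then have False
      using u snoc by (cases h) (auto simp: cyclically_reduced_def)
    then show ?thesis ..
  qed
qed

text \<open>The algebraic substitute for a diagram with at most \<open>n\<close> faces. The zero
  rule holds for every \<open>n\<close>, which makes the notion monotone; the conjugators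
  \<open>g\<close> range over the free group on all letters of the type, which makes it invariant
  under conjugation and independent of \<open>X\<close>.\<close>

inductive filling :: "'a word set \<Rightarrow> nat \<Rightarrow> 'a fgrp \<Rightarrow> bool" for R :: "'a word set" where
  filling_zero: "filling R n 0"
| filling_step: "filling R n x \<Longrightarrow> r \<in> R \<Longrightarrow> filling R (Suc n) (g + fg r - g + x)"

lemma filling_mono: "filling R m x \<Longrightarrow> m \<le> n \<Longrightarrow> filling R n x"
proof (induction arbitrary: n rule: filling.induct)
  case (filling_step m x r g)
  then show ?case by (cases n) (auto intro: filling.filling_step)
qed (auto intro: filling_zero)

lemma filling_0_iff: "filling R 0 x \<longleftrightarrow> x = 0"
  by (auto elim: filling.cases intro: filling_zero)

lemma filling_add: "filling R m x \<Longrightarrow> filling R n y \<Longrightarrow> filling R (m + n) (x + y)"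
proof (induction rule: filling.induct)
  case (filling_zero m)
  then show ?case using filling_mono by fastforce
next
  case (filling_step m x r g)
  then show ?case using filling.filling_step [of R "m + n" "x + y" r g] by (simp add: group_norm)
qed

lemma filling_conj: "filling R n x \<Longrightarrow> filling R n (h + x - h)"
proof (induction rule: filling.induct)
  case (filling_step m x r g)
  then show ?case using filling.filling_step [of R m "h + x - h" r "h + g"] by (simp add: group_norm)
qed (simp add: filling.filling_zero)

lemma filling_fconj: "fconj x y \<Longrightarrow> filling R n x \<longleftrightarrow> filling R n y"
  using filling_conj fconj_sym unfolding fconj_def by metis

text \<open>\<open>x + u + y\<close> is the conjugate \<open>x + u - x\<close> followed by
  \<open>x + y\<close>.\<close>

lemma filling_insert: "filling R i u \<Longrightarrow> filling R j (x + y) \<Longrightarrow> filling R (i + j) (x + u + y)"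
  using filling_add [OF filling_conj [of R i u x], of j "x + y"] by (simp add: group_norm)

lemma filling_swap: "filling R n (x + y) \<longleftrightarrow> filling R n (y + x)"
  by (rule filling_fconj) (auto intro!: fconjI [of _ x] simp: group_norm)

lemma append_eq_split:
  assumes "xs @ ys = w1 @ z # w2"
  obtains (left) a where "xs = w1 @ z # a" "w2 = a @ ys"
        | (right) a where "ys = a @ z # w2" "w1 = xs @ a"
  using assms by (auto simp: append_eq_append_conv2 append_eq_Cons_conv) 

section \<open>Cyclically reduced forms and the sets \<open>C_words\<close>\<close>

lemma fconj_cyc_reduced_form: "fconj (fg u) (fg (cyc_reduced_form u))"
proof -
  from cyc_reduced_form [of u] obtain t where "reduced_form u = t @ cyc_reduced_form u @ winv t"
    by blast
  then have "fg (reduced_form u) = fg t + fg (cyc_reduced_form u) - fg t" by (simp add: group_norm)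
  then show ?thesis by (intro fconjI [of _ "fg t"]) simp
qed

lemma fconj_0_iff: "fconj x y \<Longrightarrow> x = 0 \<longleftrightarrow> y = 0"
proof -
  have "fconj x 0 \<Longrightarrow> x = 0" for x :: "'a fgrp" by (auto simp: fconj_def)
  then show "fconj x y \<Longrightarrow> x = 0 \<longleftrightarrow> y = 0" using fconj_sym by blast
qed

lemma cyc_reduced_form_Nil: "cyc_reduced_form u = [] \<longleftrightarrow> fg u = 0"
  using cyc_reduced_form [of u] fconj_0_iff [OF fconj_cyc_reduced_form [of u]]
  by (auto simp: cyclically_reduced_def fg_reduced_eq_0)

lemma eq_winv_iff_fg: "reduced u \<Longrightarrow> reduced v \<Longrightarrow> u = winv v \<longleftrightarrow> fg u + fg v = 0"
  using fg_reduced_eq [of u "winv v"] by (auto simp: eq_neg_iff_add_eq_0)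

lemma words_append [simp]: "u @ v \<in> words X \<longleftrightarrow> u \<in> words X \<and> v \<in> words X"
  by (auto simp: words_def)

lemma words_Cons: "l # v \<in> words X \<longleftrightarrow> fst l \<in> X \<and> v \<in> words X"
  by (cases l) (auto simp: words_def)

lemma words_rot: "rot u v \<Longrightarrow> u \<in> words X \<Longrightarrow> v \<in> words X"
  by (elim rotE) auto

lemma words_cyc_reduced_form: "u \<in> words X \<Longrightarrow> cyc_reduced_form u \<in> words X"
  using cyc_reduced_form [of u] reduced_form_words [of u X] by auto

lemma C_words_rot:
  assumes "c \<in> C_words R k" "rot c c'"
  shows "c' \<in> C_words R k"
proof -
  have *: "c' \<in> cyclic_conjugates w" if "c \<in> cyclic_conjugates w" for w
    using that assms(2) unfolding cyclic_conjugates_iff by (rule rot_trans)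
  consider "k = 0" | "k = Suc 0" | m where "k = Suc (Suc m)"
    by (metis not0_implies_Suc)
  then show ?thesis
  proof cases
    case 1
    with assms show ?thesis by simp
  next
    case 2
    with assms * show ?thesis unfolding 2 C_words.simps(2) by (blast elim: UN_E)
  next
    case 3
    with assms * show ?thesis unfolding 3 C_words.simps(3) by (blast elim: UnionE)
  qed
qed

lemma C_words_SucE:
  assumes "c \<in> C_words R (Suc (Suc k))"
  obtains u v where "u \<in> C_words R (Suc k) \<and> v \<in> C_words R (Suc 0) \<or>
       u \<in> C_words R (Suc 0) \<and> v \<in> C_words R (Suc k)" "composable u v" "rot (corolla_product u v) c"
proof -
  obtain u v where "c \<in> cyclic_conjugates (corolla_product u v)" "composable u v"
    "u \<in> C_words R (Suc k) \<and> v \<in> C_words R (Suc 0) \<or> u \<in> C_words R (Suc 0) \<and> v \<in> C_words R (Suc k)"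
    using assms unfolding C_words.simps(3) by blast
  then show thesis using that [of u v] by (simp only: cyclic_conjugates_iff)
qed

lemma C_words_SucI:
  assumes "u \<in> C_words R (Suc k)" "v \<in> C_words R (Suc 0)" "composable u v" 
  shows "corolla_product u v \<in> C_words R (Suc (Suc k))"
proof -
  have "corolla_product u v \<in> cyclic_conjugates (corolla_product u v)"
    by (simp add: cyclic_conjugates_iff)
  with assms show ?thesis unfolding C_words.simps(3) by (intro UnionI) blast+
qed

locale presentation =
  fixes X :: "'a set" and R :: "'a word set"
  assumes presentation: "group_presentation X R"
begin


lemma relator_words: "r \<in> R \<Longrightarrow> r \<in> words X"
  using presentation by (auto simp: group_presentation_def)

lemma relator_cyclically_reduced: "r \<in> R \<Longrightarrow> r \<noteq> [] \<and> cyclically_reduced r"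
  using presentation by (auto simp: group_presentation_def)

lemma relator_winv: "r \<in> R \<Longrightarrow> winv r \<in> R"
  using presentation by (auto simp: group_presentation_def)

lemma C_words_1_iff: "c \<in> C_words R (Suc 0) \<longleftrightarrow> (\<exists>r\<in>R. rot r c)"
  by (simp add: cyclic_conjugates_iff)

lemma C_words_cyclically_reduced: "c \<in> C_words R k \<Longrightarrow> c \<noteq> [] \<and> cyclically_reduced c"
proof (induction k arbitrary: c rule: less_induct)
  case (less k)
  consider "k = 0" | "k = Suc 0" | m where "k = Suc (Suc m)"
    by (metis not0_implies_Suc)
  then show ?case
  proof cases
    case 1
    with less.prems show ?thesis by simp
  next
    case 2
    from less.prems [unfolded 2 C_words_1_iff] show ?thesis
      using relator_cyclically_reduced rot_cyclically_reduced rot_Nil by blast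
  next
    case 3
    from less.prems [unfolded 3] obtain u v where uv: "composable u v" and
      r: "rot (corolla_product u v) c" and
      "u \<in> C_words R (Suc m) \<and> v \<in> C_words R (Suc 0) \<or> u \<in> C_words R (Suc 0) \<and> v \<in> C_words R (Suc m)"
      by (rule C_words_SucE)
    then have "cyclically_reduced u" "cyclically_reduced v"
      using less.IH [of "Suc m" u] less.IH [of "Suc 0" u] less.IH [of "Suc m" v] less.IH [of "Suc 0" v]
        3 by auto
    then have "fg u + fg v \<noteq> 0"
      using uv eq_winv_iff_fg unfolding composable_def cyclically_reduced_def by blast
    then have "corolla_product u v \<noteq> []"
      by (simp add: corolla_product_def cyc_reduced_form_Nil)
    then show ?thesis
      using r rot_Nil rot_cyclically_reduced cyc_reduced_form unfolding corolla_product_def by blast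
  qed
qed

lemma C_words_words_filling: "c \<in> C_words R k \<Longrightarrow> c \<in> words X \<and> filling R k (fg c)"
proof (induction k arbitrary: c rule: less_induct)
  case (less k)
  consider "k = 0" | "k = Suc 0" | m where "k = Suc (Suc m)"
    by (metis not0_implies_Suc)
  then show ?case
  proof cases
    case 1
    with less.prems show ?thesis by simp
  next
    case 2
    from less.prems [unfolded 2 C_words_1_iff] obtain r where r: "r \<in> R" "rot r c" by blast
    have "filling R (Suc 0) (fg r)"
      using filling_step [OF filling_zero [of R 0] r(1), of 0] by simp
    with r 2 show ?thesis
      using filling_fconj fconj_rot words_rot relator_words by blast
  next
    case 3
    from less.prems [unfolded 3] obtain u v where 
      r: "rot (corolla_product u v) c" and
      "u \<in> C_words R (Suc m) \<and> v \<in> C_words R (Suc 0) \<or> u \<in> C_words R (Suc 0) \<and> v \<in> C_words R (Suc m)"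
      by (rule C_words_SucE)
    then have w: "u \<in> words X" "v \<in> words X" and "filling R k (fg u + fg v)"
      using less.IH [of "Suc m" u] less.IH [of "Suc 0" u] less.IH [of "Suc m" v] less.IH [of "Suc 0" v]
        3 filling_add [of R "Suc m" "fg u" "Suc 0" "fg v"] filling_add [of R "Suc 0" "fg u" "Suc m" "fg v"] by auto
    moreover have "fconj (fg u + fg v) (fg c)"
      using fconj_trans [OF fconj_cyc_reduced_form [of "u @ v"] fconj_rot] r
      by (simp add: corolla_product_def)
    moreover have "c \<in> words X"
      using words_rot [OF r [unfolded corolla_product_def]] w words_cyc_reduced_form [of "u @ v"] by simp
    ultimately show ?thesis using filling_fconj by blast
  qed
qed

lemma C_words_1_winv: "c \<in> C_words R (Suc 0) \<Longrightarrow> winv c \<in> C_words R (Suc 0)"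
proof -
  assume "c \<in> C_words R (Suc 0)"
  then obtain r where r: "r \<in> R" "rot r c" unfolding C_words_1_iff by blast
  from r(2) obtain x y where "r = x @ y" "c = y @ x" by (rule rotE)
  then have "rot (winv r) (winv c)" using rot_append [of "winv y" "winv x"] by simp
  with r(1) show ?thesis unfolding C_words_1_iff using relator_winv by blast
qed

end

lemma rot_hdE:
  assumes "rot p (z # q)" obtains p1 p2 where "p = p1 @ z # p2" "q = p2 @ p1"
proof -
  from assms obtain x y where xy: "p = x @ y" "z # q = y @ x" by (rule rotE)
  show thesis
  proof (cases y)
    case Nil
    with xy that [of "[]" q] show ?thesis by simp
  next
    case (Cons z' y')
    with xy that [of x y'] show ?thesis by simp
  qed
qed

text \<open>Each letter of the cyclically reduced product survives from one of the two factors. Read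
  from that letter on, the product is the rotated factor times a conjugate of the other
  factor.\<close>

lemma cyc_reduced_form_letter_origin:
  assumes "reduced u" "reduced v" "rot (cyc_reduced_form (u @ v)) (z # p)"
  shows "(\<exists>u' x. rot u (z # u') \<and> fg (z # p) = fg (z # u') + x \<and> fconj x (fg v)) \<or>
    (\<exists>v' x. rot v (z # v') \<and> fg (z # p) = fg (z # v') + x \<and> fconj x (fg u))"
proof -
  obtain u' s v' where u: "u = u' @ s" and v: "v = winv s @ v'" and red: "reduced (u' @ v')"
    using max_cancellation assms by blast
  have "fg (u @ v) = fg (u' @ v')" by (simp add: u v group_norm)
  then have rf: "reduced_form (u @ v) = u' @ v'"
    using red by (simp only: fg_eq_iff reduced_form_reduced)
  obtain p1 p2 where p1: "cyc_reduced_form (u @ v) = p1 @ z # p2" and p: "p = p2 @ p1"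
    using rot_hdE [OF assms(3)] .
  \<comment> \<open>The letter \<open>z\<close> of the core is a letter of \<open>u'\<close> or of
    \<open>v'\<close>, hence of \<open>u\<close> or of \<open>v\<close>.\<close>
  obtain t where "u' @ v' = (t @ p1) @ z # (p2 @ winv t)"
    using cyc_reduced_form [of "u @ v"] rf p1 by auto
  then show ?thesis
  proof (cases rule: append_eq_split)
    case (left a)
    have "rot u (z # a @ s @ t @ p1)"
      using rot_append [of "t @ p1" "z # a @ s"] u left by simp
    moreover have *: "fg p2 = fg a + fg v' + fg t"
      using arg_cong [OF left(2), of "\<lambda>w. fg w + fg t"] by (simp add: group_norm)
    have "fg (z # p) = fg (z # a @ s @ t @ p1) + (- (fg t + fg p1) - fg s + fg v' + fg t + fg p1)"
      by (simp add: p fg_Cons group_norm *)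
    moreover have "fconj (- (fg t + fg p1) - fg s + fg v' + fg t + fg p1) (fg v)"
      by (rule fconjI [of _ "- (fg t + fg p1)"]) (simp add: v group_norm)
    ultimately show ?thesis by blast
  next
    case (right a)
    have "rot v (z # p2 @ winv t @ winv s @ a)"
      using rot_append [of "winv s @ a" "z # p2 @ winv t"] v right by simp
    moreover have *: "fg p1 = - fg t + fg u' + fg a"
      using arg_cong [OF right(2), of "\<lambda>w. - fg t + fg w"] by (simp add: group_norm)
    have "fg (z # p) = fg (z # p2 @ winv t @ winv s @ a) + (- fg a + fg s + fg u' + fg a)"
      by (simp add: p fg_Cons group_norm *)
    moreover have "fconj (- fg a + fg s + fg u' + fg a) (fg u)"
      by (rule fconjI [of _ "- fg a + fg s"]) (simp add: u group_norm)
    ultimately show ?thesis by blast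
  qed
qed

subsection \<open>Corollas and their letters\<close>

declare C_words.simps(2) [simp del]

context presentation
begin

lemma C_words_reduced: "c \<in> C_words R k \<Longrightarrow> reduced c"
  using C_words_cyclically_reduced cyclically_reduced_def by blast

text \<open>Each edge on the boundary of a corolla borders a face, and removing this face leaves at
  most \<open>k - 1\<close> faces. The edge is traced back through the gluings to the factor it
  comes from, until that factor is a single face.\<close>

lemma C_words_first_letter:
  "z # c \<in> C_words R k \<Longrightarrow>
    \<exists>r x. z # r \<in> C_words R (Suc 0) \<and> fg (z # c) = fg (z # r) + x \<and> filling R (k - 1) x"
proof (induction k arbitrary: c rule: less_induct)
  case (less k)
  consider "k = 0" | "k = Suc 0" | m where "k = Suc (Suc m)"
    by (metis not0_implies_Suc)
  then show ?case
  proof cases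
    case 1
    with less.prems show ?thesis by simp
  next
    case 2
    with less.prems show ?thesis
      by (intro exI [of _ c] exI [of _ 0]) (simp add: filling_zero)
  next
    case 3
    \<comment> \<open>Both factors are treated alike: the edge comes from \<open>c'\<close> with
      \<open>i\<close> faces, and the other factor contributes its \<open>j\<close> faces to the
      rest.\<close>
    have step: ?thesis
      if "z # c' \<in> C_words R i" "fg (z # c) = fg (z # c') + x" "fconj x (fg d)" "d \<in> C_words R j"
        "i + j = k" "i < k" "0 < i" for c' x d i j
    proof -
      obtain r y where r: "z # r \<in> C_words R (Suc 0)" "fg (z # c') = fg (z # r) + y" "filling R (i - 1) y"
        using less.IH [OF \<open>i < k\<close> \<open>z # c' \<in> C_words R i\<close>] by blast
      have "filling R j x"
        using that C_words_words_filling filling_fconj by blast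
      with r(3) have "filling R (i - 1 + j) (y + x)" by (rule filling_add)
      with r that show ?thesis
        by (intro exI [of _ r] exI [of _ "y + x"]) (simp add: group_norm)
    qed
    from less.prems [unfolded 3] obtain u v where r: "rot (corolla_product u v) (z # c)" and
      uv: "u \<in> C_words R (Suc m) \<and> v \<in> C_words R (Suc 0) \<or> u \<in> C_words R (Suc 0) \<and> v \<in> C_words R (Suc m)"
      by (rule C_words_SucE)
    from uv 3 obtain i j where ij: "u \<in> C_words R i" "v \<in> C_words R j" "i + j = k" "0 < i" "0 < j"
      by force
    then have "reduced u" "reduced v" using C_words_reduced by blast+
    from cyc_reduced_form_letter_origin [OF this r [unfolded corolla_product_def]]
    show ?thesis
    proof (elim disjE exE conjE)
      fix u' x assume "rot u (z # u')" "fg (z # c) = fg (z # u') + x" "fconj x (fg v)"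
      then show ?thesis using step [of u' i x v j] ij C_words_rot [OF ij(1)] by auto
    next
      fix v' x assume "rot v (z # v')" "fg (z # c) = fg (z # v') + x" "fconj x (fg u)"
      then show ?thesis using step [of v' j x u i] ij C_words_rot [OF ij(2)] by auto
    qed
  qed
qed

text \<open>One common edge suffices for gluing a face to a corolla, although
  \<open>composable\<close> asks for more. Rotating both words until the common arc \<open>s\<close>
  is as long as possible either exhausts one of them, which is the prefix or suffix alternative, or
  leaves no cancellation at the outer ends, which is the third.\<close>

lemma C_words_extend:
  assumes a: "a \<in> C_words R i" and r: "r \<in> C_words R (Suc 0)"
    and junction: "last a = linv (hd r)" and nz: "fg a + fg r \<noteq> 0"
  obtains c where "c \<in> C_words R (Suc i)" "fconj (fg a + fg r) (fg c)"
proof -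
  define Q where "Q s \<longleftrightarrow> (\<exists>u v. rot a (u @ s) \<and> rot r (winv s @ v) \<and> fconj (fg a + fg r) (fg u + fg v))"
    for s
  have "a \<noteq> []" "r \<noteq> []" using a r C_words_cyclically_reduced by blast+
  then obtain a' r' x where ar: "a = a' @ [x]" "r = linv x # r'"
    using junction by (metis append_butlast_last_id linv_linv list.collapse)
  then have Q1: "Q [x]"
    unfolding Q_def by (intro exI [of _ a'] exI [of _ r']) (simp add: group_norm fg_Cons)
  have bound: "Q s \<Longrightarrow> length s < Suc (length a)" for s
    unfolding Q_def using rot_length by fastforce
  obtain s where s: "Q s" and max: "\<And>t. Q t \<Longrightarrow> length t \<le> length s"
    using ex_has_greatest_nat [of Q "[x]" length "Suc (length a)"] Q1 bound by blast
  then have "s \<noteq> []" using Q1 by fastforce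
  from s obtain u' v' where u: "rot a (u' @ s)" and v: "rot r (winv s @ v')"
    and conj: "fconj (fg a + fg r) (fg u' + fg v')"
    unfolding Q_def by blast
  let ?u = "u' @ s" and ?v = "winv s @ v'"
  have uC: "?u \<in> C_words R i" and vC: "?v \<in> C_words R (Suc 0)"
    using a r u v C_words_rot by blast+
  have conj': "fconj (fg a + fg r) (fg (?u @ ?v))"
    using conj by (simp add: group_norm)
  then have "fg ?u + fg ?v \<noteq> 0" using nz fconj_0_iff [OF conj'] by (simp add: group_norm)
  then have ne: "?u \<noteq> winv ?v"
    by (metis eq_winv_iff_fg uC vC C_words_reduced)
  \<comment> \<open>A cancellation at the outer ends can be rotated to the inner junction, where it
    lengthens \<open>s\<close>.\<close>
  have "hd u' \<noteq> linv (last v')" if ne: "u' \<noteq> []" "v' \<noteq> []"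
  proof
    assume "hd u' = linv (last v')"
    with ne obtain y u'' v'' where uv: "u' = y # u''" "v' = v'' @ [linv y]"
      by (metis append_butlast_last_id linv_linv list.collapse)
    have "rot ?u (u'' @ s @ [y])" "rot ?v ((linv y # winv s) @ v'')"
      using rot_append [of "[y]" "u'' @ s"] rot_append [of "winv s @ v''" "[linv y]"] uv by simp_all
    then have 1: "rot a (u'' @ s @ [y])" "rot r (winv (s @ [y]) @ v'')"
      using u v rot_trans by (blast, fastforce)
    have "fconj (fg u' + fg v') (fg u'' + fg v'')"
      using uv by (intro fconjI [of _ "fg [y]"]) (simp add: group_norm fg_Cons)
    with conj have "fconj (fg a + fg r) (fg u'' + fg v'')" by (rule fconj_trans)
    with 1 have "Q (s @ [y])" unfolding Q_def by blast
    with max show False by fastforce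
  qed
  moreover have "last s = linv (hd (winv s))" using \<open>s \<noteq> []\<close> by (simp add: hd_winv)
  ultimately have "composable ?u ?v"
    unfolding composable_def using ne \<open>s \<noteq> []\<close>
    by (cases "u' = []"; cases "v' = []") (auto simp: prefix_def suffix_def)
  moreover obtain m where "i = Suc m" using a by (cases i) auto
  ultimately have "corolla_product ?u ?v \<in> C_words R (Suc i)"
    using C_words_SucI uC vC by blast
  moreover have "fconj (fg a + fg r) (fg (corolla_product ?u ?v))"
    unfolding corolla_product_def by (rule fconj_trans [OF conj' fconj_cyc_reduced_form])
  ultimately show thesis by (rule that)
qed

lemma composable_junction:
  assumes "composable u v" "u \<noteq> []" "v \<noteq> []"
  shows "last u = linv (hd v)"
  using assms unfolding composable_def
  by (auto simp: prefix_def suffix_def hd_winv last_winv hd_append)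

text \<open>The form of the definition that the algorithm tests: a single common edge, the face
  always on the right, and the result determined by its conjugacy class alone.\<close>

lemma C_words_Suc_Suc_iff:
  "c \<in> C_words R (Suc (Suc k)) \<longleftrightarrow> cyclically_reduced c \<and>
    (\<exists>u\<in>C_words R (Suc k). \<exists>v\<in>C_words R (Suc 0). last u = linv (hd v) \<and> fg u + fg v \<noteq> 0 \<and>
      fconj (fg c) (fg u + fg v))" (is "_ \<longleftrightarrow> _ \<and> ?P")
proof (intro iffI conjI; (elim conjE)?)
  assume c: "c \<in> C_words R (Suc (Suc k))"
  show "cyclically_reduced c" using c C_words_cyclically_reduced by blast
  from c obtain u v where comp: "composable u v" and r: "rot (corolla_product u v) c" and
    uv: "u \<in> C_words R (Suc k) \<and> v \<in> C_words R (Suc 0) \<or> u \<in> C_words R (Suc 0) \<and> v \<in> C_words R (Suc k)"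
    by (rule C_words_SucE)
  have "u \<noteq> []" "v \<noteq> []" using uv C_words_cyclically_reduced by blast+
  with comp have j: "last u = linv (hd v)" by (rule composable_junction)
  have nz: "fg u + fg v \<noteq> 0"
    using comp uv eq_winv_iff_fg C_words_reduced unfolding composable_def by blast
  have fc: "fconj (fg c) (fg u + fg v)"
    using fconj_sym [OF fconj_trans [OF fconj_cyc_reduced_form fconj_rot [OF r [unfolded corolla_product_def]]]]
    by simp
  from uv show ?P
  proof
    assume "u \<in> C_words R (Suc k) \<and> v \<in> C_words R (Suc 0)"
    with j nz fc show ?P by blast
  next
    assume *: "u \<in> C_words R (Suc 0) \<and> v \<in> C_words R (Suc k)"
    \<comment> \<open>With the face on the left, moving the cancelling letters \<open>x\<close> and
      \<open>linv x\<close> to the outer ends and exchanging the factors gives the same conjugacy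
      class with the face on the right.\<close>
    obtain x u' v' where x: "u = u' @ [x]" "v = linv x # v'"
      using j \<open>u \<noteq> []\<close> \<open>v \<noteq> []\<close> by (metis append_butlast_last_id linv_linv list.collapse)
    have 1: "x # u' \<in> C_words R (Suc 0)" "v' @ [linv x] \<in> C_words R (Suc k)"
      using * x C_words_rot rot_append [of u' "[x]"] rot_append [of "[linv x]" v'] by fastforce+
    have 2: "fconj (fg u + fg v) (fg (v' @ [linv x]) + fg (x # u'))"
      using x by (intro fconjI [of _ "fg u'"]) (simp add: group_norm fg_Cons)
    then have "fg (v' @ [linv x]) + fg (x # u') \<noteq> 0" using nz fconj_0_iff by blast
    moreover have "fconj (fg c) (fg (v' @ [linv x]) + fg (x # u'))"
      using fc 2 by (rule fconj_trans)
    ultimately show ?P using 1 by (intro bexI [OF _ 1(2)] bexI [OF _ 1(1)]) auto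
  qed
next
  assume c: "cyclically_reduced c" and ?P
  then obtain u v where "u \<in> C_words R (Suc k)" "v \<in> C_words R (Suc 0)" "last u = linv (hd v)"
    "fg u + fg v \<noteq> 0" and uv: "fconj (fg c) (fg u + fg v)" by blast
  then obtain d where d: "d \<in> C_words R (Suc (Suc k))" "fconj (fg u + fg v) (fg d)"
    by (metis C_words_extend)
  then have "rot d c"
    using c uv C_words_cyclically_reduced fconj_cyclically_reduced_imp_rot fconj_trans fconj_sym by metis
  with d show "c \<in> C_words R (Suc (Suc k))" using C_words_rot by blast
qed

lemma in_D_properties: "in_D X R k w \<Longrightarrow> 1 \<le> k \<and> w \<noteq> [] \<and> reduced w \<and> w \<in> words X \<and> filling R k (fg w)"
proof (induction rule: in_D.induct)
  case (conjugate k w u)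
  then show ?case
    using C_words_words_filling [of w k] C_words_cyclically_reduced [of w k] filling_conj [of R k "fg w" "fg u"]
    by (simp add: winv_words group_norm)
next
  case (insertion i j u w1 w2)
  then show ?case
    using filling_insert [of R i "fg u" j "fg w1" "fg w2"] by (simp add: group_norm)
qed

text \<open>In a planar diagram with boundary word \<open>w\<close>, an edge labelled \<open>z\<close> either bounds a
  face or is a bridge; a bridge is traversed a second time, by a letter \<open>z\<^sup>-\<^sup>1\<close>, and cutting it
  separates the diagram into two.\<close>

lemma in_D_letter:
  "in_D X R k w \<Longrightarrow> w = w1 @ z # w2 \<Longrightarrow>
    (\<exists>r x. z # r \<in> C_words R (Suc 0) \<and> fg [z] + fg w2 + fg w1 = fg (z # r) + x \<and> filling R (k - 1) x) \<or>
    (\<exists>v1 v2 i j. w2 = v1 @ linv z # v2 \<and> filling R i (fg v1) \<and> filling R j (fg w1 + fg v2) \<and> i + j \<le> k) \<or>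
    (\<exists>v0 v1 i j. w1 = v0 @ linv z # v1 \<and> filling R i (fg v1) \<and> filling R j (fg v0 + fg w2) \<and> i + j \<le> k)"
  (is "_ \<Longrightarrow> _ \<Longrightarrow> ?A k w1 w2 \<or> ?B k w1 w2 \<or> ?C k w1 w2")
proof (induction arbitrary: w1 w2 rule: in_D.induct)
  case (conjugate k c u)
  have filling: "filling R k (fg c)" using conjugate C_words_words_filling by blast
  from conjugate.prems show ?case
  proof (cases rule: append_eq_split)
    \<comment> \<open>\<open>z\<close> lies in the leading tail, so its mirror letter in the
      trailing tail is the other side of a bridge.\<close>
    case (left a)
    have "w2 = (a @ c @ winv a) @ linv z # winv w1" using left by simp
    moreover have "filling R k (fg (a @ c @ winv a))" using filling_conj [OF filling, of "fg a"] by (simp add: group_norm)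
    moreover have "filling R 0 (fg w1 + fg (winv w1))" by (simp add: filling_zero)
    ultimately have "?B k w1 w2" by (metis add.right_neutral order_refl)
    then show ?thesis by blast
  next
    case (right b)
    from right(1) show ?thesis
    proof (cases rule: append_eq_split)
      case (left a)
      have "rot c (z # a @ b)" using rot_append [of b "z # a"] left by simp
      then have "z # a @ b \<in> C_words R k" using conjugate C_words_rot by blast
      then obtain r x where "z # r \<in> C_words R (Suc 0)" "fg (z # a @ b) = fg (z # r) + x" "filling R (k - 1) x"
        using C_words_first_letter by blast
      moreover have "fg [z] + fg w2 + fg w1 = fg (z # a @ b)"
        using left right by (simp add: group_norm fg_Cons)
      ultimately have "?A k w1 w2" by metis
      then show ?thesis by blast
    next
      case (right a)
      have "winv (winv u) = winv (a @ z # w2)" using right by simp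
      then have u: "u = winv w2 @ linv z # winv a" by simp
      have "w1 = winv w2 @ linv z # (winv a @ c @ a)"
        using right \<open>w1 = u @ b\<close> by (simp add: u)
      moreover have "filling R k (fg (winv a @ c @ a))"
        using filling_conj [OF filling, of "- fg a"] by (simp add: group_norm)
      moreover have "filling R 0 (fg (winv w2) + fg w2)" by (simp add: filling_zero)
      ultimately have "?C k w1 w2" by (metis add.right_neutral order_refl)
      then show ?thesis by blast
    qed
  qed
next
  case (insertion i j u p q)
  have Aru: "filling R i (fg u)" and Arpq: "filling R j (fg p + fg q)"
    using in_D_properties [OF insertion(3)] in_D_properties [OF insertion(4)] by simp_all
  have ins: "filling R (i + n) (x + (fg u + y))" if "filling R n (x + y)" for n x y
    using filling_insert [OF Aru that] by (simp add: group_norm)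
  \<comment> \<open>\<open>y\<close> is the boundary, read from \<open>z\<close>, of the part whose
    face is removed; \<open>h\<close> carries the other part \<open>d\<close> to the end of the
    word, so that its faces are merely added.\<close>
  have A: "?A (i + j) w1 w2"
    if "z # r \<in> C_words R (Suc 0)" "y = fg (z # r) + x" "filling R m x" "filling R n d" "m + n = i + j - 1"
      "fg [z] + fg w2 + fg w1 = y + (- h + d + h)" for r x y m n d h
    using that filling_add [OF that(3) filling_conj [OF that(4), of "- h"]]
    by (intro exI [of _ r] exI [of _ "x + (- h + d + h)"]) (simp add: group_norm)
  from insertion.prems show ?case
  proof (cases rule: append_eq_split)
    case (left a)
    have "p @ q = w1 @ z # (a @ q)" using left by simp
    from insertion.IH(2) [OF this] consider "?A j w1 (a @ q)" | "?B j w1 (a @ q)" | "?C j w1 (a @ q)"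
      by blast
    then show ?thesis
    proof cases
      case 1
      then obtain r x where rx: "z # r \<in> C_words R (Suc 0)" "fg [z] + fg (a @ q) + fg w1 = fg (z # r) + x" "filling R (j - 1) x"
        by blast
      have "?A (i + j) w1 w2"
        by (rule A [OF rx Aru, of "fg q + fg w1"]) (use insertion(2) left in \<open>simp_all add: group_norm\<close>)
      then show ?thesis by blast
    next
      case 2
      then obtain v1 v2 i' j' where v: "a @ q = v1 @ linv z # v2" "filling R i' (fg v1)" "filling R j' (fg w1 + fg v2)" "i' + j' \<le> j"
        by blast
      from v(1) have "?B (i + j) w1 w2"
      proof (cases rule: append_eq_split)
        case (left b)
        with \<open>w2 = a @ u @ q\<close> v ins [of j' "fg w1 + fg b" "fg q"] show ?thesis
          by (intro exI [of _ v1] exI [of _ "b @ u @ q"] exI [of _ i'] exI [of _ "i + j'"]) (simp add: group_norm)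
      next
        case (right b)
        with \<open>w2 = a @ u @ q\<close> v ins [of i' "fg a" "fg b"] show ?thesis
          by (intro exI [of _ "a @ u @ b"] exI [of _ v2] exI [of _ "i + i'"] exI [of _ j']) (simp add: group_norm)
      qed
      then show ?thesis by blast
    next
      case 3
      then obtain v0 v1 i' j' where v: "w1 = v0 @ linv z # v1" "filling R i' (fg v1)" "filling R j' (fg v0 + fg (a @ q))" "i' + j' \<le> j"
        by blast
      with left ins [of j' "fg v0 + fg a" "fg q"] have "?C (i + j) w1 w2"
        by (intro exI [of _ v0] exI [of _ v1] exI [of _ i'] exI [of _ "i + j'"]) (simp add: group_norm)
      then show ?thesis by blast
    qed
  next
    case (right b)
    from right(1) show ?thesis
    proof (cases rule: append_eq_split)
      case (left a)
      have insu: "filling R (n + j) (fg p + (x + fg q))" if "filling R n x" for n x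
        using filling_insert [OF that Arpq] by (simp add: group_norm)
      from insertion.IH(1) [OF left(1)] consider "?A i b a" | "?B i b a" | "?C i b a"
        by blast
      then show ?thesis
      proof cases
        case 1
        then obtain r x where rx: "z # r \<in> C_words R (Suc 0)" "fg [z] + fg a + fg b = fg (z # r) + x" "filling R (i - 1) x"
          by blast
        have "?A (i + j) w1 w2"
          by (rule A [OF rx Arpq [unfolded filling_swap [of _ _ "fg p"]], of "fg b"])
            (use insertion(1) left right in \<open>simp_all add: group_norm\<close>)
        then show ?thesis by blast
      next
        case 2
        then obtain v1 v2 i' j' where v: "a = v1 @ linv z # v2" "filling R i' (fg v1)" "filling R j' (fg b + fg v2)" "i' + j' \<le> i"
          by blast
        with left right insu [OF v(3)] have "?B (i + j) w1 w2"
          by (intro exI [of _ v1] exI [of _ "v2 @ q"] exI [of _ i'] exI [of _ "j' + j"]) (simp add: group_norm)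
        then show ?thesis by blast
      next
        case 3
        then obtain v0 v1 i' j' where v: "b = v0 @ linv z # v1" "filling R i' (fg v1)" "filling R j' (fg v0 + fg a)" "i' + j' \<le> i"
          by blast
        with left right insu [OF v(3)] have "?C (i + j) w1 w2"
          by (intro exI [of _ "p @ v0"] exI [of _ v1] exI [of _ i'] exI [of _ "j' + j"]) (simp add: group_norm)
        then show ?thesis by blast
      qed
    next
      case (right a)
      with \<open>w1 = p @ b\<close> have w1: "w1 = p @ u @ a" by simp
      have "p @ q = (p @ a) @ z # w2" using right by simp
      from insertion.IH(2) [OF this] consider "?A j (p @ a) w2" | "?B j (p @ a) w2" | "?C j (p @ a) w2"
        by blast
      then show ?thesis
      proof cases
        case 1
        then obtain r x where rx: "z # r \<in> C_words R (Suc 0)" "fg [z] + fg w2 + fg (p @ a) = fg (z # r) + x" "filling R (j - 1) x"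
          by blast
        have "?A (i + j) w1 w2"
          by (rule A [OF rx Aru, of "fg a"]) (use insertion(2) w1 in \<open>simp_all add: group_norm\<close>)
        then show ?thesis by blast
      next
        case 2
        then obtain v1 v2 i' j' where v: "w2 = v1 @ linv z # v2" "filling R i' (fg v1)" "filling R j' (fg (p @ a) + fg v2)" "i' + j' \<le> j"
          by blast
        with w1 ins [of j' "fg p" "fg a + fg v2"] have "?B (i + j) w1 w2"
          by (intro exI [of _ v1] exI [of _ v2] exI [of _ i'] exI [of _ "i + j'"]) (simp add: group_norm)
        then show ?thesis by blast
      next
        case 3
        then obtain v0 v1 i' j' where v: "p @ a = v0 @ linv z # v1" "filling R i' (fg v1)" "filling R j' (fg v0 + fg w2)" "i' + j' \<le> j"
          by blast
        from v(1) have "?C (i + j) w1 w2"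
        proof (cases rule: append_eq_split)
          case (left b)
          with w1 v ins [of i' "fg b" "fg a"] show ?thesis
            by (intro exI [of _ v0] exI [of _ "b @ u @ a"] exI [of _ "i + i'"] exI [of _ j']) (simp add: group_norm)
        next
          case (right b)
          with w1 v ins [of j' "fg p" "fg b + fg w2"] show ?thesis
            by (intro exI [of _ "p @ u @ b"] exI [of _ v1] exI [of _ i'] exI [of _ "i + j'"]) (simp add: group_norm)
        qed
        then show ?thesis by blast
      qed
    qed
  qed
qed

end

subsection \<open>Area and the sets D\<close>

lemma words_UNIV [simp]: "w \<in> words UNIV"
  by (simp add: words_def)

text \<open>All words in a derivation are made of letters of the final word, so they use no letter
  outside \<open>X\<close>. Diagrams can therefore be studied over the full letter type.\<close>

lemma in_D_UNIV_imp: "in_D UNIV R k w \<Longrightarrow> w \<in> words X \<Longrightarrow> in_D X R k w"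
  by (induction rule: in_D.induct) (auto intro: in_D.intros)

lemma reduced_concat: "reduced (concat xs) \<Longrightarrow> x \<in> set xs \<Longrightarrow> reduced x"
  by (induction xs) (auto dest: reduced_append)

lemma length_cancel_cons: "length (cancel_cons l w) \<le> Suc (length w)"
  by (cases w) auto

lemma length_reduced_form: "length (reduced_form w) \<le> length w"
  by (induction w) (auto intro: order_trans [OF length_cancel_cons])

text \<open>The decoration \<open>[(a\<^sub>1, u\<^sub>1, j\<^sub>1), \<dots>, (a\<^sub>m, u\<^sub>m, j\<^sub>m)]\<close> stands for the cyclic word
  \<open>a\<^sub>1 u\<^sub>1 \<dots> a\<^sub>m u\<^sub>m\<close>, a disc with boundary \<open>a\<^sub>1 \<dots> a\<^sub>m\<close> to which diagrams with boundaries \<open>u\<^sub>l\<close> and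
  at most \<open>j\<^sub>l\<close> faces are attached.\<close>

type_synonym 'a decoration = "('a word \<times> 'a word \<times> nat) list"

definition body :: "'a decoration \<Rightarrow> 'a word" where
  "body ps = concat (map fst ps)"

definition whole :: "'a decoration \<Rightarrow> 'a word" where
  "whole ps = concat (map (\<lambda>(a, u, j). a @ u) ps)"

definition weight :: "'a decoration \<Rightarrow> nat" where
  "weight ps = sum_list (map (\<lambda>(a, u, j). j) ps)"

text \<open>The \<open>Suc\<close> counts entries. Merging two entries lowers the size, and so does
  splitting an attached word at a bridge: it creates one more entry but deletes two letters.\<close>

definition decoration_size :: "'a decoration \<Rightarrow> nat" where
  "decoration_size ps = sum_list (map (\<lambda>(a, u, j). Suc (length u)) ps)"

definition valid :: "'a word set \<Rightarrow> 'a decoration \<Rightarrow> bool" where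
  "valid R ps \<longleftrightarrow> (\<forall>(a, u, j)\<in>set ps. reduced u \<and> filling R j (fg u))"

lemma decoration_simps [simp]:
  "body [] = []" "body ((a, u, j) # ps) = a @ body ps" "body (ps @ qs) = body ps @ body qs"
  "whole [] = []" "whole ((a, u, j) # ps) = a @ u @ whole ps" "whole (ps @ qs) = whole ps @ whole qs"
  "weight [] = 0" "weight ((a, u, j) # ps) = j + weight ps" "weight (ps @ qs) = weight ps + weight qs"
  "decoration_size [] = 0" "decoration_size ((a, u, j) # ps) = Suc (length u + decoration_size ps)"
  "decoration_size (ps @ qs) = decoration_size ps + decoration_size qs"
  "valid R []" "valid R ((a, u, j) # ps) \<longleftrightarrow> reduced u \<and> filling R j (fg u) \<and> valid R ps"
  "valid R (ps @ qs) \<longleftrightarrow> valid R ps \<and> valid R qs"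
  by (simp_all add: body_def whole_def weight_def decoration_size_def valid_def ball_Un)

text \<open>Conjugation by the arcs that follow pushes all attached words behind the body without
  changing their numbers of faces.\<close>

lemma whole_eq_body:
  "valid R ps \<Longrightarrow> \<exists>x. fg (whole ps) = fg (body ps) + x \<and> filling R (weight ps) x"
proof (induction ps)
  case Nil
  then show ?case by (simp add: filling_zero)
next
  case (Cons p ps)
  obtain a u j where p: "p = (a, u, j)" by (cases p)
  with Cons obtain x where x: "fg (whole ps) = fg (body ps) + x" "filling R (weight ps) x" by auto
  have "filling R j (- fg (body ps) + fg u - - fg (body ps))"
    using Cons.prems p by (intro filling_conj) simp
  from filling_add [OF this x(2)] p x(1) show ?case
    by (intro exI [of _ "- fg (body ps) + fg u + fg (body ps) + x"]) (simp add: group_norm)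
qed

text \<open>Cancellation is possible only where an arc meets an attached word. \<open>outer\<close>
  is phrased for the decoration rotated to start at the arc, so that it also covers the seam of the
  cyclic word.\<close>

lemma cyclically_reduced_whole:
  assumes ne: "ps \<noteq> []" and parts: "\<And>a u j. (a, u, j) \<in> set ps \<Longrightarrow> a \<noteq> [] \<and> u \<noteq> [] \<and> reduced a \<and> reduced u"
    and inner: "\<And>xs a u j ys. ps = xs @ (a, u, j) # ys \<Longrightarrow> last a \<noteq> linv (hd u)"
    and outer: "\<And>xs a u j ys. ps = xs @ (a, u, j) # ys \<Longrightarrow>
      last (whole ((a, u, j) # ys @ xs)) \<noteq> linv (hd a)"
  shows "cyclically_reduced (whole ps)"
proof -
  have suffix: "reduced (whole ys)" if "ps = xs @ ys" for xs ys
    using that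
  proof (induction ys arbitrary: xs)
    case (Cons p ys)
    obtain a u j where p: "p = (a, u, j)" by (cases p)
    have au: "a \<noteq> []" "u \<noteq> []" "reduced a" "reduced u" using parts [of a u j] Cons.prems p by auto
    have "reduced (whole ys)" using Cons.IH [of "xs @ [p]"] Cons.prems by simp
    moreover have "last a \<noteq> linv (hd u)" using inner Cons.prems p by blast
    moreover have "last u \<noteq> linv (hd (whole ys))" if nonempty: "ys \<noteq> []"
    proof -
      obtain b v k zs where ys: "ys = (b, v, k) # zs" using nonempty by (cases ys) auto
      then have "b \<noteq> []" using parts [of b v k] Cons.prems by auto
      with outer [of "xs @ [p]" b v k zs] Cons.prems ys p au show ?thesis by auto
    qed
    ultimately show ?case using au p by (cases "ys = []") (auto simp: reduced_append_iff)
  qed simp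
  have "reduced (whole ps)" using suffix [of "[]"] by simp
  moreover obtain a u j ys where "ps = (a, u, j) # ys" using ne by (cases ps) auto
  moreover from this have "a \<noteq> []" using parts [of a u j] by auto
  ultimately show ?thesis
    using outer [of "[]" a u j ys] by (auto simp: cyclically_reduced_def)
qed

section \<open>From fillings to membership in D\<close>

context presentation
begin

lemma presentation_UNIV: "presentation UNIV R"
  using presentation by unfold_locales (auto simp: group_presentation_def)

definition D_upto :: "nat \<Rightarrow> 'a word \<Rightarrow> bool" where
  "D_upto n w \<longleftrightarrow> (\<exists>h\<le>n. in_D UNIV R h w)"

text \<open>\<open>w1 @ w2\<close> need not be reduced, so the insertion rule does not apply
  directly. The part \<open>s\<close> that cancels between \<open>w1\<close> and \<open>w2\<close>
  is turned into a tail of the inserted word, and \<open>s @ p @ winv s\<close> is inserted into a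
  reduced word instead.\<close>

lemma D_upto_insert:
  assumes IH: "\<And>m w. m < n \<Longrightarrow> reduced w \<Longrightarrow> w \<noteq> [] \<Longrightarrow> filling R m (fg w) \<Longrightarrow> D_upto m w"
    and red: "reduced (w1 @ p @ w2)" and ne: "w1 @ p @ w2 \<noteq> []"
    and p: "filling R i (fg p)" and w: "filling R j (fg w1 + fg w2)" and ij: "i < n" "j < n" "i + j \<le> n"
  shows "D_upto n (w1 @ p @ w2)"
proof -
  have mono: "D_upto n x" if "D_upto m x" "m < n" for x m
    using that unfolding D_upto_def by (meson less_imp_le order_trans)
  obtain w1' s w2' where s: "w1 = w1' @ s" "w2 = winv s @ w2'" and red': "reduced (w1' @ w2')"
    using max_cancellation red by (metis reduced_append)
  have w': "filling R j (fg (w1' @ w2'))" using w s by (simp add: group_norm)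
  have p': "filling R i (fg (s @ p @ winv s))" using filling_conj [OF p, of "fg s"] by (simp add: group_norm)
  have rp: "reduced (s @ p @ winv s)"
    using red s by (metis append.assoc reduced_append)
  \<comment> \<open>If one of the two pieces is empty, the whole word is the other one and falls
    under the induction hypothesis.\<close>
  consider "p = []" | "w1' @ w2' = []" | "p \<noteq> []" "w1' @ w2' \<noteq> []" by blast
  then show ?thesis
  proof cases
    case 1
    then show ?thesis using IH [OF ij(2), of "w1 @ w2"] red ne w mono [OF _ ij(2)] by simp
  next
    case 2
    then show ?thesis using IH [OF ij(1), of "s @ p @ winv s"] rp ne p' mono [OF _ ij(1)] s by simp
  next
    case 3
    obtain h where h: "h \<le> i" "in_D UNIV R h (s @ p @ winv s)"
      using IH [OF ij(1) rp _ p'] 3 unfolding D_upto_def by auto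
    obtain k where k: "k \<le> j" "in_D UNIV R k (w1' @ w2')"
      using IH [OF ij(2) red' 3(2) w'] unfolding D_upto_def by auto
    have "in_D UNIV R (h + k) (w1' @ (s @ p @ winv s) @ w2')"
    proof (rule in_D.insertion)
      show "1 \<le> h" "1 \<le> k"
        using h k presentation.in_D_properties [OF presentation_UNIV] by blast+
    qed (use h k red s in simp_all)
    then show ?thesis
      unfolding D_upto_def using h k ij s by (intro exI [of _ "h + k"]) auto
  qed
qed

text \<open>The seam of \<open>w0\<close> lies in only one of \<open>p\<close> and \<open>q\<close>;
  the other is an honest subword of \<open>w0\<close> and is inserted into the one that wraps
  around.\<close>

lemma D_upto_of_rotation_split:
  assumes IH: "\<And>m w. m < n \<Longrightarrow> reduced w \<Longrightarrow> w \<noteq> [] \<Longrightarrow> filling R m (fg w) \<Longrightarrow> D_upto m w"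
    and red: "reduced (t @ w0 @ winv t)" and ne: "w0 \<noteq> []" and rot: "rot w0 (p @ q)"
    and p: "filling R i (fg p)" and q: "filling R j (fg q)" and ij: "i < n" "j < n" "i + j \<le> n"
  shows "D_upto n (t @ w0 @ winv t)"
proof -
  have *: "D_upto n (t @ w0 @ winv t)"
    if w: "w0 = x @ p' @ y" "filling R i' (fg p')" "filling R j' (fg (y @ x))" "i' < n" "j' < n" "i' + j' \<le> n"
    for x p' y i' j'
  proof -
    have "filling R j' (fg x + fg y)" using w(3) filling_swap [of R j' "fg x"] by simp
    then have "filling R j' (fg (t @ x) + fg (y @ winv t))"
      using filling_conj [of R j' "fg x + fg y" "fg t"] by (simp add: group_norm)
    then have "D_upto n ((t @ x) @ p' @ (y @ winv t))"
      using w red ne by (intro D_upto_insert [OF IH]) auto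
    then show ?thesis using w by simp
  qed
  obtain x y where xy: "w0 = x @ y" "p @ q = y @ x" using rot by (rule rotE)
  from xy(2) consider z where "p = y @ z" "x = z @ q" | z where "y = p @ z" "q = z @ x"
    by (auto simp: append_eq_append_conv2)
  then show ?thesis
  proof cases
    case 1
    then show ?thesis using * [of z q y j i] xy p q ij by simp
  next
    case 2
    then show ?thesis using * [of x p z i j] xy p q ij by simp
  qed
qed


text \<open>Choose a corolla \<open>a \<in> C\<^sub>i\<close> inside a diagram for \<open>w0\<close> with \<open>i\<close> maximal, and the rest as a
  decoration of \<open>a\<close> of minimal size. A cancellation between \<open>a\<close> and a decorating word \<open>u\<close> is
  impossible: if the cancelled edge of \<open>u\<close> bounds a face, that face enlarges \<open>a\<close>, and if it is a
  bridge, \<open>u\<close> splits into two words of smaller total length.\<close>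

lemma corolla_or_rotation_split:
  assumes IH: "\<And>m w. m < n \<Longrightarrow> reduced w \<Longrightarrow> w \<noteq> [] \<Longrightarrow> filling R m (fg w) \<Longrightarrow> D_upto m w"
    and w0: "cyclically_reduced w0" "w0 \<noteq> []"
    and area: "filling R n (fg w0)" "\<And>m. filling R m (fg w0) \<Longrightarrow> n \<le> m"
  shows "(\<exists>i\<le>n. 1 \<le> i \<and> w0 \<in> C_words R i) \<or>
    (\<exists>p q i j. rot w0 (p @ q) \<and> filling R i (fg p) \<and> filling R j (fg q) \<and> i < n \<and> j < n \<and> i + j \<le> n)"
proof -
  interpret U: presentation UNIV R by (rule presentation_UNIV)
  \<comment> \<open>The budget \<open>n - i\<close> for the rest keeps the total at
    \<open>n\<close>, so a maximal \<open>i\<close> means that no further face can be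
    absorbed.\<close>
  define M where "M i \<longleftrightarrow> i \<le> n \<and> (\<exists>a x. a \<in> C_words R i \<and> filling R (n - i) x \<and> fconj (fg w0) (fg a + x))" for i
  have "\<exists>i. M i"
    using area(1)
  proof (cases rule: filling.cases)
    case (filling_zero)
    with w0 show ?thesis by (simp add: cyclically_reduced_def fg_reduced_eq_0)
  next
    case (filling_step m x r g)
    have "r \<in> C_words R (Suc 0)" using filling_step by (auto simp: C_words_1_iff intro: rot_refl)
    moreover have "fconj (fg w0) (fg r + (- g + x + g))"
      using filling_step by (intro fconjI [of _ g]) (simp add: group_norm)
    moreover have "filling R m (- g + x + g)" using filling_conj [OF filling_step(3), of "- g"] by (simp add: group_norm)
    ultimately have "M (Suc 0)" using filling_step unfolding M_def by auto
    then show ?thesis by blast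
  qed
  moreover have "M i \<Longrightarrow> i < Suc n" for i by (simp add: M_def)
  ultimately obtain i where i: "M i" and max: "\<And>k. M k \<Longrightarrow> k \<le> i"
    using ex_has_greatest_nat [of M _ id "Suc n"] by (metis id_apply)
  \<comment> \<open>If the face \<open>r\<close> cancels the corolla \<open>a\<close> outright,
    \<open>w0\<close> has a filling with fewer than \<open>n\<close> faces; otherwise both glue to a
    corolla that contradicts the maximality of \<open>i\<close>.\<close>
  have enlarge: False
    if a: "a \<in> C_words R i" and r: "r \<in> C_words R (Suc 0)" "last a = linv (hd r)" and x: "filling R m x"
      and m: "Suc i + m \<le> n" and conj: "fconj (fg w0) (fg a + fg r + x)" for a r x m
  proof (cases "fg a + fg r = 0")
    case True
    then have "filling R m (fg w0)" using conj x filling_fconj by force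
    then show False using area(2) m by fastforce
  next
    case False
    with a r obtain c where c: "c \<in> C_words R (Suc i)" "fconj (fg a + fg r) (fg c)"
      using C_words_extend by blast
    then obtain g where g: "fg a + fg r = g + fg c - g" by (auto simp: fconj_def)
    have "fconj (fg a + fg r + x) (fg c + (- g + x + g))"
      using g by (intro fconjI [of _ g]) (simp add: group_norm)
    moreover have "filling R (n - Suc i) (- g + x + g)"
      using filling_conj [OF filling_mono [OF x, of "n - Suc i"], of "- g"] m by (simp add: group_norm)
    ultimately have "M (Suc i)" unfolding M_def using c m fconj_trans [OF conj] by auto
    then show False using max by fastforce
  qed
  have ipos: "1 \<le> i" using i unfolding M_def by (cases i) auto
  define V where "V ps \<longleftrightarrow> valid R ps \<and> body ps \<in> C_words R i \<and> i + weight ps \<le> n \<and> fconj (fg w0) (fg (whole ps))"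
    for ps
  \<comment> \<open>Decorations are cyclic, so the entry under examination can be moved to the
    front.\<close>
  have V_rot: "V (ys @ xs)" if "V (xs @ ys)" for xs ys
  proof -
    have "fconj (fg (whole xs @ whole ys)) (fg (whole ys @ whole xs))"
      by (rule fconj_rot [OF rot_append])
    moreover have "rot (body xs @ body ys) (body ys @ body xs)" by (rule rot_append)
    ultimately show ?thesis
      using that C_words_rot fconj_trans unfolding V_def by (auto simp: add.commute)
  qed
  have "\<exists>ps. V ps"
  proof -
    obtain a x where ax: "i \<le> n" "a \<in> C_words R i" "filling R (n - i) x" "fconj (fg w0) (fg a + x)"
      using i unfolding M_def by blast
    obtain u where "reduced u" "x = fg u" by (rule fg_surj)
    with ax have "V [(a, u, n - i)]" by (simp add: V_def)
    then show ?thesis by blast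
  qed
  then obtain ps where ps: "V ps" and min: "\<And>qs. V qs \<Longrightarrow> decoration_size ps \<le> decoration_size qs"
    using ex_has_least_nat [of V _ decoration_size] by blast
  have body_ne: "body ps \<noteq> []" and body_red: "reduced (body ps)"
    using ps C_words_cyclically_reduced C_words_reduced unfolding V_def by blast+
  have "ps \<noteq> []" using body_ne by auto
  show ?thesis
  proof (cases "\<exists>a j. ps = [(a, [], j)]")
    case True
    then obtain a j where "ps = [(a, [], j)]" by blast
    then have a: "a \<in> C_words R i" "fconj (fg w0) (fg a)" "i \<le> n" using ps unfolding V_def by auto
    then have "rot w0 a"
      using w0 C_words_cyclically_reduced fconj_cyclically_reduced_imp_rot by blast
    then have "w0 \<in> C_words R i" using a C_words_rot rot_sym by blast
    then show ?thesis using a ipos by blast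
  next
    case no_single: False
    \<comment> \<open>An empty arc or an empty attached word would let two neighbouring entries
      merge, against minimal size.\<close>
    have parts: "a \<noteq> [] \<and> u \<noteq> [] \<and> reduced a \<and> reduced u" if in_ps: "(a, u, j) \<in> set ps" for a u j
    proof -
      obtain xs ys where split: "ps = xs @ (a, u, j) # ys" using in_ps by (metis split_list)
      have Vr: "V ((a, u, j) # ys @ xs)" using V_rot [of xs "(a, u, j) # ys"] ps split by simp
      have "u \<noteq> []"
      proof
        assume u: "u = []"
        then have "ys @ xs \<noteq> []" using no_single split by auto
        then obtain b v k zs where zs: "ys @ xs = (b, v, k) # zs" by (cases "ys @ xs") auto
        have "V ((a @ b, v, k) # zs)" using Vr u unfolding V_def zs by simp
        moreover have "decoration_size ps = Suc (decoration_size (ys @ xs))" using split u by simp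
        ultimately show False using min [of "(a @ b, v, k) # zs"] zs by simp
      qed
      moreover have "a \<noteq> []"
      proof
        assume a: "a = []"
        have "ys @ xs \<noteq> []" using body_ne split a by auto
        then obtain zs b v k where zs: "ys @ xs = zs @ [(b, v, k)]" by (metis prod_cases3 rev_exhaust)
        have "V ((zs @ [(b, v, k)]) @ [(a, u, j)])"
          using V_rot [of "[(a, u, j)]" "ys @ xs"] Vr zs by simp
        then have "V (zs @ [(b, reduced_form (v @ u), k + j)])"
          using a filling_add [of R k "fg v" j "fg u"]
          by (simp add: V_def reduced_reduced_form group_norm)
        moreover have "decoration_size ps = decoration_size (ys @ xs) + Suc (length u)" using split by simp
        ultimately show False
          using min [of "zs @ [(b, reduced_form (v @ u), k + j)]"] length_reduced_form [of "v @ u"] zs by simp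
      qed
      moreover have "reduced a"
        using body_red in_ps by (intro reduced_concat [of "map fst ps" a]) (force simp: body_def)+
      moreover have "reduced u" using ps in_ps unfolding V_def valid_def by auto
      ultimately show ?thesis by blast
    qed
    \<comment> \<open>The body uses \<open>i \<ge> 1\<close> faces, so each attached word has fewer
      than \<open>n\<close> and falls under the induction hypothesis; membership in D then makes its
      single letters accessible to \<open>in_D_letter\<close>.\<close>
    have D_part: "\<exists>h\<le>j. in_D UNIV R h u" if in_ps: "(a, u, j) \<in> set ps" for a u j
    proof -
      have "j \<le> weight ps"
        using in_ps unfolding weight_def by (intro member_le_sum_list) force+
      then have "j < n" using ps ipos unfolding V_def by linarith
      moreover have "filling R j (fg u)" using ps in_ps unfolding V_def valid_def by auto
      ultimately show ?thesis using IH [of j u] parts [OF in_ps] unfolding D_upto_def by blast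
    qed
    have "cyclically_reduced (whole ps)"
    proof (rule cyclically_reduced_whole [OF \<open>ps \<noteq> []\<close> parts])
      fix xs a u j ys assume split: "ps = xs @ (a, u, j) # ys"
      let ?zs = "ys @ xs"
      have Vr: "V ((a, u, j) # ?zs)" using V_rot [of xs "(a, u, j) # ys"] ps split by simp
      have size: "decoration_size ps = decoration_size ((a, u, j) # ?zs)" using split by simp
      have in_ps: "(a, u, j) \<in> set ps" using split by simp
      obtain g where g: "fg (whole ?zs) = fg (body ?zs) + g" "filling R (weight ?zs) g"
        using whole_eq_body [of R ?zs] Vr unfolding V_def by auto
      show "last a \<noteq> linv (hd u)"
      proof
        assume "last a = linv (hd u)"
        then obtain a' x u' where a: "a = a' @ [x]" and u: "u = linv x # u'"
          using parts [OF in_ps] by (metis append_butlast_last_id linv_linv list.collapse)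
        obtain h where h: "h \<le> j" "in_D UNIV R h u" using D_part [OF in_ps] by blast
        have "1 \<le> h" using U.in_D_properties [OF h(2)] by simp
        have "u = [] @ linv x # u'" by (simp add: u)
        from U.in_D_letter [OF h(2) this] show False
        proof (elim disjE exE conjE)
          \<comment> \<open>The edge \<open>x\<close> borders a face \<open>r\<close> of the
            attached diagram. Rotated to \<open>body ?zs @ a\<close>, the disc ends in
            \<open>x\<close> and can take over this face; all other attachments move to the
            end.\<close>
          fix r y assume r: "linv x # r \<in> C_words R (Suc 0)"
            and eq: "fg [linv x] + fg u' + fg [] = fg (linv x # r) + y" and y: "filling R (h - 1) y"
          have eq': "fg u = fg (linv x # r) + y" using eq u by (simp add: fg_Cons)
          have rotc: "body ?zs @ a \<in> C_words R i"
            using Vr C_words_rot [OF _ rot_append, of a "body ?zs" R i] unfolding V_def by simp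
          let ?k = "fg a + fg (linv x # r)"
          have "filling R (weight ?zs + (h - 1)) (- ?k + g + ?k + y)"
            using filling_add [OF filling_conj [OF g(2), of "- ?k"] y] by (simp add: group_norm)
          moreover have "fconj (fg w0) (fg (body ?zs @ a) + fg (linv x # r) + (- ?k + g + ?k + y))"
          proof (rule fconj_trans)
            show "fconj (fg w0) (fg (whole ((a, u, j) # ?zs)))" using Vr unfolding V_def by simp
            show "fconj (fg (whole ((a, u, j) # ?zs))) (fg (body ?zs @ a) + fg (linv x # r) + (- ?k + g + ?k + y))"
              using g(1) eq' by (intro fconjI [of _ "fg a + fg u"]) (simp add: group_norm)
          qed
          moreover have "Suc i + (weight ?zs + (h - 1)) \<le> n"
            using Vr h \<open>1 \<le> h\<close> unfolding V_def by simp
          ultimately show False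
            using enlarge [OF rotc r] a by simp
        next
          fix v1 v2 i1 j1 assume v: "u' = v1 @ linv (linv x) # v2" "filling R i1 (fg v1)"
            "filling R j1 (fg [] + fg v2)" "i1 + j1 \<le> h"
          have "reduced v1" "reduced v2"
            using parts [OF in_ps] u v(1) by (auto simp: reduced_Cons reduced_append_iff)
          \<comment> \<open>At a bridge \<open>a' x x^-1 v1 x v2\<close> becomes
            \<open>a' v1 x v2\<close>, so the arc is cut before \<open>x\<close>.\<close>
          then have "V ((a', v1, i1) # ([x], v2, j1) # ?zs)"
            using Vr v u a h unfolding V_def by (simp add: group_norm fg_Cons)
          from min [OF this] show False using size u v(1) by simp
        qed simp
      qed
      show "last (whole ((a, u, j) # ?zs)) \<noteq> linv (hd a)"
      proof
        assume last: "last (whole ((a, u, j) # ?zs)) = linv (hd a)"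
        obtain x a' where a: "a = x # a'" using parts [OF in_ps] by (cases a) auto
        \<comment> \<open>For a cancellation before an arc, its first letter \<open>x\<close> is
          moved to the end of the cyclic word, behind the attached word \<open>v\<close> that ends
          in \<open>linv x\<close>.\<close>
        obtain ms b v k where ms: "(a', u, j) # ?zs = ms @ [(b, v, k)]"
          by (metis list.distinct(1) prod_cases3 rev_exhaust)
        have v_in: "\<exists>b'. (b', v, k) \<in> set ps"
        proof -
          have "(b, v, k) \<in> set ((a', u, j) # ?zs)" unfolding ms by simp
          then show ?thesis using split by auto
        qed
        have vne: "v \<noteq> []" and vred: "reduced v" using v_in parts by blast+
        have "whole ((a, u, j) # ?zs) = x # whole (ms @ [(b, v, k)])"
          unfolding ms [symmetric] a by simp
        from last [unfolded this] vne have "last v = linv x" by (simp add: a)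
        with vne obtain v' where v: "v = v' @ [linv x]" by (metis append_butlast_last_id)
        have wh: "fconj (fg w0) (fg (whole (ms @ [(b, v, k)])) + fg [x])"
        proof (rule fconj_trans)
          show "fconj (fg w0) (fg (whole ((a, u, j) # ?zs)))" using Vr unfolding V_def by simp
          have "fg (whole ((a, u, j) # ?zs)) = fg [x] + fg (whole (ms @ [(b, v, k)]))"
            unfolding ms [symmetric] a by (simp add: group_norm fg_Cons)
          then show "fconj (fg (whole ((a, u, j) # ?zs))) (fg (whole (ms @ [(b, v, k)])) + fg [x])"
            by (intro fconjI [of _ "fg [x]"]) (simp add: group_norm)
        qed
        have "rot (body ((a, u, j) # ?zs)) (body (ms @ [(b, v, k)]) @ [x])"
          unfolding ms [symmetric] a using rot_append [of "[x]" "a' @ body ?zs"] by simp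
        then have bd: "body ms @ b @ [x] \<in> C_words R i"
          using Vr C_words_rot unfolding V_def by fastforce
        have vms: "valid R ms" and wt: "i + weight ms + k \<le> n"
        proof -
          have "valid R ((a', u, j) # ?zs) \<and> i + weight ((a', u, j) # ?zs) \<le> n" using Vr unfolding V_def by simp
          then show "valid R ms" "i + weight ms + k \<le> n" unfolding ms by auto
        qed
        have size': "decoration_size ps = decoration_size (ms @ [(b, v, k)])"
          unfolding ms [symmetric] using size by simp
        obtain h where h: "h \<le> k" "in_D UNIV R h v" using D_part v_in by blast
        have "1 \<le> h" using U.in_D_properties [OF h(2)] by simp
        from U.in_D_letter [OF h(2) v] show False
        proof (elim disjE exE conjE)
          fix r y assume r: "linv x # r \<in> C_words R (Suc 0)"
            and eq: "fg [linv x] + fg [] + fg v' = fg (linv x # r) + y" and y: "filling R (h - 1) y"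
          have eq': "fg v' = fg [x] + fg (linv x # r) + y"
            using arg_cong [OF eq, of "\<lambda>y. fg [x] + y"] by (simp add: group_norm)
          obtain g where g: "fg (whole ms) = fg (body ms) + g" "filling R (weight ms) g"
            using whole_eq_body vms by blast
          let ?k = "fg b + fg [x] + fg (linv x # r)"
          have "filling R (weight ms + (h - 1)) (- ?k + g + ?k + y)"
            using filling_add [OF filling_conj [OF g(2), of "- ?k"] y] by (simp add: group_norm)
          moreover have "fconj (fg w0) (fg (body ms @ b @ [x]) + fg (linv x # r) + (- ?k + g + ?k + y))"
            using wh g(1) by (simp add: group_norm v eq')
          moreover have "Suc i + (weight ms + (h - 1)) \<le> n"
            using wt h \<open>1 \<le> h\<close> by simp
          ultimately show False
            using enlarge [OF bd r] by simp
        next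
          fix v0 v1 i1 j1 assume v': "v' = v0 @ linv (linv x) # v1" "filling R i1 (fg v1)"
            "filling R j1 (fg v0 + fg [])" "i1 + j1 \<le> h"
          have "reduced v0" "reduced v1"
            using vred v v'(1) by (auto simp: reduced_Cons reduced_append_iff)
          \<comment> \<open>Here \<open>v = v0 x v1 x^-1\<close>, so \<open>v x\<close> reduces to
            \<open>v0 x v1\<close> and \<open>x\<close> becomes an arc of its own.\<close>
          then have "V (ms @ [(b, v0, j1), ([x], v1, i1)])"
            using v' v h vms wt bd wh unfolding V_def by (simp add: group_norm fg_Cons)
          from min [OF this] show False using size' v v'(1) by simp
        qed simp
      qed
    qed
    moreover have "fconj (fg w0) (fg (whole ps))" using ps unfolding V_def by blast
    ultimately have rot: "rot w0 (whole ps)"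
      using w0 fconj_cyclically_reduced_imp_rot by blast
    \<comment> \<open>The decorated boundary is now a rotation of \<open>w0\<close>, and cutting off
      one attached word splits it. Both parts have fewer than \<open>n\<close> faces:
      \<open>j < n\<close> since the body uses some, and \<open>n - j < n\<close> since
      \<open>u\<close> is a nonempty reduced word, whence \<open>j \<noteq> 0\<close>.\<close>
    obtain a u j zs where split: "ps = (a, u, j) # zs" using \<open>ps \<noteq> []\<close> by (cases ps) auto
    have "rot w0 (u @ (whole zs @ a))"
      using rot_trans [OF rot] rot_append [of a "u @ whole zs"] split by simp
    moreover have "filling R j (fg u)" using ps split unfolding V_def by simp
    moreover have "filling R (n - j) (fg (whole zs @ a))"
    proof -
      have "valid R zs" using ps split unfolding V_def by simp
      then obtain g where g: "fg (whole zs) = fg (body zs) + g" "filling R (weight zs) g"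
        using whole_eq_body by blast
      have "filling R (i + weight zs) (fg (a @ body zs) + g)"
        using ps split g(2) C_words_words_filling [of "a @ body zs" i] unfolding V_def by (intro filling_add) auto
      moreover have "i + weight zs \<le> n - j" using ps split unfolding V_def by auto
      ultimately have "filling R (n - j) (fg (a @ body zs) + g)" by (rule filling_mono)
      then have "filling R (n - j) (fg a + fg (whole zs))" using g(1) by (simp add: group_norm)
      then show ?thesis using filling_swap [of R "n - j" "fg a" "fg (whole zs)"] by simp
    qed
    moreover have "j \<noteq> 0"
    proof
      assume "j = 0"
      then have "fg u = 0" using \<open>filling R j (fg u)\<close> by (simp add: filling_0_iff)
      then show False using parts [of a u j] split by (auto simp: fg_reduced_eq_0)
    qed
    moreover have "j < n" "j \<le> n" using ps ipos split unfolding V_def by auto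
    ultimately show ?thesis
      by (intro disjI2 exI [of _ u] exI [of _ "whole zs @ a"] exI [of _ j] exI [of _ "n - j"]) simp
  qed
qed

text \<open>By strong induction \<open>n\<close> may be taken minimal. The cyclically reduced core
  has the same fillings as \<open>w\<close>; if it is a corolla, the conjugation rule restores the
  tails, and otherwise it splits.\<close>

theorem filling_imp_D_upto: "reduced w \<Longrightarrow> w \<noteq> [] \<Longrightarrow> filling R n (fg w) \<Longrightarrow> D_upto n w"
proof (induction n arbitrary: w rule: less_induct)
  case (less n)
  show ?case
  proof (cases "\<exists>m<n. filling R m (fg w)")
    case True
    then obtain m where "m < n" "filling R m (fg w)" by blast
    with less.IH [of m w] less.prems show ?thesis
      unfolding D_upto_def by (meson less_imp_le order_trans)
  next
    case False
    obtain t w0 where w: "cyclically_reduced w0" "w = t @ w0 @ winv t"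
      using ex_cyclic_decomposition less.prems by blast
    have "w0 \<noteq> []"
    proof
      assume "w0 = []"
      then have "fg w = 0" using w by simp
      then show False using less.prems by (simp add: fg_reduced_eq_0)
    qed
    have "fconj (fg w) (fg w0)" using w by (intro fconjI [of _ "fg t"]) (simp add: group_norm)
    then have eq: "filling R m (fg w0) \<longleftrightarrow> filling R m (fg w)" for m using filling_fconj by blast
    have "(\<exists>i\<le>n. 1 \<le> i \<and> w0 \<in> C_words R i) \<or>
      (\<exists>p q i j. rot w0 (p @ q) \<and> filling R i (fg p) \<and> filling R j (fg q) \<and> i < n \<and> j < n \<and> i + j \<le> n)"
      using less.IH w(1) \<open>w0 \<noteq> []\<close> less.prems(3) False
      by (intro corolla_or_rotation_split) (auto simp: eq not_less)
    then show ?thesis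
    proof (elim disjE exE conjE)
      fix i assume "i \<le> n" "1 \<le> i" "w0 \<in> C_words R i"
      with w less.prems have "in_D UNIV R i (t @ w0 @ winv t)"
        by (intro in_D.conjugate) auto
      with w \<open>i \<le> n\<close> show ?thesis unfolding D_upto_def by blast
    next
      fix p q i j
      assume "rot w0 (p @ q)" "filling R i (fg p)" "filling R j (fg q)" "i < n" "j < n" "i + j \<le> n"
      then show ?thesis
        using less.IH less.prems(1) \<open>w0 \<noteq> []\<close> unfolding w(2)
        by (intro D_upto_of_rotation_split) auto
    qed
  qed
qed

end

subsection \<open>Relators and Dehn functions\<close>

text \<open>Conjugators in the area of a word over \<open>X\<close> may be taken over \<open>X\<close>, since deleting all other
  letters is a retraction of the free group.\<close>

definition restrict_word :: "'a set \<Rightarrow> 'a word \<Rightarrow> 'a word" where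
  "restrict_word X w = filter (\<lambda>l. fst l \<in> X) w"

lemma restrict_word_append [simp]:
  "restrict_word X (u @ v) = restrict_word X u @ restrict_word X v"
  by (simp add: restrict_word_def)

lemma restrict_word_winv [simp]: "restrict_word X (winv w) = winv (restrict_word X w)"
  by (induction w) (auto simp: restrict_word_def linv_def)

lemma restrict_word_in_words: "restrict_word X w \<in> words X"
  by (auto simp: restrict_word_def words_def)

lemma restrict_word_id: "w \<in> words X \<Longrightarrow> restrict_word X w = w"
  by (induction w) (auto simp: restrict_word_def words_Cons)

text \<open>The restriction keeps or deletes both letters of a cancelling pair.\<close>

lemma fg_restrict_reduced_form: "fg (restrict_word X (reduced_form w)) = fg (restrict_word X w)"
proof (induction w)
  case (Cons l w)
  have *: "fg (restrict_word X (cancel_cons l v)) = fg (restrict_word X [l]) + fg (restrict_word X v)" for v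
  proof (cases v)
    case (Cons m v')
    have "restrict_word X (m # v') = restrict_word X [m] @ restrict_word X v'"
      "restrict_word X (l # m # v') = restrict_word X [l] @ restrict_word X [m] @ restrict_word X v'"
      using restrict_word_append [of X "[m]" v'] restrict_word_append [of X "[l]" "m # v'"] by simp_all
    moreover have "restrict_word X [linv l] = winv (restrict_word X [l])"
      using restrict_word_winv [of X "[l]"] by simp
    ultimately show ?thesis using Cons by (simp add: group_norm)
  qed (simp add: restrict_word_def)
  have "restrict_word X (l # w) = restrict_word X [l] @ restrict_word X w"
    using restrict_word_append [of X "[l]" w] by simp
  then show ?case using Cons by (simp add: *)
qed simp

abbreviation conj_product :: "('a word \<times> 'a word) list \<Rightarrow> 'a word" where
  "conj_product ps \<equiv> concat (map (\<lambda>(u, r). u @ r @ winv u) ps)"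

lemma filling_conj_product:
  "set ps \<subseteq> UNIV \<times> R \<Longrightarrow> filling R (length ps) (fg (conj_product ps))"
proof (induction ps)
  case (Cons p ps)
  then show ?case
    using filling_step [of R "length ps" "fg (conj_product ps)" "snd p" "fg (fst p)"]
    by (cases p) (auto simp: group_norm)
qed (simp add: filling_zero)

lemma filling_imp_conj_product:
  "filling R n x \<Longrightarrow> \<exists>ps. length ps \<le> n \<and> set ps \<subseteq> UNIV \<times> R \<and> x = fg (conj_product ps)"
proof (induction rule: filling.induct)
  case (filling_zero n)
  then show ?case by (intro exI [of _ "[]"]) simp
next
  case (filling_step n x r g)
  then obtain ps where ps: "length ps \<le> n" "set ps \<subseteq> UNIV \<times> R" "x = fg (conj_product ps)" by blast
  obtain w where "g = fg w" by (metis fg_surj)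
  with ps filling_step show ?case by (intro exI [of _ "(w, r) # ps"]) (simp add: group_norm)
qed

text \<open>Each cut of the reduced form lifts to a cut of \<open>w\<close> itself with the same
  group elements on both sides. An insertion into the reduced form can thus be imitated in the
  unreduced word.\<close>

lemma prefix_of_reduced_form:
  "reduced_form w = w1 @ w2 \<Longrightarrow> \<exists>v1 v2. w = v1 @ v2 \<and> fg v1 = fg w1 \<and> fg v2 = fg w2"
proof (induction w arbitrary: w1 w2)
  case (Cons l w)
  show ?case
  proof (cases "reduced_form w \<noteq> [] \<and> hd (reduced_form w) = linv l")
    case True
    then obtain v where v: "reduced_form w = linv l # v" by (cases "reduced_form w") auto
    \<comment> \<open>The new letter cancels the first letter of the reduced form, so in the tail
      the cut comes one letter later.\<close>
    with Cons.prems have "reduced_form w = (linv l # w1) @ w2" by simp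
    then obtain v1 v2 where "w = v1 @ v2" "fg v1 = fg (linv l # w1)" "fg v2 = fg w2"
      using Cons.IH by blast
    moreover have "fg (l # linv l # w1) = fg w1" by (cases w1) (auto simp: fg_Cons)
    ultimately show ?thesis
      using fg_append [of "[l]" v1] fg_append [of "[l]" "linv l # w1"]
      by (intro exI [of _ "l # v1"] exI [of _ v2]) simp
  next
    case False
    then have eq: "l # reduced_form w = w1 @ w2" using Cons.prems by (cases "reduced_form w") auto
    show ?thesis
    proof (cases w1)
      case Nil
      then have "fg (l # w) = fg w2" using Cons.prems by (metis append_Nil fg_reduced_form)
      with Nil show ?thesis by (intro exI [of _ "[]"] exI [of _ "l # w"]) simp
    next
      case (Cons l' w1')
      with eq have "reduced_form w = w1' @ w2" "l' = l" by auto
      then obtain v1 v2 where "w = v1 @ v2" "fg v1 = fg w1'" "fg v2 = fg w2"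
        using Cons.IH by blast
      with Cons \<open>l' = l\<close> show ?thesis
        using fg_append [of "[l]" v1] fg_append [of "[l]" w1']
        by (intro exI [of _ "l # v1"] exI [of _ v2]) simp
    qed
  qed
qed simp

lemma max0_le_iff: "finite A \<Longrightarrow> max0 A \<le> k \<longleftrightarrow> (\<forall>a\<in>A. a \<le> k)"
  by (auto simp: max0_def)

context presentation
begin

lemma filling_words_iff:
  assumes "w \<in> words X" "reduced w"
  shows "filling R n (fg w) \<longleftrightarrow>
    (\<exists>ps. length ps \<le> n \<and> set ps \<subseteq> words X \<times> R \<and> w = reduced_form (conj_product ps))"
proof
  assume "filling R n (fg w)"
  then obtain ps where ps: "length ps \<le> n" "set ps \<subseteq> UNIV \<times> R" "fg w = fg (conj_product ps)"
    using filling_imp_conj_product by blast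
  define qs where "qs = map (\<lambda>(u, r). (restrict_word X u, r)) ps"
  have "restrict_word X (conj_product ps) = conj_product qs"
    unfolding qs_def using ps(2)
  proof (induction ps)
    case (Cons p ps)
    then show ?case by (cases p) (simp add: restrict_word_id relator_words)
  qed (simp add: restrict_word_def)
  moreover have "fg (restrict_word X w) = fg (restrict_word X (conj_product ps))"
    using fg_restrict_reduced_form [of X w] fg_restrict_reduced_form [of X "conj_product ps"] ps(3)
    unfolding fg_eq_iff by simp
  ultimately have "w = reduced_form (conj_product qs)"
    using assms by (simp add: fg_eq_iff reduced_form_reduced restrict_word_id)
  moreover have "length qs \<le> n" "set qs \<subseteq> words X \<times> R"
    using ps unfolding qs_def by (auto simp: restrict_word_in_words)
  ultimately show "\<exists>ps. length ps \<le> n \<and> set ps \<subseteq> words X \<times> R \<and> w = reduced_form (conj_product ps)"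
    by blast
next
  assume "\<exists>ps. length ps \<le> n \<and> set ps \<subseteq> words X \<times> R \<and> w = reduced_form (conj_product ps)"
  then obtain ps where "length ps \<le> n" "set ps \<subseteq> UNIV \<times> R" "w = reduced_form (conj_product ps)" by blast
  then show "filling R n (fg w)" using filling_mono [OF filling_conj_product] by auto
qed

lemma filling_uminus: "filling R n x \<Longrightarrow> filling R n (- x)"
proof (induction rule: filling.induct)
  case (filling_step n x r g)
  have "filling R (Suc 0) (g + fg (winv r) - g)"
    using filling.filling_step [OF filling.filling_zero relator_winv [OF filling_step(2)], of 0 g] by simp
  from filling_add [OF filling_step.IH this] show ?case by (simp add: group_norm)
qed (simp add: filling_zero)

text \<open>Fillable reduced words form a normal subgroup, with inverses because \<open>R\<close> is
  closed under inversion. Conversely, a filling is rewritten with conjugators over \<open>X\<close>,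
  so that every normal subgroup containing \<open>R\<close> contains its value.\<close>

lemma relators_eq: "relators X R = {w \<in> words X. reduced w \<and> (\<exists>n. filling R n (fg w))}" (is "_ = ?N")
proof
  interpret F: group "free_group X" by (rule group_free_group)
  have mult: "x \<otimes>\<^bsub>free_group X\<^esub> y = reduced_form (x @ y)" for x y by (simp add: free_group_def)
  have carrier: "x \<in> carrier (free_group X) \<longleftrightarrow> x \<in> words X \<and> reduced x" for x by (simp add: free_group_def)
  have one: "\<one>\<^bsub>free_group X\<^esub> = []" by (simp add: free_group_def)
  have inv: "inv\<^bsub>free_group X\<^esub> x = winv x" if "x \<in> carrier (free_group X)" for x
    using that by (intro F.inv_equality) (auto simp: mult one carrier reduced_form_winv_left winv_words)
  have "subgroup ?N (free_group X)"
  proof (rule F.subgroupI)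
    show "?N \<subseteq> carrier (free_group X)" by (auto simp: carrier)
    have "[] \<in> ?N" using filling_zero by (auto simp: words_def)
    then show "?N \<noteq> {}" by blast
  next
    fix a assume "a \<in> ?N"
    then show "inv\<^bsub>free_group X\<^esub> a \<in> ?N" using filling_uminus by (auto simp: inv carrier winv_words)
  next
    fix a b assume "a \<in> ?N" "b \<in> ?N"
    then show "a \<otimes>\<^bsub>free_group X\<^esub> b \<in> ?N"
      by (auto simp: mult reduced_reduced_form reduced_form_words intro: filling_add)
  qed
  moreover have "x \<otimes>\<^bsub>free_group X\<^esub> h \<otimes>\<^bsub>free_group X\<^esub> inv\<^bsub>free_group X\<^esub> x \<in> ?N"
    if "x \<in> carrier (free_group X)" "h \<in> ?N" for x h
    using that filling_conj [of R _ "fg h" "fg x"]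
    by (auto simp: mult inv carrier reduced_reduced_form reduced_form_words winv_words group_norm)
  ultimately have "?N \<lhd> free_group X"
    by (auto simp: F.normal_inv_iff)
  moreover have "R \<subseteq> ?N"
  proof
    fix r assume r: "r \<in> R"
    then have "r \<in> C_words R (Suc 0)" unfolding C_words_1_iff using rot_refl by blast
    then have "filling R (Suc 0) (fg r)" "reduced r" using C_words_words_filling C_words_reduced by blast+
    then show "r \<in> ?N" using relator_words [OF r] by blast
  qed
  ultimately show "relators X R \<subseteq> ?N"
    unfolding relators_def normal_closure_def by blast
  show "?N \<subseteq> relators X R"
    unfolding relators_def normal_closure_def
  proof (intro subsetI InterI, elim CollectE conjE exE)
    fix w n N
    assume w: "w \<in> words X" "reduced w" "filling R n (fg w)" and N: "N \<lhd> free_group X" "R \<subseteq> N"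
    interpret N: normal N "free_group X" by (rule N(1))
    obtain ps where ps: "set ps \<subseteq> words X \<times> R" "w = reduced_form (conj_product ps)"
      using w filling_words_iff by blast
    have "reduced_form (conj_product ps) \<in> N"
      using ps(1)
    proof (induction ps)
      case Nil
      then show ?case using N.one_closed by (simp add: one)
    next
      case (Cons p ps)
      obtain u r where p: "p = (u, r)" by (cases p)
      have u: "reduced_form u \<in> carrier (free_group X)"
        using Cons.prems p by (simp add: carrier reduced_reduced_form reduced_form_words)
      have "r \<in> N" using Cons.prems p N by auto
      then have "reduced_form u \<otimes>\<^bsub>free_group X\<^esub> r \<otimes>\<^bsub>free_group X\<^esub> inv\<^bsub>free_group X\<^esub> (reduced_form u) \<in> N"
        using u N.inv_op_closed2 by blast
      moreover have "reduced_form (reduced_form (reduced_form u @ r) @ winv (reduced_form u)) =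
          reduced_form (u @ r @ winv u)"
        by (simp add: fg_eq_iff [symmetric] group_norm)
      ultimately have "reduced_form (u @ r @ winv u) \<in> N" using u by (simp add: mult inv)
      then have "reduced_form (u @ r @ winv u) \<otimes>\<^bsub>free_group X\<^esub> reduced_form (conj_product ps) \<in> N"
        using Cons N.m_closed by auto
      moreover have "reduced_form (reduced_form (u @ r @ winv u) @ reduced_form (conj_product ps)) =
          reduced_form (conj_product (p # ps))"
        by (simp add: fg_eq_iff [symmetric] group_norm p)
      ultimately show ?case by (simp add: mult)
    qed
    with ps show "w \<in> N" by simp
  qed
qed

text \<open>\<open>area\<close> minimises over exact numbers of factors and \<open>filling\<close>
  bounds them from above; being a relator guarantees that the minimum exists.\<close>

lemma area_le_iff:
  assumes "w \<in> relators X R"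
  shows "area X R w \<le> k \<longleftrightarrow> filling R k (fg w)"
proof -
  let ?P = "\<lambda>k. \<exists>ps. length ps = k \<and> set ps \<subseteq> words X \<times> R \<and> w = reduced_form (conj_product ps)"
  have w: "w \<in> words X" "reduced w" "\<exists>n. filling R n (fg w)" using assms relators_eq by auto
  then have ex: "\<exists>k. ?P k" using filling_words_iff by blast
  have "?P (area X R w)" unfolding area_def by (rule LeastI_ex [OF ex])
  then obtain ps where "length ps = area X R w" "set ps \<subseteq> words X \<times> R" "w = reduced_form (conj_product ps)"
    by blast
  then have "filling R (area X R w) (fg w)"
    unfolding filling_words_iff [OF w(1,2)] by (intro exI [of _ ps] conjI) simp_all
  moreover have "area X R w \<le> k" if filling: "filling R k (fg w)"
  proof -
    obtain ps where ps: "length ps \<le> k" "set ps \<subseteq> words X \<times> R" "w = reduced_form (conj_product ps)"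
      using filling unfolding filling_words_iff [OF w(1,2)] by (elim exE conjE)
    have "?P (length ps)" by (intro exI [of _ ps] conjI refl ps)
    then have "area X R w \<le> length ps" unfolding area_def by (rule Least_le)
    with ps(1) show ?thesis by simp
  qed
  ultimately show ?thesis using filling_mono by blast
qed

lemma relators_in_D:
  assumes "w \<in> relators X R" "w \<noteq> []"
  shows "in_D X R (area X R w) w"
proof -
  have w: "w \<in> words X" "reduced w" using assms relators_eq by auto
  obtain h where h: "h \<le> area X R w" "in_D UNIV R h w"
    using filling_imp_D_upto [OF w(2) assms(2)] area_le_iff [OF assms(1)] unfolding D_upto_def by blast
  then have D: "in_D X R h w" using w in_D_UNIV_imp by blast
  then have "area X R w \<le> h" using in_D_properties area_le_iff [OF assms(1)] by blast
  with h D show ?thesis by simp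
qed

lemma in_D_relators: "in_D X R k w \<Longrightarrow> w \<in> relators X R"
  using in_D_properties relators_eq by blast

lemma C_words_relators: "c \<in> C_words R k \<Longrightarrow> c \<in> relators X R"
  using C_words_words_filling C_words_reduced relators_eq by blast

text \<open>A relator \<open>c \<noteq> []\<close> lies in D at index \<open>area X R c\<close> and
  at no smaller index, since an index in D bounds the area. For \<open>c\<close> in
  \<open>C_words R k\<close> the area is at most \<open>k\<close>, so avoiding all smaller D forces
  equality.\<close>

lemma proper_corolla_iff:
  "proper_corolla X R c \<longleftrightarrow> c \<in> relators X R \<and> c \<in> C_words R (area X R c)"
proof
  assume "proper_corolla X R c"
  then obtain k where k: "c \<in> C_words R k" "\<And>h. 1 \<le> h \<Longrightarrow> h < k \<Longrightarrow> \<not> in_D X R h c"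
    by (auto simp: proper_corolla_def D_words_def)
  have rel: "c \<in> relators X R" using k C_words_relators by blast
  have "in_D X R (area X R c) c"
    using relators_in_D [OF rel] k C_words_cyclically_reduced by blast
  then have "k \<le> area X R c" using k(2) in_D_properties by (meson not_le)
  moreover have "area X R c \<le> k" using area_le_iff [OF rel] k C_words_words_filling by blast
  ultimately show "c \<in> relators X R \<and> c \<in> C_words R (area X R c)" using rel k by simp
next
  assume c: "c \<in> relators X R \<and> c \<in> C_words R (area X R c)"
  then have "1 \<le> area X R c" by (cases "area X R c") auto
  moreover have "\<not> in_D X R h c" if "h < area X R c" for h
    using that c in_D_properties area_le_iff by (meson not_le)
  ultimately show "proper_corolla X R c"
    using c by (auto simp: proper_corolla_def D_words_def)
qed

text \<open>Inserting the inverse of a face at one of its boundary vertices removes the face, which makes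
  the area decidable by inserting relators and reducing freely.\<close>

lemma in_D_face:
  "in_D X R k w \<Longrightarrow> \<exists>w1 w2 r. w = w1 @ w2 \<and> r \<in> C_words R (Suc 0) \<and> filling R (k - 1) (fg (w1 @ r @ w2))"
proof (induction rule: in_D.induct)
  case (conjugate k c u)
  then obtain z c' where c: "c = z # c'" using C_words_cyclically_reduced by (meson neq_Nil_conv)
  then obtain r x where r: "z # r \<in> C_words R (Suc 0)" "fg c = fg (z # r) + x" "filling R (k - 1) x"
    using C_words_first_letter conjugate by blast
  have "filling R (k - 1) (fg (u @ winv (z # r) @ (c @ winv u)))"
    using r(2) filling_conj [OF r(3), of "fg u"] unfolding fg_append fg_winv by (simp add: group_norm)
  with C_words_1_winv [OF r(1)] show ?case by blast
next
  case (insertion i j u w1 w2)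
  then obtain u1 u2 r where u: "u = u1 @ u2" "r \<in> C_words R (Suc 0)" "filling R (i - 1) (fg (u1 @ r @ u2))"
    by blast
  have "filling R j (fg w1 + fg w2)" using in_D_properties [OF insertion(4)] by simp
  from filling_insert [OF u(3) this] have "filling R (i + j - 1) (fg ((w1 @ u1) @ r @ (u2 @ w2)))"
    using insertion(1) by (simp add: group_norm)
  with u show ?case by (metis append.assoc)
qed

text \<open>Valid for unreduced \<open>w\<close> as well, so the recursion can be iterated as a
  plain search: the face is found in the reduced form and its vertex is pulled back to
  \<open>w\<close>.\<close>

lemma filling_Suc_iff:
  "filling R (Suc k) (fg w) \<longleftrightarrow> filling R k (fg w) \<or>
    (\<exists>w1 w2 r. w = w1 @ w2 \<and> r \<in> C_words R (Suc 0) \<and> filling R k (fg (w1 @ r @ w2)))"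
proof
  assume filling: "filling R (Suc k) (fg w)"
  show "filling R k (fg w) \<or> (\<exists>w1 w2 r. w = w1 @ w2 \<and> r \<in> C_words R (Suc 0) \<and> filling R k (fg (w1 @ r @ w2)))"
  proof (cases "reduced_form w = []")
    case True
    then show ?thesis by (simp add: fg_eq_0_iff [symmetric] filling_zero)
  next
    case False
    interpret U: presentation UNIV R by (rule presentation_UNIV)
    obtain h where "h \<le> Suc k" "in_D UNIV R h (reduced_form w)"
      using filling_imp_D_upto [OF reduced_reduced_form False] filling unfolding D_upto_def by auto
    then obtain w1 w2 r where 1: "reduced_form w = w1 @ w2" "r \<in> C_words R (Suc 0)" "filling R k (fg (w1 @ r @ w2))"
      using U.in_D_face filling_mono [of R "h - 1" _ k] by (metis Suc_eq_plus1 le_diff_conv)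
    then obtain v1 v2 where "w = v1 @ v2" "fg v1 = fg w1" "fg v2 = fg w2"
      using prefix_of_reduced_form by blast
    with 1 show ?thesis by (metis fg_append)
  qed
next
  assume "filling R k (fg w) \<or> (\<exists>w1 w2 r. w = w1 @ w2 \<and> r \<in> C_words R (Suc 0) \<and> filling R k (fg (w1 @ r @ w2)))"
  then show "filling R (Suc k) (fg w)"
  proof (elim disjE exE conjE)
    assume "filling R k (fg w)"
    then show ?thesis by (rule filling_mono) simp
  next
    fix w1 w2 r assume w: "w = w1 @ w2" "r \<in> C_words R (Suc 0)" "filling R k (fg (w1 @ r @ w2))"
    have "filling R (Suc 0) (fg (winv r))" using C_words_1_winv [OF w(2)] C_words_words_filling by blast
    from filling_add [OF filling_conj [OF this, of "fg w1"] w(3)] show ?thesis using w(1) by (simp add: group_norm)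
  qed
qed

end

section \<open>Comparison of the two Dehn functions\<close>

locale finite_presentation = presentation +
  assumes finite_X: "finite X" and finite_R: "finite R"
begin

lemma finite_short_words: "finite {w \<in> words X. length w \<le> n}"
  using finite_lists_length_le [of "X \<times> (UNIV :: bool set)" n] finite_X
  by (auto simp: words_def lists_eq_set intro: rev_finite_subset)

lemma finite_short_relators: "finite {w. w \<in> relators X R \<and> length w \<le> n}"
  by (rule finite_subset [OF _ finite_short_words [of n]]) (auto simp: relators_eq)

lemma dehn_le_iff: "dehn X R n \<le> k \<longleftrightarrow> (\<forall>w\<in>relators X R. length w \<le> n \<longrightarrow> filling R k (fg w))"
proof -
  have "finite {area X R w | w. w \<in> relators X R \<and> length w \<le> n}"
    using finite_short_relators [of n] by simp
  then show ?thesis unfolding dehn_def using area_le_iff by (auto simp: max0_le_iff)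
qed

lemma dehn0_le_iff:
  "dehn0 X R n \<le> k \<longleftrightarrow> (\<forall>c. proper_corolla X R c \<longrightarrow> length c \<le> n \<longrightarrow> filling R k (fg c))"
proof -
  have "finite {c. proper_corolla X R c \<and> length c \<le> n}"
    by (rule finite_subset [OF _ finite_short_relators [of n]]) (auto simp: proper_corolla_iff)
  then have "finite {area X R c | c. proper_corolla X R c \<and> length c \<le> n}" by simp
  then show ?thesis unfolding dehn0_def using area_le_iff by (auto simp: max0_le_iff proper_corolla_iff)
qed

lemma dehn0_le_dehn: "dehn0 X R n \<le> dehn X R n"
  unfolding dehn0_le_iff using dehn_le_iff [of n "dehn X R n"] by (auto simp: proper_corolla_iff)

text \<open>Induction on length along the last rule for D. Under conjugation the core has the area
  of \<open>w\<close>, so it is a proper corolla of length at most \<open>n\<close>; under insertion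
  both words are shorter and their lengths add up.\<close>

lemma area_le_length_times_dehn0:
  "w \<in> relators X R \<Longrightarrow> length w \<le> n \<Longrightarrow> filling R (length w * dehn0 X R n) (fg w)"
proof (induction w rule: length_induct)
  case (1 w)
  show ?case
  proof (cases "w = []")
    case True
    then show ?thesis by (simp add: filling_zero)
  next
    case False
    then have "in_D X R (area X R w) w" using 1 relators_in_D by blast
    then show ?thesis
    proof (cases rule: in_D.cases)
      case (conjugate c u)
      have c: "c \<in> relators X R" using conjugate C_words_relators by blast
      have "fconj (fg w) (fg c)" using conjugate by (intro fconjI [of _ "fg u"]) (simp add: group_norm)
      then have filling: "filling R k (fg w) \<longleftrightarrow> filling R k (fg c)" for k using filling_fconj by blast
      then have "area X R c = area X R w"
        using area_le_iff [OF c] area_le_iff [of w] 1 by (metis order_antisym order_refl)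
      then have "proper_corolla X R c" using conjugate c by (simp add: proper_corolla_iff)
      moreover have "length c \<le> n" using conjugate 1 by simp
      ultimately have "filling R (dehn0 X R n) (fg w)"
        using dehn0_le_iff [of n "dehn0 X R n"] filling by simp
      moreover have "dehn0 X R n \<le> length w * dehn0 X R n" using False by (cases w) auto
      ultimately show ?thesis by (rule filling_mono)
    next
      case (insertion i j u w1 w2)
      have ne: "u \<noteq> []" "w1 @ w2 \<noteq> []" using insertion in_D_properties by blast+
      have "u \<in> relators X R" "w1 @ w2 \<in> relators X R" using insertion in_D_relators by blast+
      then have "filling R (length u * dehn0 X R n) (fg u)" "filling R (length (w1 @ w2) * dehn0 X R n) (fg w1 + fg w2)"
        using 1(1) [rule_format, of u] 1(1) [rule_format, of "w1 @ w2"] 1(3) insertion(1,2) ne by auto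
      from filling_insert [OF this] show ?thesis using insertion by (simp add: group_norm algebra_simps)
    qed
  qed
qed

lemma dehn_le_times_dehn0: "dehn X R n \<le> n * dehn0 X R n"
  unfolding dehn_le_iff using area_le_length_times_dehn0 by (metis filling_mono mult_le_mono1)

end

subsection \<open>Computable functions on encoded data\<close>

lemma rec_comp1: "rec_eval g xs y \<Longrightarrow> rec_eval f [y] z \<Longrightarrow> rec_eval (Comp f [g]) xs z"
  by (rule rec_eval.comp [of _ _ "[y]"]) auto

lemma rec_comp2:
  "rec_eval g xs y \<Longrightarrow> rec_eval g' xs y' \<Longrightarrow> rec_eval f [y, y'] z \<Longrightarrow> rec_eval (Comp f [g, g']) xs z"
  by (rule rec_eval.comp [of _ _ "[y, y']"]) auto

lemma rec_proj: "i < length xs \<Longrightarrow> y = xs ! i \<Longrightarrow> rec_eval (Proj i) xs y"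
  by (simp add: rec_eval.proj)

primrec const_prog :: "nat \<Rightarrow> recf" where
  "const_prog 0 = Zero"
| "const_prog (Suc n) = Comp Succ [const_prog n]"

lemma const_prog: "rec_eval (const_prog n) xs n"
  by (induction n) (auto intro: rec_eval.zero rec_eval.succ rec_comp1)

definition "add_prog = Prim (Proj 0) (Comp Succ [Proj 1])"

lemma add_prog: "rec_eval add_prog [m, n] (m + n)"
  unfolding add_prog_def
  by (induction m) (auto intro!: rec_eval.prim_0 rec_eval.prim_Suc rec_comp1 rec_eval.succ intro: rec_proj)

definition "pred_prog = Prim Zero (Proj 0)"

lemma pred_prog: "rec_eval pred_prog [n] (n - 1)"
  unfolding pred_prog_def
proof (induction n)
  case (Suc n)
  have "rec_eval (Proj 0) [n, n - 1] n" by (rule rec_proj) auto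
  from rec_eval.prim_Suc [OF Suc this] show ?case by simp
qed (auto intro: rec_eval.prim_0 rec_eval.zero)

definition "monus_prog = Prim (Proj 0) (Comp pred_prog [Proj 1])"

lemma monus_prog: "rec_eval monus_prog [m, n] (n - m)"
  unfolding monus_prog_def
proof (induction m)
  case 0
  show ?case by (intro rec_eval.prim_0 rec_proj) auto
next
  case (Suc m)
  have "rec_eval (Comp pred_prog [Proj 1]) [m, n - m, n] (n - m - 1)"
    by (rule rec_comp1 [OF rec_proj pred_prog]) auto
  from rec_eval.prim_Suc [OF Suc this] show ?case by simp
qed

definition "triangle_prog = Prim Zero (Comp add_prog [Proj 1, Comp Succ [Proj 0]])"

lemma triangle_prog: "rec_eval triangle_prog [n] (triangle n)"
  unfolding triangle_prog_def
proof (induction n)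
  case 0
  show ?case by (auto intro: rec_eval.prim_0 rec_eval.zero)
next
  case (Suc n)
  have "rec_eval (Comp add_prog [Proj 1, Comp Succ [Proj 0]]) [n, triangle n] (triangle n + Suc n)"
    by (rule rec_comp2 [OF rec_proj rec_comp1 [OF rec_proj rec_eval.succ] add_prog]) auto
  from rec_eval.prim_Suc [OF Suc this] show ?case by simp
qed

definition "pair_prog f g = Comp (Comp add_prog [Comp triangle_prog [add_prog], Proj 0]) [f, g]"

lemma pair_prog:
  assumes "rec_eval f xs m" "rec_eval g xs n"
  shows "rec_eval (pair_prog f g) xs (prod_encode (m, n))"
  unfolding pair_prog_def prod_encode_def prod.case
  by (rule rec_comp2 [OF assms rec_comp2 [OF rec_comp1 [OF add_prog triangle_prog] rec_proj add_prog]]) auto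

text \<open>Since \<open>prod_encode (m, n) = triangle (m + n) + m\<close>, the sum
  \<open>m + n\<close> is the least \<open>s\<close> with \<open>z < triangle (Suc s)\<close> for
  the code \<open>z\<close>, that is, with \<open>Suc z - triangle (Suc s) = 0\<close>.\<close>

definition "diagonal_prog = Mu (Comp monus_prog [Comp triangle_prog [Comp Succ [Proj 0]], Comp Succ [Proj 1]])"

lemma mono_triangle: "m \<le> n \<Longrightarrow> triangle m \<le> triangle n"
  by (induction n) (auto simp: le_Suc_eq)

lemma diagonal_prog: "rec_eval diagonal_prog [prod_encode (m, n)] (m + n)"
  unfolding diagonal_prog_def
proof (rule rec_eval.mu)
  let ?f = "Comp monus_prog [Comp triangle_prog [Comp Succ [Proj 0]], Comp Succ [Proj 1]]"
  have eval: "rec_eval ?f [s, z] (Suc z - triangle (Suc s))" for s z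
    by (rule rec_comp2 [OF rec_comp1 [OF rec_comp1 [OF rec_proj rec_eval.succ] triangle_prog]
          rec_comp1 [OF rec_proj rec_eval.succ] monus_prog]) auto
  show "rec_eval ?f [m + n, prod_encode (m, n)] 0"
    using eval [of "m + n" "prod_encode (m, n)"] by (simp add: prod_encode_def)
  show "\<forall>s<m + n. \<exists>y. rec_eval ?f [s, prod_encode (m, n)] y \<and> 0 < y"
  proof (intro allI impI exI conjI)
    fix s assume "s < m + n"
    then have "triangle (Suc s) \<le> triangle (m + n)" by (intro mono_triangle) simp
    then show "0 < Suc (prod_encode (m, n)) - triangle (Suc s)" unfolding prod_encode_def by simp
  qed (rule eval)
qed

definition "fst_prog = Comp monus_prog [Comp triangle_prog [diagonal_prog], Proj 0]"
definition "snd_prog = Comp monus_prog [fst_prog, diagonal_prog]"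

lemma fst_prog: "rec_eval fst_prog [prod_encode (m, n)] m"
proof -
  have "rec_eval fst_prog [prod_encode (m, n)] (prod_encode (m, n) - triangle (m + n))"
    unfolding fst_prog_def
    by (rule rec_comp2 [OF rec_comp1 [OF diagonal_prog triangle_prog] rec_proj monus_prog]) auto
  then show ?thesis by (simp add: prod_encode_def)
qed

lemma snd_prog: "rec_eval snd_prog [prod_encode (m, n)] n"
  using rec_comp2 [OF fst_prog diagonal_prog monus_prog, of m n] unfolding snd_prog_def by simp

text \<open>The encodings are bijective so that every program halts on every number that it meets as
  an intermediate value of a primitive recursion.\<close>

class encodable =
  fixes enc :: "'a \<Rightarrow> nat"
  assumes bij_enc: "bij enc"

definition dec :: "nat \<Rightarrow> 'a::encodable" where
  "dec = inv_into UNIV enc"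

lemma enc_dec [simp]: "enc (dec n) = n"
  unfolding dec_def by (rule surj_f_inv_f [OF bij_is_surj [OF bij_enc]])

lemma dec_enc [simp]: "dec (enc x) = x"
  by (simp add: dec_def bij_enc bij_is_inj)

lemma enc_inject: "enc x = enc y \<longleftrightarrow> x = y"
  by (metis dec_enc)

instantiation nat :: encodable
begin
definition enc_nat :: "nat \<Rightarrow> nat" where "enc_nat n = n"
instance by standard (simp add: enc_nat_def [abs_def] bij_def)
end

instantiation prod :: (encodable, encodable) encodable
begin
definition enc_prod :: "'a \<times> 'b \<Rightarrow> nat" where "enc_prod p = prod_encode (enc (fst p), enc (snd p))"
instance
proof
  have "(enc :: 'a \<times> 'b \<Rightarrow> nat) = prod_encode \<circ> map_prod enc enc"
    by (auto simp: enc_prod_def)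
  moreover have "bij (map_prod (enc :: 'a \<Rightarrow> nat) (enc :: 'b \<Rightarrow> nat))"
    using bij_betw_map_prod [OF bij_enc bij_enc] by simp
  ultimately show "bij (enc :: 'a \<times> 'b \<Rightarrow> nat)"
    using bij_prod_encode by (metis bij_comp)
qed
end

instantiation list :: (encodable) encodable
begin
definition enc_list :: "'a list \<Rightarrow> nat" where "enc_list xs = list_encode (map enc xs)"
instance
proof
  have "(enc :: 'a list \<Rightarrow> nat) = list_encode \<circ> map enc"
    by (auto simp: enc_list_def)
  moreover have "bij (map (enc :: 'a \<Rightarrow> nat))"
    by (rule o_bij [of "map dec"]) (auto simp: fun_eq_iff map_idI)
  ultimately show "bij (enc :: 'a list \<Rightarrow> nat)"
    using bij_list_encode by (metis bij_comp)
qed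
end

lemma enc_Nil: "enc ([] :: 'a::encodable list) = 0"
  and enc_Cons: "enc (x # xs) = Suc (enc (x, xs))" for x :: "'a::encodable"
  by (simp_all add: enc_list_def enc_prod_def)

text \<open>One argument serves for all variables in scope: rules for operators that bind variables
  ask for the body as a function of a tuple of the outer argument and the bound variables. The rules
  then follow the syntax of a term.\<close>

definition comp_fun :: "('a::encodable \<Rightarrow> 'b::encodable) \<Rightarrow> bool" where
  "comp_fun f \<longleftrightarrow> (\<exists>p. \<forall>x. rec_eval p [enc x] (enc (f x)))"

definition comp_pred :: "('a::encodable \<Rightarrow> bool) \<Rightarrow> bool" where
  "comp_pred P \<longleftrightarrow> comp_fun (\<lambda>x. of_bool (P x) :: nat)"

lemma computable_iff_comp_fun: "computable f \<longleftrightarrow> comp_fun f"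
  by (simp add: computable_def comp_fun_def enc_nat_def)

named_theorems computability_intros

lemma comp_fun_id [computability_intros]: "comp_fun (\<lambda>x. x)"
  unfolding comp_fun_def by (intro exI [of _ "Proj 0"] allI rec_proj) auto

lemma comp_fun_const [computability_intros]: "comp_fun (\<lambda>x. c)"
  unfolding comp_fun_def using const_prog by blast

lemma comp_fun_comp: "comp_fun f \<Longrightarrow> comp_fun g \<Longrightarrow> comp_fun (\<lambda>x. f (g x))"
  unfolding comp_fun_def by (meson rec_comp1)

lemma comp_fun_Pair [computability_intros]: "comp_fun f \<Longrightarrow> comp_fun g \<Longrightarrow> comp_fun (\<lambda>x. (f x, g x))"
  unfolding comp_fun_def enc_prod_def fst_conv snd_conv by (meson pair_prog)

lemma comp_fun_fst [computability_intros]: "comp_fun f \<Longrightarrow> comp_fun (\<lambda>x. fst (f x))"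
proof (rule comp_fun_comp [of fst])
  show "comp_fun (fst :: 'b \<times> 'c \<Rightarrow> 'b)"
    unfolding comp_fun_def enc_prod_def using fst_prog by blast
qed

lemma comp_fun_snd [computability_intros]: "comp_fun f \<Longrightarrow> comp_fun (\<lambda>x. snd (f x))"
proof (rule comp_fun_comp [of snd])
  show "comp_fun (snd :: 'b \<times> 'c \<Rightarrow> 'c)"
    unfolding comp_fun_def enc_prod_def using snd_prog by blast
qed

lemma comp_fun_enc [computability_intros]: "comp_fun f \<Longrightarrow> comp_fun (\<lambda>x. enc (f x))"
  by (simp add: comp_fun_def enc_nat_def)

lemma comp_fun_dec [computability_intros]: "comp_fun f \<Longrightarrow> comp_fun (\<lambda>x. dec (f x))"
  by (simp add: comp_fun_def enc_nat_def)

lemma comp_fun_Suc [computability_intros]: "comp_fun f \<Longrightarrow> comp_fun (\<lambda>x. Suc (f x))"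
proof (rule comp_fun_comp [of Suc])
  show "comp_fun Suc" unfolding comp_fun_def enc_nat_def using rec_eval.succ by blast
qed

lemma comp_fun_rec_nat [computability_intros]:
  assumes "comp_fun h" "comp_fun f" "comp_fun (\<lambda>t. g (fst t) (fst (snd t)) (snd (snd t)))"
  shows "comp_fun (\<lambda>x. rec_nat (f x) (\<lambda>n y. g x n y) (h x))"
proof -
  obtain ph pf pg where h: "\<And>x. rec_eval ph [enc x] (enc (h x))"
    and f: "\<And>x. rec_eval pf [enc x] (enc (f x))"
    and g: "\<And>t. rec_eval pg [enc t] (enc (g (fst t) (fst (snd t)) (snd (snd t))))"
    using assms unfolding comp_fun_def by blast
  let ?step = "Comp pg [pair_prog (Proj 2) (pair_prog (Proj 0) (Proj 1))]"
  have step: "rec_eval ?step [n, enc y, enc x] (enc (g x n y))" for n x y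
  proof (rule rec_comp1)
    have "rec_eval (pair_prog (Proj 2) (pair_prog (Proj 0) (Proj 1))) [n, enc y, enc x]
        (prod_encode (enc x, prod_encode (n, enc y)))"
      by (intro pair_prog rec_proj) auto
    then show "rec_eval (pair_prog (Proj 2) (pair_prog (Proj 0) (Proj 1))) [n, enc y, enc x] (enc (x, n, y))"
      by (simp add: enc_prod_def enc_nat_def)
    show "rec_eval pg [enc (x, n, y)] (enc (g x n y))" using g [of "(x, n, y)"] by simp
  qed
  have rec: "rec_eval (Prim pf ?step) [n, enc x] (enc (rec_nat (f x) (g x) n))" for n x
  proof (induction n)
    case (Suc n)
    from rec_eval.prim_Suc [OF Suc step] show ?case by simp
  qed (simp add: rec_eval.prim_0 f)
  have "rec_eval (Comp (Prim pf ?step) [ph, Proj 0]) [enc x] (enc (rec_nat (f x) (g x) (h x)))" for x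
    by (rule rec_comp2 [OF h rec_proj]) (use rec in \<open>auto simp: enc_nat_def\<close>)
  then show ?thesis unfolding comp_fun_def by blast
qed

lemma comp_fun_minus [computability_intros]: "comp_fun f \<Longrightarrow> comp_fun g \<Longrightarrow> comp_fun (\<lambda>x. f x - (g x :: nat))"
proof -
  assume fg: "comp_fun f" "comp_fun g"
  have eq: "f x - g x = rec_nat (f x) (\<lambda>_ y. rec_nat 0 (\<lambda>n _. n) y) (g x)" for x
  proof -
    have "rec_nat (f x) (\<lambda>_ y. rec_nat 0 (\<lambda>n _. n) y) k = f x - k" for k
    proof (induction k)
      case (Suc k)
      then show ?case by (cases "f x - k") auto
    qed simp
    then show ?thesis by simp
  qed
  show ?thesis unfolding eq by (intro computability_intros fg)
qed

lemma comp_fun_mult: "comp_fun f \<Longrightarrow> comp_fun g \<Longrightarrow> comp_fun (\<lambda>x. f x * (g x :: nat))"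
proof -
  assume fg: "comp_fun f" "comp_fun g"
  have eq: "f x * g x = rec_nat 0 (\<lambda>_ y. rec_nat y (\<lambda>_. Suc) (g x)) (f x)" for x
  proof -
    have plus: "rec_nat y (\<lambda>_. Suc) k = k + y" for k y by (induction k) auto
    have "rec_nat 0 (\<lambda>_ y. rec_nat y (\<lambda>_. Suc) (g x)) k = k * g x" for k
      by (induction k) (simp_all add: plus)
    then show ?thesis by simp
  qed
  show ?thesis unfolding eq by (intro computability_intros comp_fun_comp [OF fg(2)] fg)
qed

lemma comp_fun_if [computability_intros]: "comp_pred P \<Longrightarrow> comp_fun f \<Longrightarrow> comp_fun g \<Longrightarrow> comp_fun (\<lambda>x. if P x then f x else g x)"
proof -
  assume P: "comp_pred P" and fg: "comp_fun f" "comp_fun g"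
  have eq: "(if P x then f x else g x) = rec_nat (g x) (\<lambda>_ _. f x) (of_bool (P x))" for x by simp
  show ?thesis unfolding eq
    by (intro computability_intros P [unfolded comp_pred_def] fg comp_fun_comp [OF fg(1)])
qed

lemma comp_pred_not [computability_intros]: "comp_pred P \<Longrightarrow> comp_pred (\<lambda>x. \<not> P x)"
proof -
  assume P: "comp_pred P"
  have eq: "of_bool (\<not> P x) = (if P x then 0 else 1 :: nat)" for x by simp
  show ?thesis unfolding comp_pred_def eq by (intro computability_intros P)
qed

lemma comp_pred_conj [computability_intros]: "comp_pred P \<Longrightarrow> comp_pred Q \<Longrightarrow> comp_pred (\<lambda>x. P x \<and> Q x)"
proof -
  assume P: "comp_pred P" and Q: "comp_pred Q"
  have eq: "of_bool (P x \<and> Q x) = (if P x then of_bool (Q x) else 0 :: nat)" for x by simp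
  show ?thesis unfolding comp_pred_def eq by (intro computability_intros P Q [unfolded comp_pred_def])
qed

lemma comp_pred_imp [computability_intros]: "comp_pred P \<Longrightarrow> comp_pred Q \<Longrightarrow> comp_pred (\<lambda>x. P x \<longrightarrow> Q x)"
proof -
  assume P: "comp_pred P" and Q: "comp_pred Q"
  have eq: "(P x \<longrightarrow> Q x) = (\<not> (P x \<and> \<not> Q x))" for x by blast
  show ?thesis unfolding eq by (intro computability_intros P Q)
qed

lemma comp_pred_eq [computability_intros]: "comp_fun f \<Longrightarrow> comp_fun g \<Longrightarrow> comp_pred (\<lambda>x. f x = g x)"
proof -
  assume fg: "comp_fun f" "comp_fun g"
  have eq: "of_bool (f x = g x) =
      rec_nat (rec_nat 1 (\<lambda>_ _. 0) (enc (g x) - enc (f x))) (\<lambda>_ _. 0 :: nat) (enc (f x) - enc (g x))" for x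
    by (cases "enc (f x) - enc (g x)"; cases "enc (g x) - enc (f x)")
      (auto simp: enc_inject [symmetric, where 'a = 'b])
  show ?thesis unfolding comp_pred_def eq by (intro computability_intros fg)
qed

text \<open>The existence premise makes the search halt for every \<open>x\<close>.
  \<open>Mu\<close> searches over the first argument, hence the swapped pair in the proof.\<close>

lemma comp_fun_Least [computability_intros]:
  fixes P :: "'a::encodable \<Rightarrow> nat \<Rightarrow> bool"
  assumes "comp_pred (\<lambda>t. P (fst t) (snd t))" "\<And>x. \<exists>n. P x n"
  shows "comp_fun (\<lambda>x. LEAST n. P x n)"
proof -
  have "comp_pred (\<lambda>t. \<not> P (snd t) (fst t))"
    using comp_fun_comp [OF assms(1) [unfolded comp_pred_def] comp_fun_Pair [OF comp_fun_snd [OF comp_fun_id] comp_fun_fst [OF comp_fun_id]]]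
    by (intro comp_pred_not) (simp add: comp_pred_def)
  then obtain p where p: "\<And>t. rec_eval p [enc t] (of_bool (\<not> P (snd t) (fst t)))"
    unfolding comp_pred_def comp_fun_def enc_nat_def by blast
  let ?q = "Comp p [pair_prog (Proj 0) (Proj 1)]"
  have q: "rec_eval ?q [n, enc x] (of_bool (\<not> P x n))" for n x
  proof (rule rec_comp1)
    have "rec_eval (pair_prog (Proj 0) (Proj 1)) [n, enc x] (prod_encode (n, enc x))"
      by (intro pair_prog rec_proj) auto
    then show "rec_eval (pair_prog (Proj 0) (Proj 1)) [n, enc x] (enc (n, x))"
      by (simp add: enc_prod_def enc_nat_def)
    show "rec_eval p [enc (n, x)] (of_bool (\<not> P x n))" using p [of "(n, x)"] by simp
  qed
  have "rec_eval (Mu ?q) [enc x] (LEAST n. P x n)" for x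
  proof (rule rec_eval.mu)
    show "rec_eval ?q [LEAST n. P x n, enc x] 0"
      using q [of "LEAST n. P x n" x] LeastI_ex [OF assms(2) [of x]] by simp
    show "\<forall>m<LEAST n. P x n. \<exists>y. rec_eval ?q [m, enc x] y \<and> 0 < y"
    proof (intro allI impI exI conjI)
      fix m assume "m < (LEAST n. P x n)"
      then have "\<not> P x m" by (rule not_less_Least)
      then show "rec_eval ?q [m, enc x] 1" using q [of m x] by simp
    qed simp
  qed
  then show ?thesis unfolding comp_fun_def enc_nat_def by blast
qed


section \<open>Computable functions on lists\<close>

lemma comp_fun_Cons [computability_intros]: "comp_fun f \<Longrightarrow> comp_fun g \<Longrightarrow> comp_fun (\<lambda>x. f x # g x)"
proof -
  assume fg: "comp_fun f" "comp_fun g"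
  have eq: "f x # g x = dec (Suc (enc (f x, g x)))" for x
    by (simp flip: enc_Cons)
  show ?thesis unfolding eq by (intro computability_intros fg)
qed

text \<open>A list has code 0 or the successor of the code of its head and tail, so recursion on the
  code acts as the case distinction.\<close>

lemma comp_fun_case_list [computability_intros]:
  fixes g :: "'a::encodable \<Rightarrow> 'b::encodable \<Rightarrow> 'b list \<Rightarrow> 'c::encodable"
  assumes "comp_fun l" "comp_fun f" "comp_fun (\<lambda>t. g (fst t) (fst (snd t)) (snd (snd t)))"
  shows "comp_fun (\<lambda>x. case l x of [] \<Rightarrow> f x | y # ys \<Rightarrow> g x y ys)"
proof -
  have eq: "(case l x of [] \<Rightarrow> f x | y # ys \<Rightarrow> g x y ys) =
      rec_nat (f x) (\<lambda>n _. g x (fst (dec n :: 'b \<times> 'b list)) (snd (dec n :: 'b \<times> 'b list))) (enc (l x))" for x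
    by (cases "l x") (auto simp: enc_Nil enc_Cons)
  have "comp_fun (\<lambda>t :: 'a \<times> nat \<times> 'c. g (fst t) (fst (dec (fst (snd t)) :: 'b \<times> 'b list))
      (snd (dec (fst (snd t)) :: 'b \<times> 'b list)))"
    using comp_fun_comp [OF assms(3), of "\<lambda>t :: 'a \<times> nat \<times> 'c. (fst t, dec (fst (snd t)))"] by (simp add: computability_intros)
  then show ?thesis unfolding eq by (intro comp_fun_rec_nat comp_fun_enc assms)
qed

lemma length_le_enc: "length xs \<le> enc xs" for xs :: "'a::encodable list"
proof (induction xs)
  case (Cons x xs)
  then show ?case
    using le_prod_encode_2 [of "enc xs" "enc x"] by (simp add: enc_Cons enc_prod_def)
qed simp

text \<open>The state is the remaining list with the accumulator. The code of the list bounds its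
  length and serves as the number of rounds; an exhausted list leaves the state fixed.\<close>

lemma comp_fun_foldl [computability_intros]:
  assumes "comp_fun l" "comp_fun a" "comp_fun (\<lambda>t. g (fst t) (fst (snd t)) (snd (snd t)))"
  shows "comp_fun (\<lambda>x. foldl (\<lambda>b y. g x b y) (a x) (l x))"
proof -
  let ?step = "\<lambda>x t. case fst t of [] \<Rightarrow> t | y # ys \<Rightarrow> (ys, g x (snd t) y)"
  have "rec_nat (l, b) (\<lambda>_ t. ?step x t) n = (drop n l, foldl (g x) b (take n l))" for x n l b
  proof (induction n)
    case (Suc n)
    show ?case
    proof (cases "n < length l")
      case True
      then show ?thesis
        by (simp add: Suc take_Suc_conv_app_nth Cons_nth_drop_Suc [symmetric])
    qed (simp add: Suc)
  qed simp
  then have eq: "foldl (g x) (a x) (l x) = snd (rec_nat (l x, a x) (\<lambda>_ t. ?step x t) (enc (l x)))" for x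
    by (simp add: length_le_enc)
  have "comp_fun (\<lambda>s. g (fst (fst s)) (snd (snd (snd (fst s)))) (fst (snd s)))"
    using comp_fun_comp [OF assms(3), of "\<lambda>s. (fst (fst s), snd (snd (snd (fst s))), fst (snd s))"]
    by (simp add: computability_intros)
  then show ?thesis unfolding eq
    by (intro computability_intros assms)
qed

lemma comp_fun_rev [computability_intros]: "comp_fun l \<Longrightarrow> comp_fun (\<lambda>x. rev (l x))"
proof -
  assume l: "comp_fun l"
  have eq: "rev (l x) = foldl (\<lambda>ys y. y # ys) [] (l x)" for x
    by (simp add: rev_conv_fold foldl_conv_fold)
  show ?thesis unfolding eq by (intro computability_intros l)
qed

lemma comp_fun_foldr [computability_intros]:
  assumes "comp_fun l" "comp_fun a" "comp_fun (\<lambda>t. g (fst t) (fst (snd t)) (snd (snd t)))"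
  shows "comp_fun (\<lambda>x. foldr (\<lambda>y b. g x y b) (l x) (a x))"
proof -
  have eq: "foldr (g x) (l x) (a x) = foldl (\<lambda>b y. g x y b) (a x) (rev (l x))" for x
    by (simp add: foldr_conv_fold foldl_conv_fold)
  have "comp_fun (\<lambda>t. g (fst t) (snd (snd t)) (fst (snd t)))"
    using comp_fun_comp [OF assms(3), of "\<lambda>t. (fst t, snd (snd t), fst (snd t))"] by (simp add: computability_intros)
  then show ?thesis unfolding eq by (intro comp_fun_foldl comp_fun_rev assms)
qed

lemma comp_fun_append [computability_intros]: "comp_fun l \<Longrightarrow> comp_fun m \<Longrightarrow> comp_fun (\<lambda>x. l x @ m x)"
proof -
  assume lm: "comp_fun l" "comp_fun m"
  have eq: "l x @ m x = foldr (\<lambda>y b. y # b) (l x) (m x)" for x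
    by (simp add: foldr_conv_fold fold_Cons_rev)
  show ?thesis unfolding eq by (intro computability_intros lm)
qed

lemma comp_fun_map [computability_intros]:
  assumes "comp_fun l" "comp_fun (\<lambda>t. f (fst t) (snd t))"
  shows "comp_fun (\<lambda>x. map (\<lambda>y. f x y) (l x))"
proof -
  have eq: "map (f x) ys = foldr (\<lambda>y b. f x y # b) ys []" for x ys
    by (induction ys) auto
  have "comp_fun (\<lambda>t. f (fst t) (fst (snd t)))"
    using comp_fun_comp [OF assms(2), of "\<lambda>t. (fst t, fst (snd t))"] by (simp add: computability_intros)
  then show ?thesis unfolding eq by (intro computability_intros assms)
qed

lemma comp_fun_concat [computability_intros]: "comp_fun l \<Longrightarrow> comp_fun (\<lambda>x. concat (l x))"
proof -
  assume l: "comp_fun l"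
  have eq: "concat (l x) = foldr (\<lambda>y b. y @ b) (l x) []" for x
    by (simp add: concat_conv_foldr)
  show ?thesis unfolding eq by (intro computability_intros l)
qed

lemma comp_pred_list_all [computability_intros]:
  assumes "comp_fun l" "comp_pred (\<lambda>t. P (fst t) (snd t))"
  shows "comp_pred (\<lambda>x. list_all (\<lambda>y. P x y) (l x))"
proof -
  have eq: "of_bool (list_all (P x) ys) = foldr (\<lambda>y b. if P x y then b else 0 :: nat) ys 1" for x ys
    by (induction ys) auto
  have P: "comp_pred (\<lambda>t :: _ \<times> _ \<times> nat. P (fst t) (fst (snd t)))"
    using comp_fun_comp [OF assms(2) [unfolded comp_pred_def] comp_fun_Pair [OF comp_fun_fst [OF comp_fun_id] comp_fun_fst [OF comp_fun_snd [OF comp_fun_id]]]]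
    unfolding comp_pred_def by (simp only: fst_conv snd_conv)
  show ?thesis unfolding comp_pred_def eq by (intro computability_intros assms P)
qed

lemma comp_pred_list_ex [computability_intros]:
  assumes "comp_fun l" "comp_pred (\<lambda>t. P (fst t) (snd t))"
  shows "comp_pred (\<lambda>x. list_ex (\<lambda>y. P x y) (l x))"
proof -
  have eq: "list_ex (P x) (l x) = (\<not> list_all (\<lambda>y. \<not> P x y) (l x))" for x
    by (simp add: list_ex_iff list_all_iff)
  show ?thesis unfolding eq by (intro computability_intros assms)
qed

lemma comp_fun_length [computability_intros]: "comp_fun l \<Longrightarrow> comp_fun (\<lambda>x. length (l x))"
proof -
  assume l: "comp_fun l"
  have eq: "length ys = foldr (\<lambda>_ n. Suc n) ys 0" for ys :: "'b list"
    by (induction ys) auto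
  show ?thesis unfolding eq by (intro computability_intros l)
qed

lemma comp_fun_funpow [computability_intros]:
  fixes f :: "'a::encodable \<Rightarrow> 'b::encodable \<Rightarrow> 'b"
  assumes "comp_fun n" "comp_fun a" "comp_fun (\<lambda>t. f (fst t) (snd t))"
  shows "comp_fun (\<lambda>x. ((\<lambda>y. f x y) ^^ n x) (a x))"
proof -
  have eq: "(f x ^^ k) b = rec_nat b (\<lambda>_ y. f x y) k" for x k b
    by (induction k) auto
  have "comp_fun (\<lambda>t. f (fst t) (snd (snd t)))"
    using comp_fun_comp [OF assms(3), of "\<lambda>t. (fst t, snd (snd t))"] by (simp add: computability_intros)
  then show ?thesis unfolding eq by (intro computability_intros assms)
qed

lemma comp_fun_drop [computability_intros]: "comp_fun n \<Longrightarrow> comp_fun l \<Longrightarrow> comp_fun (\<lambda>x. drop (n x) (l x))"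
proof -
  assume nl: "comp_fun n" "comp_fun l"
  have eq: "drop k ys = ((\<lambda>zs. case zs of [] \<Rightarrow> [] | z # zs' \<Rightarrow> zs') ^^ k) ys" for k and ys :: "'b list"
  proof (induction k arbitrary: ys)
    case (Suc k)
    from Suc [of "[]"] Suc [of "tl ys"] show ?case
      by (cases ys) (simp_all add: funpow_Suc_right del: funpow.simps)
  qed simp
  show ?thesis unfolding eq by (intro computability_intros nl)
qed

lemma comp_fun_take [computability_intros]: "comp_fun n \<Longrightarrow> comp_fun l \<Longrightarrow> comp_fun (\<lambda>x. take (n x) (l x))"
proof -
  assume nl: "comp_fun n" "comp_fun l"
  have eq: "take (n x) (l x) = rev (drop (length (l x) - n x) (rev (l x)))" for x
    by (cases "n x \<le> length (l x)") (simp_all add: rev_drop)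
  show ?thesis unfolding eq by (intro computability_intros nl)
qed

lemma comp_fun_upt [computability_intros]: "comp_fun n \<Longrightarrow> comp_fun (\<lambda>x. [0..<n x])"
proof -
  assume n: "comp_fun n"
  have eq: "[0..<k] = rec_nat [] (\<lambda>i ys. ys @ [i]) k" for k by (induction k) auto
  show ?thesis unfolding eq by (intro computability_intros n)
qed

subsection \<open>Deciding area and corollas\<close>


text \<open>The inversion \<open>i\<close> is a parameter here and below: with \<open>linv\<close>
  the algorithms are compared with the definitions on words, with \<open>letter_inv\<close> they run
  on codes.\<close>

definition cancel_alg :: "('l \<Rightarrow> 'l) \<Rightarrow> 'l \<Rightarrow> 'l list \<Rightarrow> 'l list" where
  "cancel_alg i l w = (case w of [] \<Rightarrow> [l] | m # w' \<Rightarrow> if m = i l then w' else l # w)"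

definition reduce_alg :: "('l \<Rightarrow> 'l) \<Rightarrow> 'l list \<Rightarrow> 'l list" where
  "reduce_alg i w = foldr (\<lambda>l v. cancel_alg i l v) w []"

definition strip_alg :: "('l \<Rightarrow> 'l) \<Rightarrow> 'l list \<Rightarrow> 'l list" where
  "strip_alg i w = (case w of [] \<Rightarrow> [] | m # w' \<Rightarrow>
    (case rev w' of [] \<Rightarrow> w | n # v \<Rightarrow> if n = i m then rev v else w))"

text \<open>Each round removes two letters or has reached a fixed point, so \<open>length w\<close>
  rounds suffice.\<close>

definition core_alg :: "('l \<Rightarrow> 'l) \<Rightarrow> 'l list \<Rightarrow> 'l list" where
  "core_alg i w = ((\<lambda>v. strip_alg i v) ^^ length w) w"

definition insertions :: "'l list \<Rightarrow> 'l list \<Rightarrow> 'l list list" where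
  "insertions r w = map (\<lambda>k. take k w @ r @ drop k w) [0..<Suc (length w)]"

definition insert_step :: "'l list list \<Rightarrow> 'l list list \<Rightarrow> 'l list list" where
  "insert_step C ws = ws @ concat (map (\<lambda>w. concat (map (\<lambda>r. insertions r w) C)) ws)"

definition area_alg :: "('l \<Rightarrow> 'l) \<Rightarrow> 'l list list \<Rightarrow> nat \<Rightarrow> 'l list \<Rightarrow> bool" where
  "area_alg i C k w \<longleftrightarrow> list_ex (\<lambda>v. reduce_alg i v = []) (((\<lambda>ws. insert_step C ws) ^^ k) [w])"

definition rotations :: "'l list \<Rightarrow> 'l list list" where
  "rotations w = map (\<lambda>k. drop k w @ take k w) [0..<Suc (length w)]"

text \<open>Comparing lists of at most one letter expresses that the last letter of \<open>u\<close>
  is inverse to the first of \<open>v\<close> without partial functions.\<close>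

definition glue_alg :: "('l \<Rightarrow> 'l) \<Rightarrow> 'l list \<Rightarrow> 'l list \<Rightarrow> 'l list list" where
  "glue_alg i u v = (if map (\<lambda>l. i l) (take 1 v) = drop (length u - 1) u \<and> reduce_alg i (u @ v) \<noteq> []
    then rotations (core_alg i (reduce_alg i (u @ v))) else [])"

definition corolla_step :: "('l \<Rightarrow> 'l) \<Rightarrow> 'l list list \<Rightarrow> 'l list list \<Rightarrow> 'l list list" where
  "corolla_step i C us = concat (map (\<lambda>u. concat (map (\<lambda>v. glue_alg i u v) C)) us)"

text \<open>The list \<open>C\<close> is already the first level, hence \<open>k - 1\<close>
  rounds.\<close>

definition corolla_alg :: "('l \<Rightarrow> 'l) \<Rightarrow> 'l list list \<Rightarrow> nat \<Rightarrow> 'l list list" where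
  "corolla_alg i C k = ((\<lambda>us. corolla_step i C us) ^^ (k - 1)) C"

definition short_lists :: "'l list \<Rightarrow> nat \<Rightarrow> 'l list list" where
  "short_lists L n = ((\<lambda>ws. [] # concat (map (\<lambda>w. map (\<lambda>l. l # w) L) ws)) ^^ n) [[]]"

text \<open>\<open>word_code\<close> gives the generator numbered \<open>m\<close> the codes
  \<open>2 * m + 1\<close> and, for its inverse, \<open>2 * m\<close>.\<close>

definition letter_inv :: "nat \<Rightarrow> nat" where
  "letter_inv n = (if even n then Suc n else n - 1)"

lemma comp_fun_unary: "comp_fun (\<lambda>y. F y) \<Longrightarrow> comp_fun f \<Longrightarrow> comp_fun (\<lambda>x. F (f x))"
  by (rule comp_fun_comp)

lemma comp_fun_binary:
  assumes "comp_fun (\<lambda>t. F (fst t) (snd t))" "comp_fun f" "comp_fun g"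
  shows "comp_fun (\<lambda>x. F (f x) (g x))"
  using comp_fun_comp [OF assms(1) comp_fun_Pair [OF assms(2,3)]] by simp

lemma comp_fun_letter_inv [computability_intros]: "comp_fun f \<Longrightarrow> comp_fun (\<lambda>x. letter_inv (f x))"
proof (rule comp_fun_unary [of letter_inv])
  have eq: "even n = (rec_nat 1 (\<lambda>_ b. 1 - b) n = (1 :: nat))" for n
  proof -
    have "rec_nat 1 (\<lambda>_ b. 1 - b) n = (of_bool (even n) :: nat)" by (induction n) auto
    then show ?thesis by simp
  qed
  show "comp_fun letter_inv" unfolding letter_inv_def [abs_def] eq by (intro computability_intros)
qed

lemma comp_fun_cancel_alg [computability_intros]: "comp_fun f \<Longrightarrow> comp_fun g \<Longrightarrow> comp_fun (\<lambda>x. cancel_alg letter_inv (f x) (g x))"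
  by (rule comp_fun_binary [of "cancel_alg letter_inv"]) (unfold cancel_alg_def, intro computability_intros)

lemma comp_fun_reduce_alg [computability_intros]: "comp_fun f \<Longrightarrow> comp_fun (\<lambda>x. reduce_alg letter_inv (f x))"
  unfolding reduce_alg_def by (intro computability_intros)

lemma comp_fun_strip_alg [computability_intros]: "comp_fun f \<Longrightarrow> comp_fun (\<lambda>x. strip_alg letter_inv (f x))"
  by (rule comp_fun_unary [of "strip_alg letter_inv"]) (unfold strip_alg_def, intro computability_intros)

lemma comp_fun_core_alg [computability_intros]: "comp_fun f \<Longrightarrow> comp_fun (\<lambda>x. core_alg letter_inv (f x))"
  unfolding core_alg_def by (intro computability_intros)

lemma comp_fun_insertions [computability_intros]: "comp_fun f \<Longrightarrow> comp_fun g \<Longrightarrow> comp_fun (\<lambda>x. insertions (f x) (g x))"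
  by (rule comp_fun_binary [of insertions]) (unfold insertions_def, intro computability_intros)

lemma comp_fun_insert_step [computability_intros]: "comp_fun f \<Longrightarrow> comp_fun (\<lambda>x. insert_step C (f x))"
  by (rule comp_fun_unary [of "insert_step C"]) (unfold insert_step_def, intro computability_intros)

lemma comp_pred_area_alg [computability_intros]: "comp_fun f \<Longrightarrow> comp_fun g \<Longrightarrow> comp_pred (\<lambda>x. area_alg letter_inv C (f x) (g x))"
  unfolding area_alg_def by (intro computability_intros)

lemma comp_fun_rotations [computability_intros]: "comp_fun f \<Longrightarrow> comp_fun (\<lambda>x. rotations (f x))"
  by (rule comp_fun_unary [of rotations]) (unfold rotations_def, intro computability_intros)

lemma comp_fun_glue_alg [computability_intros]: "comp_fun f \<Longrightarrow> comp_fun g \<Longrightarrow> comp_fun (\<lambda>x. glue_alg letter_inv (f x) (g x))"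
  by (rule comp_fun_binary [of "glue_alg letter_inv"]) (unfold glue_alg_def, intro computability_intros)

lemma comp_fun_corolla_step [computability_intros]: "comp_fun f \<Longrightarrow> comp_fun (\<lambda>x. corolla_step letter_inv C (f x))"
  unfolding corolla_step_def by (intro computability_intros)

lemma comp_fun_corolla_alg [computability_intros]: "comp_fun f \<Longrightarrow> comp_fun (\<lambda>x. corolla_alg letter_inv C (f x))"
  unfolding corolla_alg_def by (intro computability_intros)

lemma comp_fun_short_lists [computability_intros]: "comp_fun f \<Longrightarrow> comp_fun (\<lambda>x. short_lists L (f x))"
  unfolding short_lists_def by (intro computability_intros)

section \<open>Correctness of the algorithms on words\<close>

lemma set_short_lists: "set (short_lists L n) = {w. set w \<subseteq> set L \<and> length w \<le> n}"
proof (induction n)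
  case 0
  show ?case by (auto simp: short_lists_def)
next
  case (Suc n)
  have "short_lists L (Suc n) = [] # concat (map (\<lambda>w. map (\<lambda>l. l # w) L) (short_lists L n))"
    by (simp add: short_lists_def)
  then have "set (short_lists L (Suc n)) = insert [] {l # w | l w. l \<in> set L \<and> w \<in> set (short_lists L n)}"
    by auto
  also have "\<dots> = {w. set w \<subseteq> set L \<and> length w \<le> Suc n}"
  proof (intro Set.set_eqI)
    fix w show "w \<in> insert [] {l # w | l w. l \<in> set L \<and> w \<in> set (short_lists L n)} \<longleftrightarrow>
        w \<in> {w. set w \<subseteq> set L \<and> length w \<le> Suc n}"
      by (cases w) (auto simp: Suc)
  qed
  finally show ?case .
qed

lemma set_insertions: "set (insertions r w) = {w1 @ r @ w2 | w1 w2. w = w1 @ w2}"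
proof (intro Set.set_eqI iffI)
  fix v assume "v \<in> {w1 @ r @ w2 | w1 w2. w = w1 @ w2}"
  then obtain w1 w2 where "w = w1 @ w2" "v = w1 @ r @ w2" by blast
  then show "v \<in> set (insertions r w)"
    unfolding insertions_def by (auto intro!: image_eqI [of _ _ "length w1"] simp del: upt_Suc)
qed (auto simp: insertions_def simp del: upt_Suc intro: append_take_drop_id [symmetric])

lemma set_rotations: "v \<in> set (rotations w) \<longleftrightarrow> rot w v"
proof
  assume "v \<in> set (rotations w)"
  then obtain k where "v = drop k w @ take k w" by (auto simp: rotations_def simp del: upt_Suc)
  then show "rot w v" using rot_append [of "take k w" "drop k w"] by simp
next
  assume "rot w v"
  then obtain x y where "w = x @ y" "v = y @ x" by (rule rotE)
  then show "v \<in> set (rotations w)"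
    unfolding rotations_def by (auto intro!: image_eqI [of _ _ "length x"] simp del: upt_Suc)
qed

lemma reduce_alg_linv: "reduce_alg linv w = reduced_form w"
proof -
  have "cancel_alg linv l v = cancel_cons l v" for l and v :: "'a word"
    by (cases v) (auto simp: cancel_alg_def)
  then show ?thesis by (simp add: reduce_alg_def reduced_form_def)
qed


lemma strip_alg_cases:
  fixes w :: "'a word"
  assumes "reduced w"
  obtains (fixed) "strip_alg linv w = w" "cyclically_reduced w"
    | (shorter) "length (strip_alg linv w) < length w" "reduced (strip_alg linv w)"
        "fconj (fg w) (fg (strip_alg linv w))"
proof (cases w)
  case Nil
  then show thesis by (intro fixed) (auto simp: strip_alg_def cyclically_reduced_def)
next
  case (Cons m w')
  show thesis
  proof (cases w' rule: rev_cases)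
    case Nil
    with Cons show thesis by (intro fixed) (auto simp: strip_alg_def cyclically_reduced_def)
  next
    case (snoc v n)
    show thesis
    proof (cases "n = linv m")
      case True
      then have w: "w = m # v @ [linv m]" and strip: "strip_alg linv w = v"
        using Cons snoc by (auto simp: strip_alg_def)
      have red: "reduced v" using assms unfolding w by (simp add: reduced_Cons reduced_append_iff)
      have "fg w = fg [m] + fg v - fg [m]"
        unfolding w using fg_append [of "[m]" "v @ [linv m]"] by (simp add: group_norm)
      then have conj: "fconj (fg w) (fg v)" by (rule fconjI)
      have "length v < length w" unfolding w by simp
      then show thesis using red conj shorter unfolding strip by blast
    next
      case False
      then have "strip_alg linv w = w" "last w \<noteq> linv (hd w)"
        using Cons snoc by (auto simp: strip_alg_def)
      then show thesis using assms by (intro fixed) (auto simp: cyclically_reduced_def)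
    qed
  qed
qed

text \<open>Correct up to rotation is enough: cyclically reduced conjugates are rotations of one
  another, and \<open>glue_alg\<close> lists all rotations.\<close>

lemma core_alg_linv:
  assumes "reduced w"
  shows "cyclically_reduced (core_alg linv w) \<and> fconj (fg w) (fg (core_alg linv w))"
proof -
  have "cyclically_reduced ((strip_alg linv ^^ n) w) \<and> fconj (fg w) (fg ((strip_alg linv ^^ n) w))"
    if "length w \<le> n" for n
    using assms that
  proof (induction n arbitrary: w)
    case 0
    then show ?case by (simp add: cyclically_reduced_def)
  next
    case (Suc n)
    from Suc.prems(1) show ?case
    proof (cases rule: strip_alg_cases)
      case fixed
      have "(strip_alg linv ^^ k) w = w" for k by (induction k) (simp_all add: fixed)
      with fixed show ?thesis by simp
    next
      case shorter
      then show ?thesis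
        using Suc.IH [of "strip_alg linv w"] Suc.prems(2) fconj_trans [OF shorter(3)]
        by (auto simp: funpow_Suc_right simp del: funpow.simps)
    qed
  qed
  from this [of "length w"] show ?thesis by (simp add: core_alg_def)
qed

context presentation
begin

lemma area_alg_linv:
  assumes "set C = C_words R (Suc 0)"
  shows "area_alg linv C k w \<longleftrightarrow> filling R k (fg w)"
proof -
  \<comment> \<open>The claim is made for arbitrary starting lists because the induction performs
    the innermost insertion first.\<close>
  have "list_ex (\<lambda>v. reduce_alg linv v = []) ((insert_step C ^^ k) ws) \<longleftrightarrow> (\<exists>w\<in>set ws. filling R k (fg w))" for ws
  proof (induction k arbitrary: ws)
    case 0
    then show ?case by (simp add: list_ex_iff reduce_alg_linv filling_0_iff fg_eq_0_iff)
  next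
    case (Suc k)
    have step: "v \<in> set (insert_step C ws) \<longleftrightarrow> v \<in> set ws \<or>
        (\<exists>w\<in>set ws. \<exists>r\<in>C_words R (Suc 0). \<exists>w1 w2. v = w1 @ r @ w2 \<and> w = w1 @ w2)" for v
      by (simp add: insert_step_def set_insertions assms)
    have "(\<exists>v\<in>set (insert_step C ws). filling R k (fg v)) \<longleftrightarrow> (\<exists>w\<in>set ws. filling R (Suc k) (fg w))"
    proof
      assume "\<exists>v\<in>set (insert_step C ws). filling R k (fg v)"
      then obtain v where v: "filling R k (fg v)" and "v \<in> set (insert_step C ws)" by blast
      from this(2) show "\<exists>w\<in>set ws. filling R (Suc k) (fg w)"
        unfolding step
      proof (elim disjE bexE exE conjE)
        assume "v \<in> set ws"
        with v show ?thesis using filling_Suc_iff by blast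
      next
        fix w r w1 w2 assume w: "w \<in> set ws" "r \<in> C_words R (Suc 0)" "v = w1 @ r @ w2" "w = w1 @ w2"
        then have "filling R (Suc k) (fg w)" using v unfolding filling_Suc_iff by blast
        with w(1) show ?thesis by blast
      qed
    next
      assume "\<exists>w\<in>set ws. filling R (Suc k) (fg w)"
      then obtain w where w: "w \<in> set ws" and "filling R (Suc k) (fg w)" by blast
      from this(2) show "\<exists>v\<in>set (insert_step C ws). filling R k (fg v)"
        unfolding filling_Suc_iff
      proof (elim disjE exE conjE)
        assume "filling R k (fg w)"
        then show ?thesis using w step by blast
      next
        fix w1 w2 r assume r: "w = w1 @ w2" "r \<in> C_words R (Suc 0)" "filling R k (fg (w1 @ r @ w2))"
        have "w1 @ r @ w2 \<in> set (insert_step C ws)" unfolding step using w r(1,2) by blast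
        with r(3) show ?thesis by (rule bexI)
      qed
    qed
    with Suc show ?case by (simp add: funpow_Suc_right del: funpow.simps)
  qed
  from this [of "[w]"] show ?thesis by (simp add: area_alg_def)
qed

lemma corolla_alg_linv:
  assumes C: "set C = C_words R (Suc 0)"
  shows "set (corolla_alg linv C (Suc k)) = C_words R (Suc k)"
proof (induction k)
  case 0
  show ?case by (simp add: corolla_alg_def C)
next
  case (Suc k)
  have step: "corolla_alg linv C (Suc (Suc k)) = corolla_step linv C (corolla_alg linv C (Suc k))"
    by (simp add: corolla_alg_def)
  have glue: "c \<in> set (glue_alg linv u v) \<longleftrightarrow> cyclically_reduced c \<and> last u = linv (hd v) \<and> fg u + fg v \<noteq> 0 \<and>
      fconj (fg c) (fg u + fg v)" if "u \<noteq> []" "v \<noteq> []" for c u v :: "'a word"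
  proof -
    have junction: "map linv (take 1 v) = drop (length u - 1) u \<longleftrightarrow> last u = linv (hd v)"
      using that by (cases v; cases u rule: rev_cases) auto
    let ?core = "core_alg linv (reduced_form (u @ v))"
    have core: "cyclically_reduced ?core" "fconj (fg u + fg v) (fg ?core)"
      using core_alg_linv [OF reduced_reduced_form [of "u @ v"]] by auto
    have "rot ?core c \<longleftrightarrow> cyclically_reduced c \<and> fconj (fg c) (fg u + fg v)"
    proof
      assume r: "rot ?core c"
      then show "cyclically_reduced c \<and> fconj (fg c) (fg u + fg v)"
        using core rot_cyclically_reduced fconj_rot [OF r] fconj_trans fconj_sym by blast
    next
      assume "cyclically_reduced c \<and> fconj (fg c) (fg u + fg v)"
      then show "rot ?core c"
        using core fconj_cyclically_reduced_imp_rot [of c ?core] fconj_trans rot_sym by blast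
    qed
    moreover have "reduced_form (u @ v) \<noteq> [] \<longleftrightarrow> fg u + fg v \<noteq> 0"
      using fg_eq_0_iff [of "u @ v"] by simp
    ultimately show ?thesis
      unfolding glue_alg_def junction reduce_alg_linv by (auto simp: set_rotations)
  qed
  have "c \<in> set (corolla_alg linv C (Suc (Suc k))) \<longleftrightarrow>
      (\<exists>u\<in>C_words R (Suc k). \<exists>v\<in>C_words R (Suc 0). c \<in> set (glue_alg linv u v))" for c
    unfolding step corolla_step_def by (simp add: Suc C)
  moreover have "(\<exists>u\<in>C_words R (Suc k). \<exists>v\<in>C_words R (Suc 0). c \<in> set (glue_alg linv u v)) \<longleftrightarrow>
      c \<in> C_words R (Suc (Suc k))" for c
  proof -
    have "c \<in> set (glue_alg linv u v) \<longleftrightarrow> cyclically_reduced c \<and> last u = linv (hd v) \<and> fg u + fg v \<noteq> 0 \<and>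
        fconj (fg c) (fg u + fg v)" if "u \<in> C_words R (Suc k)" "v \<in> C_words R (Suc 0)" for u v
      using glue that C_words_cyclically_reduced by blast
    then show ?thesis unfolding C_words_Suc_Suc_iff by (simp cong: bex_cong)
  qed
  ultimately show ?case by (simp add: Set.set_eq_iff)
qed

end

text \<open>The algorithms inspect letters only through equality and inversion, so they commute with
  a map that is injective on an inversion-closed set of letters and respects inversion.\<close>

locale renaming =
  fixes f :: "'l \<Rightarrow> 'm" and L :: "'l set" and i :: "'l \<Rightarrow> 'l" and j :: "'m \<Rightarrow> 'm"
  assumes inj: "inj_on f L" and closed: "l \<in> L \<Longrightarrow> i l \<in> L" and commute: "l \<in> L \<Longrightarrow> f (i l) = j (f l)"
begin

lemma inj_lists: "inj_on (map f) (lists L)"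
  using inj by (rule inj_on_map_lists)

lemma map_eq_iff: "u \<in> lists L \<Longrightarrow> v \<in> lists L \<Longrightarrow> map f u = map f v \<longleftrightarrow> u = v"
  using inj_lists by (auto dest: inj_onD)

lemma image_eq_iff: "l \<in> L \<Longrightarrow> m \<in> L \<Longrightarrow> f m = j (f l) \<longleftrightarrow> m = i l"
  using closed commute inj by (metis inj_onD)

lemma cancel_alg:
  assumes "l \<in> L" "w \<in> lists L"
  shows "cancel_alg j (f l) (map f w) = map f (cancel_alg i l w) \<and> cancel_alg i l w \<in> lists L"
proof (cases w)
  case (Cons m v)
  have "f m = j (f l) \<longleftrightarrow> m = i l"
    using assms Cons image_eq_iff by simp
  with Cons assms show ?thesis by (auto simp: cancel_alg_def)
qed (use assms in \<open>auto simp: cancel_alg_def\<close>)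

lemma reduce_alg:
  "w \<in> lists L \<Longrightarrow> reduce_alg j (map f w) = map f (reduce_alg i w) \<and> reduce_alg i w \<in> lists L"
proof (induction w)
  case (Cons l w)
  then show ?case
    using cancel_alg [of l "reduce_alg i w"] by (simp add: reduce_alg_def)
qed (simp add: reduce_alg_def)

lemma strip_alg:
  assumes "w \<in> lists L"
  shows "strip_alg j (map f w) = map f (strip_alg i w) \<and> strip_alg i w \<in> lists L"
proof (cases w)
  case (Cons m v)
  show ?thesis
  proof (cases v rule: rev_cases)
    case (snoc v' n)
    have "f n = j (f m) \<longleftrightarrow> n = i m"
      using assms Cons snoc image_eq_iff by simp
    with Cons snoc assms show ?thesis by (auto simp: strip_alg_def rev_map)
  qed (use Cons assms in \<open>auto simp: strip_alg_def\<close>)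
qed (use assms in \<open>auto simp: strip_alg_def\<close>)

lemma core_alg:
  assumes "w \<in> lists L"
  shows "core_alg j (map f w) = map f (core_alg i w) \<and> core_alg i w \<in> lists L"
proof -
  have "(strip_alg j ^^ n) (map f w) = map f ((strip_alg i ^^ n) w) \<and> (strip_alg i ^^ n) w \<in> lists L" for n
    by (induction n) (use assms strip_alg in auto)
  then show ?thesis by (simp add: core_alg_def)
qed

lemma insert_step_map: "insert_step (map (map f) C) (map (map f) ws) = map (map f) (insert_step C ws)"
proof -
  have ins: "insertions (map f r) (map f w) = map (map f) (insertions r w)" for r w
    by (simp add: insertions_def take_map drop_map del: upt_Suc)
  then show ?thesis by (simp add: insert_step_def map_concat comp_def)
qed

lemma insert_step_lists:
  assumes "set C \<subseteq> lists L" "set ws \<subseteq> lists L"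
  shows "set (insert_step C ws) \<subseteq> lists L"
proof
  fix v assume "v \<in> set (insert_step C ws)"
  then consider "v \<in> set ws" | w r where "w \<in> set ws" "r \<in> set C" "v \<in> set (insertions r w)"
    by (auto simp: insert_step_def)
  then show "v \<in> lists L"
  proof cases
    case 1
    with assms show ?thesis by blast
  next
    case 2
    then have "w \<in> lists L" "r \<in> lists L" using assms by blast+
    with 2(3) show ?thesis by (auto simp: set_insertions)
  qed
qed

lemma area_alg:
  assumes "set C \<subseteq> lists L" "w \<in> lists L"
  shows "area_alg j (map (map f) C) k (map f w) \<longleftrightarrow> area_alg i C k w"
proof -
  have *: "(insert_step (map (map f) C) ^^ k) [map f w] = map (map f) ((insert_step C ^^ k) [w]) \<and>
      set ((insert_step C ^^ k) [w]) \<subseteq> lists L"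
  proof (induction k)
    case (Suc k)
    then show ?case using insert_step_lists [OF assms(1)] by (simp add: insert_step_map)
  qed (use assms in simp)
  then have "reduce_alg j (map f v) = [] \<longleftrightarrow> reduce_alg i v = []" if "v \<in> set ((insert_step C ^^ k) [w])" for v
    using reduce_alg [of v] that by (metis (no_types, lifting) Nil_is_map_conv subsetD)
  with * show ?thesis by (auto simp: area_alg_def list_ex_iff)
qed

lemma glue_alg:
  assumes "u \<in> lists L" "v \<in> lists L"
  shows "glue_alg j (map f u) (map f v) = map (map f) (glue_alg i u v) \<and> set (glue_alg i u v) \<subseteq> lists L"
proof -
  have uv: "u @ v \<in> lists L" using assms by simp
  note red = reduce_alg [OF uv]
  note core = core_alg [OF conjunct2 [OF red]]
  have "map j (take 1 (map f v)) = map f (map i (take 1 v))"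
    using assms commute by (cases v) auto
  moreover have "map i (take 1 v) \<in> lists L"
    using assms closed by (cases v) auto
  moreover have "drop (length u - 1) u \<in> lists L"
    using assms by (auto dest: in_set_dropD)
  ultimately have junction: "map j (take 1 (map f v)) = drop (length (map f u) - 1) (map f u) \<longleftrightarrow>
      map i (take 1 v) = drop (length u - 1) u"
    using map_eq_iff by (simp only: drop_map length_map)
  have rots: "rotations (map f w) = map (map f) (rotations w)" for w
    by (simp add: rotations_def take_map drop_map del: upt_Suc)
  have rots_lists: "set (rotations w) \<subseteq> lists L" if "w \<in> lists L" for w
    using that by (auto simp: rotations_def simp del: upt_Suc) (meson in_set_dropD, meson in_set_takeD)
  show ?thesis
  proof (cases "map i (take 1 v) = drop (length u - 1) u \<and> reduce_alg i (u @ v) \<noteq> []")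
    case True
    then have "glue_alg i u v = rotations (core_alg i (reduce_alg i (u @ v)))" by (simp add: glue_alg_def)
    moreover have "glue_alg j (map f u) (map f v) = rotations (core_alg j (reduce_alg j (map f (u @ v))))"
      unfolding glue_alg_def junction using True red by simp
    ultimately show ?thesis using red core rots rots_lists by simp
  next
    case False
    then have "glue_alg i u v = []" by (auto simp: glue_alg_def)
    moreover have "glue_alg j (map f u) (map f v) = []"
      unfolding glue_alg_def junction using False red by (auto simp flip: map_append)
    ultimately show ?thesis by simp
  qed
qed

lemma corolla_alg:
  assumes C: "set C \<subseteq> lists L"
  shows "corolla_alg j (map (map f) C) k = map (map f) (corolla_alg i C k) \<and> set (corolla_alg i C k) \<subseteq> lists L"
proof -
  have step: "corolla_step j (map (map f) C) (map (map f) us) = map (map f) (corolla_step i C us) \<and>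
      set (corolla_step i C us) \<subseteq> lists L" if us: "set us \<subseteq> lists L" for us
  proof -
    have eq: "glue_alg j (map f u) (map f v) = map (map f) (glue_alg i u v)" "set (glue_alg i u v) \<subseteq> lists L"
      if "u \<in> set us" "v \<in> set C" for u v
      using glue_alg us C that by blast+
    then have "map (\<lambda>v. glue_alg j (map f u) (map f v)) C = map (\<lambda>v. map (map f) (glue_alg i u v)) C"
      if "u \<in> set us" for u using that by simp
    then have "corolla_step j (map (map f) C) (map (map f) us) = map (map f) (corolla_step i C us)"
      unfolding corolla_step_def by (simp add: map_concat comp_def cong: map_cong)
    moreover have "set (corolla_step i C us) \<subseteq> lists L"
    proof
      fix x assume "x \<in> set (corolla_step i C us)"
      then obtain u v where "u \<in> set us" "v \<in> set C" "x \<in> set (glue_alg i u v)"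
        unfolding corolla_step_def by auto
      then show "x \<in> lists L" using eq(2) by blast
    qed
    ultimately show ?thesis ..
  qed
  have "(corolla_step j (map (map f) C) ^^ n) (map (map f) C) = map (map f) ((corolla_step i C ^^ n) C) \<and>
      set ((corolla_step i C ^^ n) C) \<subseteq> lists L" for n
    by (induction n) (use C step in auto)
  then show ?thesis by (simp add: corolla_alg_def)
qed

end

section \<open>Transfer to codes and the equivalence\<close>

definition letter_code :: "('a \<Rightarrow> nat) \<Rightarrow> 'a letter \<Rightarrow> nat" where
  "letter_code e = (\<lambda>(x, b). 2 * e x + of_bool b)"

lemma word_code_eq: "word_code e w = enc (map (letter_code e) w)"
  by (simp add: word_code_def enc_list_def letter_code_def enc_nat_def [abs_def])

text \<open>Turns a value into the outcome of a search for an upper bound.\<close>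

lemma Least_ge: "(LEAST k. n \<le> k) = (n :: nat)"
  by (rule Least_equality) auto

locale numbered_presentation = finite_presentation +
  fixes e :: "'a \<Rightarrow> nat"
  assumes inj_e: "inj_on e X"
begin

sublocale renaming "letter_code e" "X \<times> UNIV" linv letter_inv
proof
  show "inj_on (letter_code e) (X \<times> UNIV)"
  proof (rule inj_onI)
    fix p q assume "p \<in> X \<times> (UNIV :: bool set)" "q \<in> X \<times> (UNIV :: bool set)"
      and eq: "letter_code e p = letter_code e q"
    then obtain x b y c where pq: "p = (x, b)" "q = (y, c)" "x \<in> X" "y \<in> X" by auto
    with eq have "b = c \<and> e x = e y"
      by (cases b; cases c) (auto simp: letter_code_def, presburger+)
    with pq inj_e show "p = q" by (auto dest: inj_onD)
  qed
qed (auto simp: linv_def letter_code_def letter_inv_def)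

text \<open>An arbitrary enumeration will do: for a fixed presentation it is one constant, and
  constants are computable.\<close>

definition C_list :: "nat list list" where
  "C_list = map (map (letter_code e)) (SOME xs. set xs = C_words R (Suc 0))"

definition letter_list :: "nat list" where
  "letter_list = map (letter_code e) (SOME xs. set xs = X \<times> UNIV)"

lemma finite_C_words_1: "finite (C_words R (Suc 0))"
proof -
  have "cyclic_conjugates r = set (rotations r)" for r :: "'a word"
    by (auto simp: cyclic_conjugates_iff set_rotations)
  then show ?thesis using finite_R by (simp add: C_words.simps(2))
qed

lemma C_list_exists: "\<exists>xs. set xs = C_words R (Suc 0) \<and> C_list = map (map (letter_code e)) xs"
  unfolding C_list_def using someI_ex [OF finite_list [OF finite_C_words_1]] by blast

lemma set_letter_list: "set letter_list = letter_code e ` (X \<times> UNIV)"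
proof -
  have "finite (X \<times> (UNIV :: bool set))" using finite_X by simp
  from someI_ex [OF finite_list [OF this]] show ?thesis
    by (simp add: letter_list_def)
qed

lemma area_alg_iff:
  "w \<in> words X \<Longrightarrow> area_alg letter_inv C_list k (map (letter_code e) w) \<longleftrightarrow> filling R k (fg w)"
proof -
  assume w: "w \<in> words X"
  obtain xs where xs: "set xs = C_words R (Suc 0)" "C_list = map (map (letter_code e)) xs"
    using C_list_exists by blast
  have "set xs \<subseteq> lists (X \<times> UNIV)" using xs C_words_words_filling unfolding words_def by blast
  with w xs show ?thesis using area_alg [of xs w k] area_alg_linv [of xs k w] unfolding words_def by simp
qed

lemma corolla_alg_iff:
  assumes w: "w \<in> words X"
  shows "map (letter_code e) w \<in> set (corolla_alg letter_inv C_list (Suc k)) \<longleftrightarrow> w \<in> C_words R (Suc k)"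
proof -
  obtain xs where xs: "set xs = C_words R (Suc 0)" "C_list = map (map (letter_code e)) xs"
    using C_list_exists by blast
  have "set xs \<subseteq> lists (X \<times> UNIV)" using xs C_words_words_filling unfolding words_def by blast
  note c = corolla_alg [OF this, of "Suc k"] corolla_alg_linv [OF xs(1), of k]
  have "map (letter_code e) w \<in> map (letter_code e) ` C_words R (Suc k) \<longleftrightarrow> w \<in> C_words R (Suc k)"
    using c w inj_lists unfolding words_def by (intro inj_on_image_mem_iff) auto
  with c xs show ?thesis by simp
qed

lemma reduced_iff:
  "w \<in> words X \<Longrightarrow> reduce_alg letter_inv (map (letter_code e) w) = map (letter_code e) w \<longleftrightarrow> reduced w"
proof -
  assume w: "w \<in> words X"
  have "reduce_alg letter_inv (map (letter_code e) w) = map (letter_code e) w \<longleftrightarrow> reduced_form w = w"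
    using reduce_alg [of w] map_eq_iff [of "reduced_form w" w] w reduced_form_words [OF w]
    unfolding words_def by (simp add: reduce_alg_linv)
  then show ?thesis using reduced_form_reduced reduced_reduced_form by metis
qed

lemma short_lists_all:
  "list_all P (short_lists letter_list n) \<longleftrightarrow> (\<forall>w\<in>words X. length w \<le> n \<longrightarrow> P (map (letter_code e) w))"
proof -
  have "set (short_lists letter_list n) = map (letter_code e) ` {w \<in> words X. length w \<le> n}"
  proof (intro Set.set_eqI iffI)
    fix v assume "v \<in> set (short_lists letter_list n)"
    then have v: "v \<in> lists (letter_code e ` (X \<times> UNIV))" "length v \<le> n"
      by (auto simp: set_short_lists set_letter_list)
    from v(1) obtain w where "w \<in> words X" "v = map (letter_code e) w"
      unfolding words_def lists_image by blast
    with v(2) show "v \<in> map (letter_code e) ` {w \<in> words X. length w \<le> n}" by auto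
  next
    fix v assume "v \<in> map (letter_code e) ` {w \<in> words X. length w \<le> n}"
    then obtain w where w: "v = map (letter_code e) w" "set w \<subseteq> X \<times> UNIV" "length w \<le> n"
      by (auto simp: words_def)
    then show "v \<in> set (short_lists letter_list n)"
      using image_mono [OF w(2)] by (simp add: set_short_lists set_letter_list)
  qed
  then show ?thesis by (auto simp: list_all_iff)
qed

text \<open>Each maximum is the least \<open>k\<close> that passes a finite test over the words of
  length at most \<open>n\<close>; \<open>F\<close> tells which words the test concerns.\<close>

lemma dehn_computable:
  assumes F: "comp_fun F" and dec: "\<And>w. w \<in> words X \<Longrightarrow> reduced w \<Longrightarrow>
    F (word_code e w) = (if w \<in> relators X R then 1 else 0 :: nat)"
  shows "comp_fun (dehn X R)" and "comp_fun (dehn0 X R)"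
proof -
  \<comment> \<open>The assumption on \<open>F\<close> covers only codes of reduced words over
    \<open>X\<close>. The first two tests single these out, so \<open>rel\<close> is correct on
    every list of numbers.\<close>
  define rel where "rel v \<longleftrightarrow> list_all (\<lambda>l. list_ex (\<lambda>m. l = m) letter_list) v \<and>
    reduce_alg letter_inv v = v \<and> F (enc v) = 1" for v :: "nat list"
  have "comp_pred rel"
    unfolding rel_def [abs_def] by (intro computability_intros comp_fun_comp [OF F])
  then have comp_pred_rel: "comp_pred (\<lambda>x. rel (g x))" if "comp_fun g" for g :: "'c::encodable \<Rightarrow> nat list"
    using that unfolding comp_pred_def by (rule comp_fun_comp)
  have rel: "rel (map (letter_code e) w) \<longleftrightarrow> w \<in> relators X R" if w: "w \<in> words X" for w
  proof -
    have "list_all (\<lambda>l. list_ex (\<lambda>m. l = m) letter_list) (map (letter_code e) w)"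
      using w by (auto simp: list_all_iff list_ex_iff set_letter_list words_def)
    then show ?thesis
      using reduced_iff [OF w] dec [OF w] relators_eq unfolding rel_def word_code_eq by auto
  qed
  have rel_image: "\<exists>w\<in>words X. v = map (letter_code e) w" if "rel v" for v
  proof -
    have "v \<in> lists (letter_code e ` (X \<times> UNIV))"
      using \<open>rel v\<close> by (auto simp: rel_def list_all_iff list_ex_iff set_letter_list)
    then show ?thesis unfolding words_def lists_image by blast
  qed
  \<comment> \<open>The guard lets the search stop at 0 on lists that code no relator, so
    \<open>ar\<close> is total.\<close>
  define ar where "ar v = (LEAST k. rel v \<longrightarrow> area_alg letter_inv C_list k v)" for v
  have area_exists: "\<exists>k. rel v \<longrightarrow> area_alg letter_inv C_list k v" for v
    using rel_image [of v] rel area_alg_iff relators_eq by blast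
  have "comp_fun ar"
    unfolding ar_def [abs_def] by (intro computability_intros comp_pred_rel area_exists)
  then have comp_fun_ar: "comp_fun (\<lambda>x. ar (g x))" if "comp_fun g" for g :: "'c::encodable \<Rightarrow> nat list"
    using that by (rule comp_fun_comp)
  have ar: "ar (map (letter_code e) w) = area X R w" if w: "w \<in> relators X R" for w
  proof -
    have "w \<in> words X" using w relators_eq by blast
    then show ?thesis
      using w area_le_iff [OF w] by (simp add: ar_def rel area_alg_iff Least_ge flip: area_le_iff)
  qed
  \<comment> \<open>Area 0 is excluded because \<open>corolla_alg\<close> returns the first level
    for index 0 too, while \<open>C_words R 0\<close> is empty.\<close>
  define cor where "cor v \<longleftrightarrow> rel v \<and> ar v \<noteq> 0 \<and>
    list_ex (\<lambda>c. c = v) (corolla_alg letter_inv C_list (ar v))" for v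
  have "comp_pred cor"
    unfolding cor_def [abs_def] by (intro computability_intros comp_pred_rel comp_fun_ar)
  then have comp_pred_cor: "comp_pred (\<lambda>x. cor (g x))" if "comp_fun g" for g :: "'c::encodable \<Rightarrow> nat list"
    using that unfolding comp_pred_def by (rule comp_fun_comp)
  have cor: "cor (map (letter_code e) w) \<longleftrightarrow> proper_corolla X R w" if w: "w \<in> words X" for w
  proof (cases "w \<in> relators X R")
    case True
    show ?thesis
    proof (cases "area X R w")
      case 0
      then show ?thesis using True by (simp add: cor_def ar proper_corolla_iff)
    next
      case (Suc k)
      then show ?thesis
        using True corolla_alg_iff [OF w, of k] rel [OF w]
        by (auto simp: cor_def ar proper_corolla_iff list_ex_iff)
    qed
  next
    case False
    then show ?thesis using rel [OF w] by (simp add: cor_def proper_corolla_iff)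
  qed
  have dehn: "list_all (\<lambda>v. rel v \<longrightarrow> area_alg letter_inv C_list k v) (short_lists letter_list n) \<longleftrightarrow>
      dehn X R n \<le> k" for n k
    unfolding short_lists_all dehn_le_iff using rel area_alg_iff relators_eq by auto
  have dehn0: "list_all (\<lambda>v. cor v \<longrightarrow> area_alg letter_inv C_list k v) (short_lists letter_list n) \<longleftrightarrow>
      dehn0 X R n \<le> k" for n k
    unfolding short_lists_all dehn0_le_iff using cor area_alg_iff relators_eq proper_corolla_iff by auto
  have "comp_fun (\<lambda>n. LEAST k. list_all (\<lambda>v. rel v \<longrightarrow> area_alg letter_inv C_list k v) (short_lists letter_list n))"
    by (intro computability_intros comp_pred_rel) (auto simp: dehn)
  then show "comp_fun (dehn X R)" by (simp add: dehn Least_ge)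
  have "comp_fun (\<lambda>n. LEAST k. list_all (\<lambda>v. cor v \<longrightarrow> area_alg letter_inv C_list k v) (short_lists letter_list n))"
    by (intro computability_intros comp_pred_cor) (auto simp: dehn0)
  then show "comp_fun (dehn0 X R)" by (simp add: dehn0 Least_ge)
qed

end

theorem theorem5p1p1:
  fixes X :: "'a set" and R :: "'a word set"
  assumes "group_presentation X R" and "finite X" and "finite R"
  shows "(solvable_word_problem X R \<longleftrightarrow> computably_bounded (dehn0 X R)) \<and>
    (computably_bounded (dehn0 X R) \<longleftrightarrow> computable (dehn0 X R)) \<and>
    (computable (dehn X R) \<longleftrightarrow> computable (dehn0 X R)) \<and>
    (computably_bounded (dehn X R) \<longleftrightarrow> computably_bounded (dehn0 X R))"
proof -
  interpret finite_presentation X R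
    using assms by unfold_locales auto
  have swp: "computable (dehn X R)" "computable (dehn0 X R)" if "solvable_word_problem X R"
  proof -
    obtain e F where e: "inj_on e X" and F: "computable F"
      and dec: "\<And>w. w \<in> carrier (free_group X) \<Longrightarrow> F (word_code e w) = (if w \<in> relators X R then 1 else 0)"
      using \<open>solvable_word_problem X R\<close> unfolding solvable_word_problem_def decidable_subset_def by blast
    interpret numbered_presentation X R e using e by unfold_locales
    have "w \<in> words X \<Longrightarrow> reduced w \<Longrightarrow> F (word_code e w) = (if w \<in> relators X R then 1 else 0)" for w
      using dec by (simp add: free_group_def)
    with F show "computable (dehn X R)" "computable (dehn0 X R)"
      unfolding computable_iff_comp_fun using dehn_computable by blast+
  qed
  have bounded_swp: "solvable_word_problem X R" if bounded: "computably_bounded (dehn X R)"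
  proof -
    obtain g where g: "comp_fun g" "\<And>n. dehn X R n \<le> g n"
      using bounded unfolding computably_bounded_def computable_iff_comp_fun by blast
    obtain e :: "'a \<Rightarrow> nat" where e: "inj_on e X"
      using finite_imp_inj_to_nat_seg [OF assms(2)] by blast
    interpret numbered_presentation X R e using e by unfold_locales
    \<comment> \<open>Only relators have fillings, and a relator of length \<open>m\<close> has one
      with \<open>dehn X R m \<le> g m\<close> faces, so a single area test at \<open>g m\<close>
      decides.\<close>
    define F :: "nat \<Rightarrow> nat" where
      "F n = of_bool (area_alg letter_inv C_list (g (length (dec n :: nat list))) (dec n))" for n
    have "comp_fun F"
      unfolding F_def [abs_def] comp_pred_def [symmetric] by (intro computability_intros comp_fun_comp [OF g(1)])
    moreover have "F (word_code e w) = (if w \<in> relators X R then 1 else 0)"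
      if w: "w \<in> carrier (free_group X)" for w
    proof -
      have w': "w \<in> words X" "reduced w" using w by (simp_all add: free_group_def)
      have "filling R (g (length w)) (fg w) \<longleftrightarrow> w \<in> relators X R"
      proof
        assume "w \<in> relators X R"
        then have "filling R (dehn X R (length w)) (fg w)" using dehn_le_iff by blast
        then show "filling R (g (length w)) (fg w)" using g(2) by (rule filling_mono)
      qed (use w' relators_eq in blast)
      then show ?thesis using area_alg_iff [OF w'(1)] by (simp add: F_def word_code_eq)
    qed
    moreover have "relators X R \<subseteq> carrier (free_group X)"
      using relators_eq by (auto simp: free_group_def)
    ultimately show ?thesis
      unfolding solvable_word_problem_def decidable_subset_def computable_iff_comp_fun using e by blast
  qed
  have computable_bounded: "computably_bounded f" if "computable f" for f
    using that unfolding computably_bounded_def by blast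
  have "computably_bounded (dehn X R)" if bounded: "computably_bounded (dehn0 X R)"
  proof -
    obtain g where g: "comp_fun g" "\<And>n. dehn0 X R n \<le> g n"
      using bounded unfolding computably_bounded_def computable_iff_comp_fun by blast
    have "dehn X R n \<le> n * g n" for n
      using dehn_le_times_dehn0 [of n] g(2) [of n] by (meson mult_le_mono2 order_trans)
    moreover have "comp_fun (\<lambda>n. n * g n)" by (intro comp_fun_mult comp_fun_id g)
    ultimately show ?thesis unfolding computably_bounded_def computable_iff_comp_fun by blast
  qed
  moreover have "computably_bounded (dehn0 X R)" if "computably_bounded (dehn X R)"
    using that dehn0_le_dehn order_trans unfolding computably_bounded_def by metis
  ultimately show ?thesis using swp bounded_swp computable_bounded by blast
qed

end
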